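(* Let $\alpha:=\sup\{|\sigma^{-1}z|^2 : z\in\mathbb{R}^d,\ \|z\|=1\}$ and define $c\in(0,\infty)$ by $$\frac1c=\alpha\int_0^{R_1}\Phi(s)\varphi(s)^{-1}\,ds=\alpha\int_0^{R_1}\int_0^s\exp\Big(\frac14\int_t^s u\,\kappa(u)^-\,du\Big)\,dt\,ds .$$ Let $(X_t,Y_t)_{t\ge0}$ be a reflection coupling of two solutions of $dX_t=b(X_t)\,dt+\sigma\,dB_t$ (with an arbitrary joint initial distribution). Then the function $t\mapsto e^{ct}\,\mathbb{E}[d_f(X_t,Y_t)]$ is decreasing on $[0,\infty)$.
   Context: Setting. $\sigma\in\mathbb{R}^{d\times d}$ is a constant matrix with $\det\sigma>0$, $b:\mathbb{R}^d\to\mathbb{R}^d$ is locally Lipschitz continuous, $(B_t)$ is a $d$-dimensional Brownian motion, and the unique strong solution of $dX_t=b(X_t)\,dt+\sigma\,dB_t$ is assumed non-explosive for every initial condition. $|\cdot|$ is the Euclidean norm, $G\in\mathbb{R}^{d\times d}$ is a symmetric strictly positive definite matrix and $\|z\|=\sqrt{z\cdot Gz}$. For a real number $a$, $a^-=\max(-a,0)$. "Decreasing" means non-increasing. For $r\in(0,\infty)$, $$\kappa(r)=\inf\Big\{-2\,\frac{|\sigma^{-1}(x-y)|^2}{\|x-y\|^2}\,\frac{(x-y)\cdot G(b(x)-b(y))}{\|x-y\|^2} : x,y\in\mathbb{R}^d,\ \|x-y\|=r\Big\}.$$ It is assumed that $\kappa$ is a continuous (real-valued) function on $(0,\infty)$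 with $\liminf_{r\to\infty}\kappa(r)>0$ and $\int_0^1 r\kappa(r)^-\,dr<\infty$. Define $$R_0=\inf\{R\ge0:\kappa(r)\ge0\ \forall r\ge R\},\qquad R_1=\inf\{R\ge R_0:\kappa(r)R(R-R_0)\ge8\ \forall r\ge R\}$$ (with $r>0$ understood), which are finite, and for $r\ge 0$ $$\varphi(r)=\exp\Big(-\frac14\int_0^r s\kappa(s)^-ds\Big),\quad \Phi(r)=\int_0^r\varphi(s)\,ds,\quad g(r)=1-\frac12\int_0^{r\wedge R_1}\frac{\Phi(s)}{\varphi(s)}ds\Big/\int_0^{R_1}\frac{\Phi(s)}{\varphi(s)}ds,$$ $$f(r)=\int_0^r\varphi(s)g(s)\,ds,\qquad d_f(x,y)=f(\|x-y\|).$$ Reflection coupling. A reflection coupling of two solutions with initial distributions $\mu,\nu$ is a process $(X_t,Y_t)$ in $\mathbb{R}^{2d}$ with $(X_0,Y_0)\sim\eta$, where $\eta$ is a coupling of $\mu$ and $\nu$, satisfying $$dX_t=b(X_t)\,dt+\sigma\,dB_t\ (t\ge0),\qquad dY_t=b(Y_t)\,dt+\sigma(I-2e_te_t^\top)\,dB_t\ \text{ for }t<T,\qquad Y_t=X_t\ \text{ for }t\ge T,$$ where $e_t=\sigma^{-1}(X_t-Y_t)/|\sigma^{-1}(X_t-Y_t)|$ and $T=\inf\{t\ge0:X_t=Y_t\}$. *)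

theory Defs
  imports "HOL-Probability.Probability"
begin

text \<open>Time is real-valued; processes are only ever evaluated at nonnegative times, and the values
  of \<open>F\<close> at negative times carry no information (any filtration on \<open>{0..}\<close> extends by \<open>F 0\<close>).
  Neither completeness nor right-continuity of the filtration is required.\<close>

definition filtered_prob_space :: "'w measure \<Rightarrow> (real \<Rightarrow> 'w measure) \<Rightarrow> bool" where
  "filtered_prob_space M F \<longleftrightarrow>
     prob_space M \<and> filtration (space M) F \<and> (\<forall>t. subalgebra M (F t))"

definition adapted ::
    "(real \<Rightarrow> 'w measure) \<Rightarrow> (real \<Rightarrow> 'w \<Rightarrow> 'a::topological_space) \<Rightarrow> bool" where
  "adapted F X \<longleftrightarrow> (\<forall>t\<ge>0. X t \<in> borel_measurable (F t))"

definition progressive ::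
    "(real \<Rightarrow> 'w measure) \<Rightarrow> (real \<Rightarrow> 'w \<Rightarrow> 'a::topological_space) \<Rightarrow> bool" where
  "progressive F H \<longleftrightarrow>
     (\<forall>t\<ge>0. (\<lambda>(s, \<omega>). H s \<omega>) \<in> borel_measurable (restrict_space borel {0..t} \<Otimes>\<^sub>M F t))"

definition brownian_motion ::
    "'w measure \<Rightarrow> (real \<Rightarrow> 'w measure) \<Rightarrow> (real \<Rightarrow> 'w \<Rightarrow> real^'d) \<Rightarrow> bool" where
  "brownian_motion M F B \<longleftrightarrow>
     filtered_prob_space M F \<and> adapted F B \<and>
     (AE \<omega> in M. B 0 \<omega> = 0 \<and> continuous_on {0..} (\<lambda>t. B t \<omega>)) \<and>
     (\<forall>s t. 0 \<le> s \<and> s < t \<longrightarrow>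
        distributed M lborel (\<lambda>\<omega>. B t \<omega> - B s \<omega>)
          (\<lambda>x. ennreal (\<Prod>i\<in>UNIV. normal_density 0 (sqrt (t - s)) (x $ i))) \<and>
        prob_space.indep_set M (sets (F s))
          (sets (vimage_algebra (space M) (\<lambda>\<omega>. B t \<omega> - B s \<omega>) borel)))"

text \<open>Simple integrands \<open>\<Sum>i<n. \<xi> i * indicator {\<tau> i<..\<tau> (Suc i)}\<close> with deterministic times \<open>\<tau>\<close>
  and bounded coefficients \<open>\<xi> i\<close> known at time \<open>\<tau> i\<close>.\<close>

definition simple_integrand ::
    "'w measure \<Rightarrow> (real \<Rightarrow> 'w measure) \<Rightarrow> nat \<Rightarrow> (nat \<Rightarrow> real) \<Rightarrow> (nat \<Rightarrow> 'w \<Rightarrow> real^'d^'d) \<Rightarrow> bool"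
  where
  "simple_integrand M F n \<tau> \<xi> \<longleftrightarrow>
     0 \<le> \<tau> 0 \<and> (\<forall>i<n. \<tau> i < \<tau> (Suc i)) \<and>
     (\<forall>i<n. \<xi> i \<in> borel_measurable (F (\<tau> i)) \<and> bounded (\<xi> i ` space M))"

definition simple_process ::
    "nat \<Rightarrow> (nat \<Rightarrow> real) \<Rightarrow> (nat \<Rightarrow> 'w \<Rightarrow> real^'d^'d) \<Rightarrow> real \<Rightarrow> 'w \<Rightarrow> real^'d^'d" where
  "simple_process n \<tau> \<xi> s \<omega> = (\<Sum>i<n. indicator {\<tau> i<..\<tau> (Suc i)} s *\<^sub>R \<xi> i \<omega>)"

definition simple_ito_integral ::
    "nat \<Rightarrow> (nat \<Rightarrow> real) \<Rightarrow> (nat \<Rightarrow> 'w \<Rightarrow> real^'d^'d) \<Rightarrow> (real \<Rightarrow> 'w \<Rightarrow> real^'d) \<Rightarrow>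
      real \<Rightarrow> 'w \<Rightarrow> real^'d" where
  "simple_ito_integral n \<tau> \<xi> B t \<omega> =
     (\<Sum>i<n. \<xi> i \<omega> *v (B (min (\<tau> (Suc i)) t) \<omega> - B (min (\<tau> i) t) \<omega>))"

text \<open>\<open>I\<close> is a continuous version of the stochastic integral \<open>t \<mapsto> \<integral>\<^sub>0\<^sup>t H\<^sub>s dB\<^sub>s\<close> of the matrix-valued
  integrand \<open>H\<close>: simple integrands converge to \<open>H\<close> in \<open>L\<^sup>2(0,t)\<close> in probability, and their elementary
  integrals converge to \<open>I t\<close> in probability. This determines \<open>I\<close> up to indistinguishability.
  The norm on matrices is the Frobenius norm. The time integral is the nonnegative one, so that
  it is infinite (instead of 0) whenever the integrand is not square integrable.\<close>

definition is_ito_integral ::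
    "'w measure \<Rightarrow> (real \<Rightarrow> 'w measure) \<Rightarrow> (real \<Rightarrow> 'w \<Rightarrow> real^'d) \<Rightarrow> (real \<Rightarrow> 'w \<Rightarrow> real^'d^'d) \<Rightarrow>
      (real \<Rightarrow> 'w \<Rightarrow> real^'d) \<Rightarrow> bool" where
  "is_ito_integral M F B H I \<longleftrightarrow>
     progressive F H \<and>
     (\<forall>t\<ge>0. I t \<in> borel_measurable M) \<and>
     (AE \<omega> in M. continuous_on {0..} (\<lambda>t. I t \<omega>)) \<and>
     (\<exists>n \<tau> \<xi>. (\<forall>k. simple_integrand M F (n k) (\<tau> k) (\<xi> k)) \<and>
        (\<forall>t\<ge>0. \<forall>\<epsilon>>0.
          (\<lambda>k. measure M {\<omega> \<in> space M. ennreal \<epsilon> <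
             (\<integral>\<^sup>+ s\<in>{0..t}. ennreal ((norm (simple_process (n k) (\<tau> k) (\<xi> k) s \<omega> - H s \<omega>))\<^sup>2) \<partial>lborel)})
            \<longlonglongrightarrow> 0 \<and>
          (\<lambda>k. measure M {\<omega> \<in> space M. \<epsilon> <
             norm (simple_ito_integral (n k) (\<tau> k) (\<xi> k) B t \<omega> - I t \<omega>)}) \<longlonglongrightarrow> 0))"

text \<open>Since \<open>\<sigma>\<close> is constant and \<open>B\<close> starts at 0, the stochastic integral of \<open>\<sigma>\<close> is \<open>\<sigma> *v B t\<close>.\<close>

definition sde_solution ::
    "'w measure \<Rightarrow> (real \<Rightarrow> 'w measure) \<Rightarrow> (real^'d \<Rightarrow> real^'d) \<Rightarrow> real^'d^'d \<Rightarrow>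
      (real \<Rightarrow> 'w \<Rightarrow> real^'d) \<Rightarrow> (real \<Rightarrow> 'w \<Rightarrow> real^'d) \<Rightarrow> bool" where
  "sde_solution M F b \<sigma> B X \<longleftrightarrow>
     adapted F X \<and>
     (AE \<omega> in M. continuous_on {0..} (\<lambda>t. X t \<omega>) \<and>
        (\<forall>t\<ge>0. X t \<omega> = X 0 \<omega> + (LBINT s:{0..t}. b (X s \<omega>)) + \<sigma> *v B t \<omega>))"

definition non_explosive ::
    "'w measure \<Rightarrow> (real \<Rightarrow> 'w measure) \<Rightarrow> (real^'d \<Rightarrow> real^'d) \<Rightarrow> real^'d^'d \<Rightarrow>
      (real \<Rightarrow> 'w \<Rightarrow> real^'d) \<Rightarrow> bool" where
  "non_explosive M F b \<sigma> B \<longleftrightarrow>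
     (\<forall>x. \<exists>X. sde_solution M F b \<sigma> B X \<and> (AE \<omega> in M. X 0 \<omega> = x))"

definition coupling_time ::
    "(real \<Rightarrow> 'w \<Rightarrow> real^'d) \<Rightarrow> (real \<Rightarrow> 'w \<Rightarrow> real^'d) \<Rightarrow> 'w \<Rightarrow> ereal" where
  "coupling_time X Y \<omega> = Inf (ereal ` {t. 0 \<le> t \<and> X t \<omega> = Y t \<omega>})"

definition reflection_dir :: "real^'d^'d \<Rightarrow> real^'d \<Rightarrow> real^'d" where
  "reflection_dir \<sigma> z = (1 / norm (matrix_inv \<sigma> *v z)) *\<^sub>R (matrix_inv \<sigma> *v z)"

definition reflection_mat :: "real^'d \<Rightarrow> real^'d^'d" where
  "reflection_mat e = mat 1 - (\<chi> i j. 2 * (e $ i * e $ j))"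

text \<open>The joint law of \<open>(X 0, Y 0)\<close> is arbitrary. On \<open>t < T\<close> the integral of the integrand cut off at
  the coupling time \<open>T\<close> is the integral of \<open>\<sigma> (I - 2 e e\<^sup>T)\<close>.\<close>

definition reflection_coupling ::
    "'w measure \<Rightarrow> (real \<Rightarrow> 'w measure) \<Rightarrow> (real^'d \<Rightarrow> real^'d) \<Rightarrow> real^'d^'d \<Rightarrow>
      (real \<Rightarrow> 'w \<Rightarrow> real^'d) \<Rightarrow> (real \<Rightarrow> 'w \<Rightarrow> real^'d) \<Rightarrow> (real \<Rightarrow> 'w \<Rightarrow> real^'d) \<Rightarrow> bool" where
  "reflection_coupling M F b \<sigma> B X Y \<longleftrightarrow>
     sde_solution M F b \<sigma> B X \<and> adapted F Y \<and>
     (\<forall>\<omega>\<in>space M. continuous_on {0..} (\<lambda>t. X t \<omega>) \<and> continuous_on {0..} (\<lambda>t. Y t \<omega>)) \<and>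
     (\<exists>I. is_ito_integral M F B
            (\<lambda>s \<omega>. if ereal s < coupling_time X Y \<omega>
                    then \<sigma> ** reflection_mat (reflection_dir \<sigma> (X s \<omega> - Y s \<omega>)) else 0) I \<and>
          (AE \<omega> in M. \<forall>t\<ge>0. ereal t < coupling_time X Y \<omega> \<longrightarrow>
             Y t \<omega> = Y 0 \<omega> + (LBINT s:{0..t}. b (Y s \<omega>)) + I t \<omega>)) \<and>
     (AE \<omega> in M. \<forall>t\<ge>0. coupling_time X Y \<omega> \<le> ereal t \<longrightarrow> Y t \<omega> = X t \<omega>)"

definition Gnorm :: "real^'d^'d \<Rightarrow> real^'d \<Rightarrow> real" where
  "Gnorm G z = sqrt (z \<bullet> (G *v z))"

definition kappa_values ::
    "real^'d^'d \<Rightarrow> real^'d^'d \<Rightarrow> (real^'d \<Rightarrow> real^'d) \<Rightarrow> real \<Rightarrow> real set" where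
  "kappa_values \<sigma> G b r =
     {- 2 * ((norm (matrix_inv \<sigma> *v (x - y)))\<^sup>2 / (Gnorm G (x - y))\<^sup>2)
          * (((x - y) \<bullet> (G *v (b x - b y))) / (Gnorm G (x - y))\<^sup>2) | x y. Gnorm G (x - y) = r}"

definition kappa :: "real^'d^'d \<Rightarrow> real^'d^'d \<Rightarrow> (real^'d \<Rightarrow> real^'d) \<Rightarrow> real \<Rightarrow> real" where
  "kappa \<sigma> G b r = Inf (kappa_values \<sigma> G b r)"

definition R0 :: "(real \<Rightarrow> real) \<Rightarrow> real" where
  "R0 \<kappa> = Inf {R. 0 \<le> R \<and> (\<forall>r>0. R \<le> r \<longrightarrow> 0 \<le> \<kappa> r)}"

definition R1 :: "(real \<Rightarrow> real) \<Rightarrow> real" where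
  "R1 \<kappa> = Inf {R. R0 \<kappa> \<le> R \<and> (\<forall>r>0. R \<le> r \<longrightarrow> 8 \<le> \<kappa> r * R * (R - R0 \<kappa>))}"

definition phi :: "(real \<Rightarrow> real) \<Rightarrow> real \<Rightarrow> real" where
  "phi \<kappa> r = exp (- (1/4) * (LBINT s:{0..r}. s * max (- \<kappa> s) 0))"

definition Phi :: "(real \<Rightarrow> real) \<Rightarrow> real \<Rightarrow> real" where
  "Phi \<kappa> r = (LBINT s:{0..r}. phi \<kappa> s)"

definition g_fun :: "(real \<Rightarrow> real) \<Rightarrow> real \<Rightarrow> real" where
  "g_fun \<kappa> r = 1 - (1/2) * ((LBINT s:{0..min r (R1 \<kappa>)}. Phi \<kappa> s / phi \<kappa> s)
                             / (LBINT s:{0..R1 \<kappa>}. Phi \<kappa> s / phi \<kappa> s))"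

definition f_fun :: "(real \<Rightarrow> real) \<Rightarrow> real \<Rightarrow> real" where
  "f_fun \<kappa> r = (LBINT s:{0..r}. phi \<kappa> s * g_fun \<kappa> s)"

definition d_f :: "real^'d^'d \<Rightarrow> (real \<Rightarrow> real) \<Rightarrow> real^'d \<Rightarrow> real^'d \<Rightarrow> real" where
  "d_f G \<kappa> x y = f_fun \<kappa> (Gnorm G (x - y))"

definition alpha :: "real^'d^'d \<Rightarrow> real^'d^'d \<Rightarrow> real" where
  "alpha \<sigma> G = Sup {(norm (matrix_inv \<sigma> *v z))\<^sup>2 | z. Gnorm G z = 1}"

definition contraction_rate :: "real^'d^'d \<Rightarrow> real^'d^'d \<Rightarrow> (real \<Rightarrow> real) \<Rightarrow> real" where
  "contraction_rate \<sigma> G \<kappa> = 1 / (alpha \<sigma> G * (LBINT s:{0..R1 \<kappa>}. Phi \<kappa> s / phi \<kappa> s))"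

end

theory Submission
  imports Defs
begin

text \<open>The proof avoids the Ito formula and works with the definition of the Ito integral as a limit of
  simple integrals. Let \<open>Z = X - Y\<close> and \<open>r = \<parallel>Z\<parallel>\<close>. The reflected noise acts on \<open>Z\<close> only in the direction of
  \<open>Z\<close> itself, so only \<open>f''\<close> enters the second order term of \<open>f r\<close>, and
  \<open>f'' \<le> r \<kappa> f' / 4 - f / (2 N)\<close>, where \<open>N = \<integral> \<Phi>/\<phi>\<close> over \<open>[0, R\<^sub>1]\<close>, cancels the drift and leaves
  the rate \<open>c = 1 / (\<alpha> N)\<close>.

  Fix \<open>m\<close> and keep only the paths which up to time \<open>t\<close> satisfy \<open>|X|, |Y| \<le> m\<close> and \<open>r \<ge> 1/m\<close>. On these paths
  all coefficients are bounded and continuous, and a second order expansion of \<open>f r\<close> over one step of a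
  time grid gives the decay up to an error whose sum vanishes with the mesh. Because \<open>f \<ge> 0\<close>, discarding
  the paths that leave this region only decreases the expectation, so no stopping theorem is needed. As
  \<open>m \<rightarrow> \<infinity>\<close>, exactly the paths which have not coupled by time \<open>t\<close> remain, and the others contribute \<open>f 0 = 0\<close>.\<close>

section \<open>Gaussian moments\<close>

text \<open>Two obstacles shape the proof: only elementary integrals are at hand, and f'' jumps at
  \<open>R1\<close>. Both are met by one-sided estimates. As f is increasing, 1-Lipschitz and
  concave, an upper bound for the new distance suffices, and f'' may be replaced by the larger
  continuous function \<open>curv \<gamma>\<close>, in which 1/N is weakened to some \<gamma> < 1/N.
  The slack pays for the jump, and \<gamma> tends to 1/N only in the final inequality.

  Over one step the noise factor a has the size of the square root of the step, so a^4 has a mean of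
  the order of the step squared. The remaining increment consists of the drift and the error of
  freezing the Ito integrand. It is kept exactly to first order and enters the error only through
  its square, whose mean is controlled by the oscillation of the integrand and the drift. Summed
  over a grid this vanishes by dominated convergence, from continuity of the paths alone.

  A path that leaves the region during a step contributes 0 at its end, but the bound must remain
  nonnegative there. For this reason the expansion is applied to the vector to which the increments
  would lead, whether or not the path has left.\<close>

context
  fixes M :: "'w measure" and D :: "'w \<Rightarrow> real^'d" and v :: real
  assumes v: "0 < v"
    and D: "distributed M lborel D (\<lambda>x. ennreal (\<Prod>i\<in>UNIV. normal_density 0 v (x $ i)))"
begin

text \<open>Lebesgue measure on \<open>real^'d\<close> is the image under \<open>T\<close> of the
  product of one-dimensional ones, so the integral of a product of functions of single coordinates
  factorises. All moments below are instances of this.\<close>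

lemma gaussian_vector_prod:
  fixes g :: "'d \<Rightarrow> real \<Rightarrow> real"
  assumes [measurable]: "\<And>i. g i \<in> borel_measurable borel"
    and int: "\<And>i. integrable lborel (\<lambda>x. normal_density 0 v x * g i x)"
  shows "has_bochner_integral M (\<lambda>\<omega>. \<Prod>i\<in>UNIV. g i (D \<omega> $ i)) (\<Prod>i\<in>UNIV. \<integral>x. normal_density 0 v x * g i x \<partial>lborel)"
proof -
  interpret product_sigma_finite "\<lambda>_::real^'d. lborel :: real measure" ..
  define T where "T = (\<lambda>f::real^'d \<Rightarrow> real. (\<Sum>b\<in>Basis. f b *\<^sub>R b))"
  have T[measurable]: "T \<in> borel_measurable (\<Pi>\<^sub>M b\<in>Basis. lborel)"
    unfolding T_def by measurable
  have lb: "(lborel :: (real^'d) measure) = distr (\<Pi>\<^sub>M b\<in>Basis. lborel) borel T"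
    unfolding T_def by (rule lborel_eq)
  have Tcomp: "T f $ i = f (axis i 1)" for f i
  proof -
    have "T f $ i = T f \<bullet> axis i 1" by (simp add: inner_axis)
    also have "\<dots> = f (axis i 1)"
      unfolding T_def by (rule inner_sum_left_Basis) (simp add: axis_in_Basis_iff)
    finally show ?thesis .
  qed
  have inj: "inj (\<lambda>i::'d. axis i (1::real))" by (auto simp: inj_on_def axis_eq_axis)
  have B: "(Basis :: (real^'d) set) = range (\<lambda>i. axis i 1)"
    by (auto simp: Basis_vec_def)
  \<comment> \<open>The product measure is indexed by basis vectors, the density by coordinates;
    \<open>the_inv\<close> recovers the coordinate from \<open>axis i 1\<close>.\<close>
  define h where "h = (\<lambda>b::real^'d. \<lambda>x. normal_density 0 v x * g (the_inv (\<lambda>i. axis i (1::real)) b) x)"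
  have h: "h (axis i 1) = (\<lambda>x. normal_density 0 v x * g i x)" for i
    unfolding h_def using the_inv_f_f[OF inj, of i] by simp
  have ih: "integrable lborel (h b)" if "b \<in> Basis" for b
    using that int by (auto simp: B h)
  let ?d = "\<lambda>x::real^'d. (\<Prod>i\<in>UNIV. normal_density 0 v (x $ i))"
  let ?g = "\<lambda>x::real^'d. (\<Prod>i\<in>UNIV. g i (x $ i))"
  have eq: "(\<Prod>b\<in>Basis. h b (f b)) = ?d (T f) *\<^sub>R ?g (T f)" for f
    unfolding B by (subst prod.reindex[OF inj]) (simp add: h Tcomp prod.distrib)
  have "integrable (\<Pi>\<^sub>M b\<in>Basis. lborel) (\<lambda>f. \<Prod>b\<in>Basis. h b (f b))"
    by (rule product_integrable_prod) (use ih in auto)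
  then have "integrable (distr (\<Pi>\<^sub>M b\<in>Basis. lborel) borel T) (\<lambda>x. ?d x *\<^sub>R ?g x)"
    by (subst integrable_distr_eq) (simp_all add: eq)
  then have i1: "integrable lborel (\<lambda>x. ?d x *\<^sub>R ?g x)" using lb by metis
  have "(\<integral>x. ?d x *\<^sub>R ?g x \<partial>lborel) = (\<integral>x. ?d x *\<^sub>R ?g x \<partial>distr (\<Pi>\<^sub>M b\<in>Basis. lborel) borel T)"
    using lb by metis
  also have "\<dots> = (\<integral>f. (\<Prod>b\<in>Basis. h b (f b)) \<partial>(\<Pi>\<^sub>M b\<in>Basis. lborel))"
    by (subst integral_distr) (simp_all add: eq)
  also have "\<dots> = (\<Prod>b\<in>Basis. integral\<^sup>L lborel (h b))"
    by (rule product_integral_prod) (use ih in auto)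
  also have "\<dots> = (\<Prod>i\<in>UNIV. \<integral>x. normal_density 0 v x * g i x \<partial>lborel)"
    unfolding B by (subst prod.reindex[OF inj]) (simp add: h)
  finally have i2: "(\<integral>x. ?d x *\<^sub>R ?g x \<partial>lborel) = (\<Prod>i\<in>UNIV. \<integral>x. normal_density 0 v x * g i x \<partial>lborel)" .
  have nn: "0 \<le> ?d x" for x :: "real^'d" by (intro prod_nonneg) auto
  show ?thesis
    unfolding has_bochner_integral_iff
    using distributed_integrable[OF D, of ?g] distributed_integral[OF D, of ?g] i1 i2 nn by simp
qed

lemma gaussian_vector_mean: "has_bochner_integral M (\<lambda>\<omega>. D \<omega> $ j) 0"
proof -
  let ?g = "\<lambda>i x::real. if i = j then x else 1"
  have "has_bochner_integral M (\<lambda>\<omega>. \<Prod>i\<in>UNIV. ?g i (D \<omega> $ i)) (\<Prod>i\<in>UNIV. \<integral>x. normal_density 0 v x * ?g i x \<partial>lborel)"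
  proof (rule gaussian_vector_prod)
    show "integrable lborel (\<lambda>x. normal_density 0 v x * ?g i x)" for i
      using integrable_normal_moment_nz_1[OF v, of 0] v by (cases "i = j") auto
  qed auto
  moreover have "(\<Prod>i\<in>UNIV. \<integral>x. normal_density 0 v x * ?g i x \<partial>lborel) = 0"
    using integral_normal_moment_nz_1[OF v, of 0] by (auto intro!: exI[of _ j])
  moreover have "(\<Prod>i\<in>UNIV. ?g i (D \<omega> $ i)) = D \<omega> $ j" for \<omega>
    by (subst prod.delta) auto
  ultimately show ?thesis by simp
qed

text \<open>Two factors in \<open>?g\<close> let one instance cover both cases: for
  \<open>j = k\<close> they meet in the same coordinate and give the second moment, otherwise the
  product contains a vanishing first moment.\<close>

lemma gaussian_vector_covariance:
  "has_bochner_integral M (\<lambda>\<omega>. D \<omega> $ j * D \<omega> $ k) (if j = k then v\<^sup>2 else 0)"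
proof -
  let ?g = "\<lambda>i x::real. (if i = j then x else 1) * (if i = k then x else 1)"
  have "integrable lborel (\<lambda>x. normal_density 0 v x * ?g i x)" for i
    using integrable_normal_moment_nz_1[OF v, of 0] v integrable_normal_moment[OF v, of 0 2]
    by (cases "i = j"; cases "i = k") (auto simp: power2_eq_square)
  then have 1: "has_bochner_integral M (\<lambda>\<omega>. \<Prod>i\<in>UNIV. ?g i (D \<omega> $ i)) (\<Prod>i\<in>UNIV. \<integral>x. normal_density 0 v x * ?g i x \<partial>lborel)"
    by (intro gaussian_vector_prod) auto
  have 2: "(\<Prod>i\<in>UNIV. ?g i (D \<omega> $ i)) = D \<omega> $ j * D \<omega> $ k" for \<omega>
    unfolding prod.distrib by (subst (1 2) prod.delta) auto
  have 3: "(\<Prod>i\<in>UNIV. \<integral>x. normal_density 0 v x * ?g i x \<partial>lborel) = (if j = k then v\<^sup>2 else 0)"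
  proof (cases "j = k")
    case True
    have "(\<Prod>i\<in>UNIV. \<integral>x. normal_density 0 v x * ?g i x \<partial>lborel) = (\<Prod>i\<in>UNIV. if i = j then v\<^sup>2 else 1)"
      using integral_normal_moment_even[OF v, of 0 1] v True
      by (intro prod.cong) (auto simp: power2_eq_square)
    then show ?thesis using True by (simp add: prod.delta)
  next
    case False
    then show ?thesis
      using integral_normal_moment_nz_1[OF v, of 0] by (auto intro!: exI[of _ j])
  qed
  show ?thesis using 1 unfolding 2 3 .
qed

text \<open>Ensures that the fourth power of the noise factor over a step has a mean of second order
  in the length of the step, so that it disappears when summed over a fine grid.\<close>

lemma gaussian_vector_moment4: "has_bochner_integral M (\<lambda>\<omega>. (D \<omega> $ j) ^ 4) (3 * v ^ 4)"
proof -
  let ?g = "\<lambda>i x::real. if i = j then x ^ 4 else 1"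
  have "has_bochner_integral M (\<lambda>\<omega>. \<Prod>i\<in>UNIV. ?g i (D \<omega> $ i)) (\<Prod>i\<in>UNIV. \<integral>x. normal_density 0 v x * ?g i x \<partial>lborel)"
  proof (rule gaussian_vector_prod)
    show "integrable lborel (\<lambda>x. normal_density 0 v x * ?g i x)" for i
      using integrable_normal_moment[OF v, of 0 4] v by (cases "i = j") auto
  qed auto
  moreover have "(\<integral>x. normal_density 0 v x * x ^ 4 \<partial>lborel) = 3 * v ^ 4"
    using integral_normal_moment_even[OF v, of 0 2] v
    by (simp add: fact_numeral field_simps power2_eq_square power4_eq_xxxx)
  moreover have "(\<Prod>i\<in>UNIV. \<integral>x. normal_density 0 v x * ?g i x \<partial>lborel) = (\<Prod>i\<in>UNIV. if i = j then 3 * v^4 else 1)"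
    using calculation(2) v by (intro prod.cong) auto
  moreover have "(\<Prod>i\<in>UNIV. ?g i (D \<omega> $ i)) = (D \<omega> $ j) ^ 4" for \<omega>
    by (subst prod.delta) auto
  ultimately show ?thesis by (simp add: prod.delta)
qed

end

section \<open>Brownian increments and the elementary isometry\<close>

lemma norm_matrix_sq: "(norm (A :: real^'n^'m))\<^sup>2 = (\<Sum>i\<in>UNIV. \<Sum>j\<in>UNIV. (A $ i $ j)\<^sup>2)"
  by (simp add: norm_vec_def L2_set_def sum_nonneg)

lemma norm_vec_sq: "(norm (x :: real^'n))\<^sup>2 = (\<Sum>i\<in>UNIV. (x $ i)\<^sup>2)"
  by (simp add: norm_vec_def L2_set_def sum_nonneg)

lemma norm_matrix_vector_mult_le: "norm ((A :: real^'n^'m) *v x) \<le> norm A * norm x"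
proof (rule power2_le_imp_le)
  have "(norm (A *v x))\<^sup>2 = (\<Sum>i\<in>UNIV. (A $ i \<bullet> x)\<^sup>2)"
    by (simp add: norm_vec_sq matrix_vector_mul_component)
  also have "\<dots> \<le> (\<Sum>i\<in>UNIV. (norm (A $ i))\<^sup>2 * (norm x)\<^sup>2)"
    by (intro sum_mono) (metis Cauchy_Schwarz_ineq2 norm_ge_zero power2_abs power_mono power_mult_distrib abs_ge_zero)
  also have "\<dots> = (norm A * norm x)\<^sup>2"
    by (simp add: norm_matrix_sq norm_vec_sq sum_distrib_right[symmetric] power_mult_distrib)
  finally show "(norm (A *v x))\<^sup>2 \<le> (norm A * norm x)\<^sup>2" .
qed simp

text \<open>Duality: with \<open>w = x v* A\<close> one has
  \<open>w \<bullet> w = x \<bullet> (A *v w)\<close>, so the bound for \<open>A *v w\<close>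
  applies and one factor \<open>norm w\<close> cancels.\<close>

lemma norm_vector_matrix_mult_le: "norm (x v* (A :: real^'n^'m)) \<le> norm x * norm A"
proof -
  let ?w = "x v* A"
  have "norm ?w * norm ?w = x \<bullet> (A *v ?w)"
    by (simp add: dot_lmul_matrix[symmetric] norm_eq_sqrt_inner)
  also have "\<dots> \<le> norm x * norm (A *v ?w)" by (rule norm_cauchy_schwarz)
  also have "\<dots> \<le> norm x * (norm A * norm ?w)"
    by (intro mult_left_mono norm_matrix_vector_mult_le) auto
  finally show ?thesis
    by (cases "norm ?w = 0") (auto simp: mult.assoc[symmetric])
qed

lemma borel_measurable_matrix_vector_mult[measurable]:
  fixes f :: "'a \<Rightarrow> real^'n^'m"
  assumes "f \<in> borel_measurable N" "g \<in> borel_measurable N"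
  shows "(\<lambda>x. f x *v g x) \<in> borel_measurable N"
proof -
  have "continuous_on UNIV (\<lambda>p::(real^'n^'m) \<times> (real^'n). fst p *v snd p)"
    unfolding matrix_vector_mult_def by (intro continuous_intros)
  then have "(\<lambda>p::(real^'n^'m) \<times> (real^'n). fst p *v snd p) \<in> borel_measurable borel"
    by (rule borel_measurable_continuous_onI)
  from measurable_compose[OF borel_measurable_Pair[OF assms] this] show ?thesis by simp
qed

lemma borel_measurable_vector_matrix_mult[measurable]:
  fixes f :: "'a \<Rightarrow> real^'n^'m"
  assumes "g \<in> borel_measurable N" "f \<in> borel_measurable N"
  shows "(\<lambda>x. g x v* f x) \<in> borel_measurable N"
proof -
  have "continuous_on UNIV (\<lambda>p::(real^'n^'m) \<times> (real^'m). snd p v* fst p)"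
    unfolding vector_matrix_mult_def by (intro continuous_intros)
  then have "(\<lambda>p::(real^'n^'m) \<times> (real^'m). snd p v* fst p) \<in> borel_measurable borel"
    by (rule borel_measurable_continuous_onI)
  from measurable_compose[OF borel_measurable_Pair[OF assms(2,1)] this] show ?thesis by simp
qed

lemma borel_measurable_vec_nth_comp[measurable]:
  fixes f :: "'a \<Rightarrow> ('b::euclidean_space)^'n"
  assumes "f \<in> borel_measurable N"
  shows "(\<lambda>x. f x $ i) \<in> borel_measurable N"
  using measurable_compose[OF assms borel_measurable_continuous_onI[of "\<lambda>x. x $ i"]]
  by (simp add: continuous_on_component)

locale brownian =
  fixes M :: "'w measure" and F :: "real \<Rightarrow> 'w measure" and B :: "real \<Rightarrow> 'w \<Rightarrow> real^'d"
  assumes bm: "brownian_motion M F B"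
begin

sublocale prob_space M
  using bm by (simp add: brownian_motion_def filtered_prob_space_def)

lemma sets_F_mono: "s \<le> t \<Longrightarrow> sets (F s) \<subseteq> sets (F t)"
  and space_F: "space (F t) = space M"
  and subalgebra_F: "subalgebra M (F t)"
  using bm by (auto simp: brownian_motion_def filtered_prob_space_def filtration_def)

lemma measurable_F_M: "f \<in> measurable (F t) N \<Longrightarrow> f \<in> measurable M N"
  by (rule measurable_from_subalg[OF subalgebra_F])

lemma sets_F_M: "A \<in> sets (F t) \<Longrightarrow> A \<in> sets M"
  using subalgebra_F[of t] by (auto simp: subalgebra_def)

lemma measurable_F_mono: "s \<le> t \<Longrightarrow> f \<in> measurable (F s) N \<Longrightarrow> f \<in> measurable (F t) N"
  by (rule measurable_from_subalg[of "F t" "F s"])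
    (use sets_F_mono[of s t] in \<open>auto simp: subalgebra_def space_F\<close>)

lemma B_measurable_F: "0 \<le> t \<Longrightarrow> B t \<in> borel_measurable (F t)"
  using bm by (auto simp: brownian_motion_def adapted_def)

lemma B_measurable[measurable (raw)]: "0 \<le> t \<Longrightarrow> B t \<in> borel_measurable M"
  using B_measurable_F measurable_F_M by blast

lemma increment_distributed:
  assumes "0 \<le> s" "s < t"
  shows "distributed M lborel (\<lambda>\<omega>. B t \<omega> - B s \<omega>)
          (\<lambda>x. ennreal (\<Prod>i\<in>UNIV. normal_density 0 (sqrt (t - s)) (x $ i)))"
  using assms bm by (auto simp: brownian_motion_def)

text \<open>\<open>brownian_motion\<close> provides independence of whole sigma-algebras; those
  generated by \<open>q\<close> and by a function of the increment are contained in them.\<close>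

lemma increment_indep:
  assumes st: "0 \<le> s" "s < t"
    and q: "q \<in> borel_measurable (F s)"
    and [measurable]: "g \<in> borel_measurable borel"
  shows "indep_var borel q borel (\<lambda>\<omega>. g (B t \<omega> - B s \<omega>))"
proof -
  let ?D = "\<lambda>\<omega>. B t \<omega> - B s \<omega>"
  have ind: "indep_set (sets (F s)) (sets (vimage_algebra (space M) ?D borel))"
    using assms bm by (auto simp: brownian_motion_def)
  have m: "q \<in> borel_measurable M" "?D \<in> borel_measurable M"
    using st q by (auto intro: measurable_F_M)
  have 1: "sigma_sets (space M) {q -` A \<inter> space M |A. A \<in> sets borel} \<subseteq> sets (F s)"
    using measurable_sets[OF q] unfolding space_F[of s, symmetric]
    by (intro sets.sigma_sets_subset) auto
  have gD: "(\<lambda>\<omega>. g (?D \<omega>)) \<in> measurable (vimage_algebra (space M) ?D borel) borel"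
    by (intro measurable_compose[OF measurable_vimage_algebra1]) auto
  have 2: "sigma_sets (space M) {(\<lambda>\<omega>. g (?D \<omega>)) -` A \<inter> space M |A. A \<in> sets borel}
      \<subseteq> sets (vimage_algebra (space M) ?D borel)"
  proof -
    have "{(\<lambda>\<omega>. g (?D \<omega>)) -` A \<inter> space M |A. A \<in> sets borel} \<subseteq> sets (vimage_algebra (space M) ?D borel)"
      using measurable_sets[OF gD] by (auto simp: space_vimage_algebra)
    then show ?thesis
      using sets.sigma_sets_subset[of _ "vimage_algebra (space M) ?D borel"]
      by (simp add: space_vimage_algebra)
  qed
  have "indep_set (sigma_sets (space M) {q -` A \<inter> space M |A. A \<in> sets borel})
     (sigma_sets (space M) {(\<lambda>\<omega>. g (?D \<omega>)) -` A \<inter> space M |A. A \<in> sets borel})"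
    using ind 1 2 unfolding indep_set_def
    by (rule_tac indep_sets_mono_sets) (auto split: bool.split)
  then show ?thesis
    unfolding indep_var_eq using m measurable_compose[OF m(2), of g borel] by simp
qed

lemma increment_mean:
  assumes st: "0 \<le> s" "s \<le> t" and q: "q \<in> borel_measurable (F s)" "integrable M q"
  shows "has_bochner_integral M (\<lambda>\<omega>. q \<omega> * (B t \<omega> - B s \<omega>) $ j) 0"
\<comment> \<open>The law of an increment is prescribed only for \<open>s < t\<close>. The
  degenerate case is treated separately because the grids used later may repeat a point.\<close>
proof (cases "s = t")
  case True
  then show ?thesis by (simp add: has_bochner_integral_zero)
next
  case False
  with st have "s < t" by simp
  have g: "has_bochner_integral M (\<lambda>\<omega>. (B t \<omega> - B s \<omega>) $ j) 0"
    by (rule gaussian_vector_mean[OF _ increment_distributed]) (use st \<open>s < t\<close> in auto)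
  have i: "indep_var borel q borel (\<lambda>\<omega>. (B t \<omega> - B s \<omega>) $ j)"
    by (rule increment_indep) (use st \<open>s < t\<close> q in auto)
  show ?thesis
    using indep_var_integrable[OF i q(2)] indep_var_lebesgue_integral[OF i q(2)] g
    by (simp add: has_bochner_integral_iff)
qed

lemma increment_covariance:
  assumes st: "0 \<le> s" "s \<le> t" and q: "q \<in> borel_measurable (F s)" "integrable M q"
  shows "has_bochner_integral M (\<lambda>\<omega>. q \<omega> * ((B t \<omega> - B s \<omega>) $ j * (B t \<omega> - B s \<omega>) $ k))
    (if j = k then (t - s) * expectation q else 0)"
proof (cases "s = t")
  case True
  then show ?thesis by (auto simp: has_bochner_integral_zero)
next
  case False
  with st have "s < t" by simp
  have g: "has_bochner_integral M (\<lambda>\<omega>. (B t \<omega> - B s \<omega>) $ j * (B t \<omega> - B s \<omega>) $ k)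
      (if j = k then (sqrt (t - s))\<^sup>2 else 0)"
    by (rule gaussian_vector_covariance[OF _ increment_distributed]) (use st \<open>s < t\<close> in auto)
  have i: "indep_var borel q borel (\<lambda>\<omega>. (B t \<omega> - B s \<omega>) $ j * (B t \<omega> - B s \<omega>) $ k)"
    by (rule increment_indep) (use st \<open>s < t\<close> q in auto)
  show ?thesis
    using indep_var_integrable[OF i q(2)] indep_var_lebesgue_integral[OF i q(2)] g st
    by (auto simp: has_bochner_integral_iff)
qed

lemma increment_moment4:
  assumes st: "0 \<le> s" "s \<le> t"
  shows "integrable M (\<lambda>\<omega>. (norm (B t \<omega> - B s \<omega>)) ^ 4)"
    and "expectation (\<lambda>\<omega>. (norm (B t \<omega> - B s \<omega>)) ^ 4) \<le> 3 * (real CARD('d))\<^sup>2 * (t - s)\<^sup>2"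
proof -
  let ?D = "\<lambda>\<omega>. B t \<omega> - B s \<omega>"
  have g: "has_bochner_integral M (\<lambda>\<omega>. (?D \<omega> $ j) ^ 4) (3 * (t - s)\<^sup>2)" for j
  proof (cases "s = t")
    case True
    then show ?thesis by (auto simp: has_bochner_integral_zero)
  next
    case False
    have "has_bochner_integral M (\<lambda>\<omega>. (?D \<omega> $ j) ^ 4) (3 * (sqrt (t - s)) ^ 4)"
      by (rule gaussian_vector_moment4[OF _ increment_distributed]) (use st False in auto)
    moreover have "(sqrt (t - s)) ^ 4 = (t - s)\<^sup>2"
      using st real_sqrt_pow2[of "t - s"] by (simp add: power4_eq_xxxx power2_eq_square)
    ultimately show ?thesis by simp
  qed
  have le: "(norm (?D \<omega>)) ^ 4 \<le> real CARD('d) * (\<Sum>j\<in>UNIV. (?D \<omega> $ j) ^ 4)" for \<omega>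
  proof -
    have "(norm (?D \<omega>)) ^ 4 = ((norm (?D \<omega>))\<^sup>2)\<^sup>2" by simp
    also have "\<dots> = (\<Sum>j\<in>UNIV. (?D \<omega> $ j)\<^sup>2)\<^sup>2" unfolding norm_vec_sq ..
    also have "\<dots> \<le> real CARD('d) * (\<Sum>j\<in>UNIV. ((?D \<omega> $ j)\<^sup>2)\<^sup>2)"
      using sum_squared_le_sum_of_squares[of "\<lambda>j. (?D \<omega> $ j)\<^sup>2" UNIV] by (simp add: mult.commute)
    finally show ?thesis by simp
  qed
  have h: "has_bochner_integral M (\<lambda>\<omega>. real CARD('d) * (\<Sum>j\<in>UNIV. (?D \<omega> $ j) ^ 4))
     (real CARD('d) * (\<Sum>j\<in>(UNIV::'d set). (3 * (t - s)\<^sup>2)))"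
    by (intro has_bochner_integral_mult_right has_bochner_integral_sum g)
  show *: "integrable M (\<lambda>\<omega>. (norm (?D \<omega>)) ^ 4)"
    by (rule Bochner_Integration.integrable_bound[OF integrable.intros[OF h]])
      (use le st in \<open>auto intro!: AE_I2 order_trans[OF _ abs_ge_self]\<close>)
  show "expectation (\<lambda>\<omega>. (norm (?D \<omega>)) ^ 4) \<le> 3 * (real CARD('d))\<^sup>2 * (t - s)\<^sup>2"
    using integral_mono[OF * integrable.intros[OF h] le] has_bochner_integral_integral_eq[OF h]
    by (simp add: power2_eq_square)
qed

lemma increment_inner_mean:
  fixes w :: "'w \<Rightarrow> real^'d"
  assumes st: "0 \<le> s" "s \<le> t" and w: "w \<in> borel_measurable (F s)" "integrable M w"
  shows "has_bochner_integral M (\<lambda>\<omega>. w \<omega> \<bullet> (B t \<omega> - B s \<omega>)) 0"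
proof -
  have [measurable]: "w \<in> borel_measurable (F s)" by fact
  have "integrable M (\<lambda>\<omega>. w \<omega> $ j)" for j
    using w(2) by (rule Bochner_Integration.integrable_bound)
      (auto intro!: measurable_F_M[of _ s] simp: component_le_norm_cart)
  then have "has_bochner_integral M (\<lambda>\<omega>. \<Sum>j\<in>UNIV. w \<omega> $ j * (B t \<omega> - B s \<omega>) $ j) (\<Sum>j\<in>(UNIV::'d set). 0)"
    by (intro has_bochner_integral_sum increment_mean st) auto
  then show ?thesis by (simp add: inner_vec_def)
qed

text \<open>Expanding the square gives products of two coordinates of the increment with known
  coefficients. Only the diagonal products survive, each with variance \<open>t - s\<close>, and
  their coefficients add up to the squared Frobenius norm.\<close>

lemma increment_matrix_norm:
  fixes \<eta> :: "'w \<Rightarrow> real^'d^'d"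
  assumes st: "0 \<le> s" "s \<le> t" and \<eta>: "\<eta> \<in> borel_measurable (F s)"
    and bd: "\<And>\<omega>. \<omega> \<in> space M \<Longrightarrow> norm (\<eta> \<omega>) \<le> C"
  shows "has_bochner_integral M (\<lambda>\<omega>. (norm (\<eta> \<omega> *v (B t \<omega> - B s \<omega>)))\<^sup>2)
    ((t - s) * expectation (\<lambda>\<omega>. (norm (\<eta> \<omega>))\<^sup>2))"
proof -
  have [measurable]: "\<eta> \<in> borel_measurable (F s)" by fact
  let ?D = "\<lambda>\<omega>. B t \<omega> - B s \<omega>"
  have comp: "\<bar>\<eta> \<omega> $ l $ j\<bar> \<le> C" if "\<omega> \<in> space M" for \<omega> l j
    using bd[OF that] component_le_norm_cart[of "\<eta> \<omega> $ l" j] Finite_Cartesian_Product.norm_nth_le[where x="\<eta> \<omega>" and i=l] by linarith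
  have int: "integrable M (\<lambda>\<omega>. \<eta> \<omega> $ l $ j * \<eta> \<omega> $ l $ k)" for l j k
    by (rule integrable_const_bound[of _ "C * C"])
      (use comp in \<open>auto intro!: AE_I2 mult_mono measurable_F_M[of _ s] simp: abs_mult intro: order_trans[OF abs_ge_zero comp]\<close>)
  have "has_bochner_integral M
     (\<lambda>\<omega>. \<Sum>l\<in>UNIV. \<Sum>j\<in>UNIV. \<Sum>k\<in>UNIV. (\<eta> \<omega> $ l $ j * \<eta> \<omega> $ l $ k) * (?D \<omega> $ j * ?D \<omega> $ k))
     (\<Sum>l\<in>UNIV. \<Sum>j\<in>UNIV. \<Sum>k\<in>UNIV. (if j = k then (t - s) * expectation (\<lambda>\<omega>. \<eta> \<omega> $ l $ j * \<eta> \<omega> $ l $ k) else 0))"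
    by (intro has_bochner_integral_sum increment_covariance st int) auto
  moreover have "(\<Sum>l\<in>UNIV. \<Sum>j\<in>UNIV. \<Sum>k\<in>UNIV. (\<eta> \<omega> $ l $ j * \<eta> \<omega> $ l $ k) * (?D \<omega> $ j * ?D \<omega> $ k))
      = (norm (\<eta> \<omega> *v ?D \<omega>))\<^sup>2" for \<omega>
    unfolding norm_vec_sq by (simp add: matrix_vector_mult_def power2_eq_square sum_product mult_ac)
  moreover have "(\<Sum>l\<in>UNIV. \<Sum>j\<in>UNIV. \<Sum>k\<in>UNIV. (if j = k then (t - s) * expectation (\<lambda>\<omega>. \<eta> \<omega> $ l $ j * \<eta> \<omega> $ l $ k) else 0))
      = (t - s) * expectation (\<lambda>\<omega>. (norm (\<eta> \<omega>))\<^sup>2)"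
  proof -
    have "has_bochner_integral M (\<lambda>\<omega>. (norm (\<eta> \<omega>))\<^sup>2)
        (\<Sum>l\<in>UNIV. \<Sum>j\<in>UNIV. expectation (\<lambda>\<omega>. \<eta> \<omega> $ l $ j * \<eta> \<omega> $ l $ j))"
      unfolding norm_matrix_sq unfolding power2_eq_square
      by (intro has_bochner_integral_sum has_bochner_integral_integrable int)
    from has_bochner_integral_integral_eq[OF this]
    show ?thesis by (simp add: sum_distrib_left)
  qed
  ultimately show ?thesis by simp
qed

text \<open>Pythagoras for martingale increments: in the induction the new term is orthogonal to the
  partial sum, because the latter is known at time \<open>p m\<close>. The induction therefore
  carries its measurability along.\<close>

lemma grid_isometry:
  fixes \<eta> :: "nat \<Rightarrow> 'w \<Rightarrow> real^'d^'d"
  assumes p0: "0 \<le> p 0" and p: "\<And>i. i < n \<Longrightarrow> p i \<le> p (Suc i)"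
    and \<eta>: "\<And>i. i < n \<Longrightarrow> \<eta> i \<in> borel_measurable (F (p i))"
    and bd: "\<And>i \<omega>. i < n \<Longrightarrow> \<omega> \<in> space M \<Longrightarrow> norm (\<eta> i \<omega>) \<le> C"
  shows "has_bochner_integral M (\<lambda>\<omega>. (norm (\<Sum>i<n. \<eta> i \<omega> *v (B (p (Suc i)) \<omega> - B (p i) \<omega>)))\<^sup>2)
    (\<Sum>i<n. (p (Suc i) - p i) * expectation (\<lambda>\<omega>. (norm (\<eta> i \<omega>))\<^sup>2))"
proof -
  let ?Q = "\<lambda>m \<omega>. (\<Sum>i<m. \<eta> i \<omega> *v (B (p (Suc i)) \<omega> - B (p i) \<omega>))"
  have pm': "i \<le> m \<Longrightarrow> m \<le> n \<Longrightarrow> p i \<le> p m" for i m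
  proof (induction m)
    case (Suc m)
    then show ?case using p[of m] by (cases "i = Suc m") auto
  qed simp
  have pm: "0 \<le> p m" if "m \<le> n" for m
    using pm'[of 0 m] p0 that by simp
  have "m \<le> n \<Longrightarrow> ?Q m \<in> borel_measurable (F (p m)) \<and>
     has_bochner_integral M (\<lambda>\<omega>. (norm (?Q m \<omega>))\<^sup>2)
    (\<Sum>i<m. (p (Suc i) - p i) * expectation (\<lambda>\<omega>. (norm (\<eta> i \<omega>))\<^sup>2))" for m
  proof (induction m)
    case 0
    then show ?case by (simp add: has_bochner_integral_zero)
  next
    case (Suc m)
    then have mn: "m < n" and IH: "?Q m \<in> borel_measurable (F (p m))"
        "has_bochner_integral M (\<lambda>\<omega>. (norm (?Q m \<omega>))\<^sup>2)
    (\<Sum>i<m. (p (Suc i) - p i) * expectation (\<lambda>\<omega>. (norm (\<eta> i \<omega>))\<^sup>2))" by auto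
    let ?D = "\<lambda>\<omega>. B (p (Suc m)) \<omega> - B (p m) \<omega>"
    have pp: "0 \<le> p m" "p m \<le> p (Suc m)" using pm[of m] p[OF mn] mn by auto
    have \<eta>m[measurable]: "\<eta> m \<in> borel_measurable (F (p m))" using \<eta>[OF mn] .
    have [measurable]: "?Q m \<in> borel_measurable (F (p m))" by fact
    \<comment> \<open>Moving \<open>\<eta> m\<close> to the other side of the inner product turns
      the cross term into a known coefficient against the increment, which has mean zero.\<close>
    define w where "w = (\<lambda>\<omega>. ?Q m \<omega> v* \<eta> m \<omega>)"
    have wm[measurable]: "w \<in> borel_measurable (F (p m))"
      unfolding w_def by measurable
    have wQ: "w \<omega> \<bullet> x = ?Q m \<omega> \<bullet> (\<eta> m \<omega> *v x)" for \<omega> x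
      by (simp add: w_def dot_lmul_matrix)
    \<comment> \<open>Square integrability of the partial sum is what the induction provides; x
      \<le> 1 + x^2 turns it into integrability of \<open>w\<close>.\<close>
    have "norm (w \<omega>) \<le> C * (1 + (norm (?Q m \<omega>))\<^sup>2)" if "\<omega> \<in> space M" for \<omega>
    proof -
      have "norm (w \<omega>) \<le> norm (?Q m \<omega>) * norm (\<eta> m \<omega>)"
        unfolding w_def by (rule norm_vector_matrix_mult_le)
      also have "\<dots> \<le> (1 + (norm (?Q m \<omega>))\<^sup>2) * C"
        using bd[OF mn that] zero_le_power2[of "norm (?Q m \<omega>) - 1/2"]
        by (intro mult_mono) (auto simp: power2_diff power_divide)
      finally show ?thesis by (simp add: mult.commute)
    qed
    then have wi: "integrable M w"
      using integrable.intros[OF IH(2)] measurable_F_M[OF wm]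
      by (intro Bochner_Integration.integrable_bound[of _ "\<lambda>\<omega>. C * (1 + (norm (?Q m \<omega>))\<^sup>2)" w])
         (auto intro!: AE_I2 order_trans[OF _ abs_ge_self])
    have 1: "has_bochner_integral M (\<lambda>\<omega>. 2 * (w \<omega> \<bullet> ?D \<omega>)) (2 * 0)"
      by (intro has_bochner_integral_mult_right increment_inner_mean pp wm wi)
    have 2: "has_bochner_integral M (\<lambda>\<omega>. (norm (\<eta> m \<omega> *v ?D \<omega>))\<^sup>2)
      ((p (Suc m) - p m) * expectation (\<lambda>\<omega>. (norm (\<eta> m \<omega>))\<^sup>2))"
      by (rule increment_matrix_norm[OF pp \<eta>m bd[OF mn]])
    have 3: "(norm (?Q m \<omega>))\<^sup>2 + 2 * (w \<omega> \<bullet> ?D \<omega>) + (norm (\<eta> m \<omega> *v ?D \<omega>))\<^sup>2 = (norm (?Q (Suc m) \<omega>))\<^sup>2" for \<omega>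
      unfolding wQ by (simp add: power2_norm_eq_inner inner_add_left inner_add_right inner_commute)
    have "B (p (Suc m)) \<in> borel_measurable (F (p (Suc m)))" "B (p m) \<in> borel_measurable (F (p (Suc m)))"
      using B_measurable_F pp measurable_F_mono[OF pp(2)] by auto
    then have 4: "?Q (Suc m) \<in> borel_measurable (F (p (Suc m)))"
      using measurable_F_mono[OF pp(2) IH(1)] measurable_F_mono[OF pp(2) \<eta>m] by simp
    from has_bochner_integral_add[OF has_bochner_integral_add[OF IH(2) 1] 2] 4
    show ?case unfolding 3 by simp
  qed
  from this[of n] show ?thesis by simp
qed

end

section \<open>Ito integrals of bounded integrands\<close>

lemma nn_integral_step_function:
  fixes p :: "nat \<Rightarrow> real"
  assumes p: "\<And>i. i < m \<Longrightarrow> p i \<le> p (Suc i)"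
    and f: "\<And>i u. i < m \<Longrightarrow> p i < u \<Longrightarrow> u \<le> p (Suc i) \<Longrightarrow> f u = c i"
  shows "(\<integral>\<^sup>+u\<in>{p 0..p m}. f u \<partial>lborel) = (\<Sum>i<m. c i * ennreal (p (Suc i) - p i))"
proof -
  have pm: "k \<le> m \<Longrightarrow> p 0 \<le> p k" for k
    by (induction k) (use p in \<open>auto intro: order_trans\<close>)
  have eq: "k \<le> m \<Longrightarrow> u \<noteq> p 0 \<Longrightarrow> f u * indicator {p 0..p k} u = (\<Sum>i<k. c i * indicator {p i<..p (Suc i)} u)" for u k
  proof (induction k)
    case (Suc k)
    have "f u * indicator {p 0..p (Suc k)} u = f u * indicator {p 0..p k} u + c k * indicator {p k<..p (Suc k)} u"
      using Suc.prems p[of k] pm[of k] f[of k u] by (auto split: split_indicator)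
    then show ?case using Suc by simp
  qed (auto split: split_indicator)
  \<comment> \<open>The cells are open on the left, so nothing is known about \<open>f\<close> at
    \<open>p 0\<close>; a single point is a null set.\<close>
  have "AE u in lborel. u \<noteq> p 0" by (rule AE_lborel_singleton)
  then have "(\<integral>\<^sup>+u\<in>{p 0..p m}. f u \<partial>lborel) = (\<integral>\<^sup>+u. (\<Sum>i<m. c i * indicator {p i<..p (Suc i)} u) \<partial>lborel)"
    by (intro nn_integral_cong_AE) (auto simp: eq)
  also have "\<dots> = (\<Sum>i<m. c i * ennreal (p (Suc i) - p i))"
    using p by (subst nn_integral_sum) (auto simp: nn_integral_cmult_indicator)
  finally show ?thesis .
qed

lemma sigma_finite_restrict_lborel:
  "S \<in> sets borel \<Longrightarrow> sigma_finite_measure (restrict_space lborel (S :: real set))"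
  by (rule sigma_finite_measure_restrict_space) (auto intro: lborel.sigma_finite_measure_axioms)

lemma borel_measurable_set_nn_integral:
  fixes f :: "real \<Rightarrow> 'w \<Rightarrow> ennreal"
  assumes f: "(\<lambda>(u, \<omega>). f u \<omega>) \<in> borel_measurable (restrict_space borel S \<Otimes>\<^sub>M N)"
    and S: "S \<in> sets borel"
  shows "(\<lambda>\<omega>. \<integral>\<^sup>+u\<in>S. f u \<omega> \<partial>lborel) \<in> borel_measurable N"
proof -
  interpret sigma_finite_measure "restrict_space lborel S"
    using S by (rule sigma_finite_restrict_lborel)
  have "(\<lambda>(\<omega>, u). f u \<omega>) \<in> borel_measurable (N \<Otimes>\<^sub>M restrict_space borel S)"
    using measurable_compose[OF measurable_pair_swap' f] by (simp add: split_beta' )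
  then have "(\<lambda>(\<omega>, u). f u \<omega>) \<in> borel_measurable (N \<Otimes>\<^sub>M restrict_space lborel S)"
    by (simp cong: measurable_cong_sets sets_pair_measure_cong add: sets_restrict_space)
  from borel_measurable_nn_integral[OF this] S
  show ?thesis by (simp add: nn_integral_restrict_space)
qed

lemma joint_measurable_section:
  assumes f: "(\<lambda>(u, \<omega>). f u \<omega>) \<in> measurable (restrict_space borel S \<Otimes>\<^sub>M N) K"
    and "\<omega> \<in> space N"
  shows "(\<lambda>u. f u \<omega>) \<in> measurable (restrict_space borel S) K"
  using measurable_compose[OF measurable_Pair2' f, of \<omega>] assms by simp

lemma joint_measurable_subset:
  assumes f: "(\<lambda>(u, \<omega>). f u \<omega>) \<in> measurable (restrict_space borel S \<Otimes>\<^sub>M N) K" and "S' \<subseteq> S"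
  shows "(\<lambda>(u, \<omega>). f u \<omega>) \<in> measurable (restrict_space borel S' \<Otimes>\<^sub>M N) K"
proof -
  have "(\<lambda>x. x) \<in> measurable (restrict_space borel S') (restrict_space borel S)"
    using \<open>S' \<subseteq> S\<close> by (intro measurable_restrict_space3) auto
  then have "(\<lambda>p. (fst p, snd p)) \<in> measurable (restrict_space borel S' \<Otimes>\<^sub>M N) (restrict_space borel S \<Otimes>\<^sub>M N)"
    by (intro measurable_Pair measurable_compose[OF measurable_fst] measurable_snd)
  from measurable_compose[OF this f] show ?thesis by (simp add: split_beta')
qed

lemma iterated_nn_integral_linear:
  fixes f g :: "real \<Rightarrow> 'w \<Rightarrow> ennreal"
  assumes f: "(\<lambda>(u, \<omega>). f u \<omega>) \<in> borel_measurable (restrict_space borel S \<Otimes>\<^sub>M N)"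
    and g: "(\<lambda>(u, \<omega>). g u \<omega>) \<in> borel_measurable (restrict_space borel S \<Otimes>\<^sub>M N)"
    and S: "S \<in> sets borel"
  shows "(\<integral>\<^sup>+\<omega>. (\<integral>\<^sup>+u\<in>S. (a * f u \<omega> + b * g u \<omega>) \<partial>lborel) \<partial>N)
    = a * (\<integral>\<^sup>+\<omega>. (\<integral>\<^sup>+u\<in>S. f u \<omega> \<partial>lborel) \<partial>N) + b * (\<integral>\<^sup>+\<omega>. (\<integral>\<^sup>+u\<in>S. g u \<omega> \<partial>lborel) \<partial>N)"
proof -
  have "(\<integral>\<^sup>+u\<in>S. (a * f u \<omega> + b * g u \<omega>) \<partial>lborel)
    = a * (\<integral>\<^sup>+u\<in>S. f u \<omega> \<partial>lborel) + b * (\<integral>\<^sup>+u\<in>S. g u \<omega> \<partial>lborel)" if "\<omega> \<in> space N" for \<omega>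
  proof -
    have "sets (restrict_space borel S) = sets (restrict_space lborel S)" by (simp add: sets_restrict_space)
    then have [measurable]: "(\<lambda>u. f u \<omega>) \<in> borel_measurable (restrict_space lborel S)"
      "(\<lambda>u. g u \<omega>) \<in> borel_measurable (restrict_space lborel S)"
      using joint_measurable_section[OF f that] joint_measurable_section[OF g that]
      by (simp_all cong: measurable_cong_sets)
    show ?thesis
      using S by (simp add: nn_integral_restrict_space[symmetric] nn_integral_add nn_integral_cmult)
  qed
  then have "(\<integral>\<^sup>+\<omega>. (\<integral>\<^sup>+u\<in>S. (a * f u \<omega> + b * g u \<omega>) \<partial>lborel) \<partial>N)
    = (\<integral>\<^sup>+\<omega>. a * (\<integral>\<^sup>+u\<in>S. f u \<omega> \<partial>lborel) + b * (\<integral>\<^sup>+u\<in>S. g u \<omega> \<partial>lborel) \<partial>N)"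
    by (rule nn_integral_cong)
  also have "\<dots> = a * (\<integral>\<^sup>+\<omega>. (\<integral>\<^sup>+u\<in>S. f u \<omega> \<partial>lborel) \<partial>N) + b * (\<integral>\<^sup>+\<omega>. (\<integral>\<^sup>+u\<in>S. g u \<omega> \<partial>lborel) \<partial>N)"
    using borel_measurable_set_nn_integral[OF f S] borel_measurable_set_nn_integral[OF g S]
    by (subst nn_integral_add) (auto simp: nn_integral_cmult)
  finally show ?thesis .
qed

text \<open>Convergence in probability gives L1 convergence of the truncations
  \<open>min 1 \<bar>d k \<omega>\<bar>\<close>, hence an almost surely convergent subsequence. Once
  a truncation is below 1 it agrees with \<open>\<bar>d k \<omega>\<bar>\<close>.\<close>

lemma (in prob_space) AE_convergent_subsequence:
  fixes d :: "nat \<Rightarrow> 'a \<Rightarrow> real"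
  assumes [measurable]: "\<And>k. d k \<in> borel_measurable M"
    and conv: "\<And>\<epsilon>. 0 < \<epsilon> \<Longrightarrow> (\<lambda>k. prob {\<omega> \<in> space M. \<epsilon> < \<bar>d k \<omega>\<bar>}) \<longlonglongrightarrow> 0"
  obtains r where "strict_mono r" "AE \<omega> in M. (\<lambda>k. d (r k) \<omega>) \<longlonglongrightarrow> 0"
proof -
  let ?u = "\<lambda>k \<omega>. min 1 \<bar>d k \<omega>\<bar>"
  have int: "integrable M (?u k)" for k
    by (rule integrable_const_bound[of _ 1]) auto
  have "(\<lambda>k. expectation (\<lambda>\<omega>. norm (?u k \<omega>))) \<longlonglongrightarrow> 0"
  proof (rule LIMSEQ_I)
    fix \<epsilon> :: real assume e: "0 < \<epsilon>"
    have "eventually (\<lambda>k. prob {\<omega> \<in> space M. \<epsilon>/2 < \<bar>d k \<omega>\<bar>} < \<epsilon>/2) sequentially"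
      by (rule order_tendstoD[OF conv]) (use e in auto)
    then obtain N where N: "\<And>k. k \<ge> N \<Longrightarrow> prob {\<omega> \<in> space M. \<epsilon>/2 < \<bar>d k \<omega>\<bar>} < \<epsilon>/2"
      by (auto simp: eventually_sequentially)
    have "norm (expectation (\<lambda>\<omega>. norm (?u k \<omega>)) - 0) < \<epsilon>" if "k \<ge> N" for k
    proof -
      define S where "S = {\<omega> \<in> space M. \<epsilon>/2 < \<bar>d k \<omega>\<bar>}"
      have [measurable]: "S \<in> sets M" unfolding S_def by measurable
      have iS: "integrable M (indicat_real S)" by (rule integrable_const_bound[of _ 1]) auto
      have "expectation (\<lambda>\<omega>. norm (?u k \<omega>)) \<le> expectation (\<lambda>\<omega>. \<epsilon>/2 + indicator S \<omega>)"
      proof (rule integral_mono)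
        show "integrable M (\<lambda>\<omega>. \<epsilon>/2 + indicator S \<omega>)" using iS by simp
      qed (use int e in \<open>auto simp: S_def split: split_indicator\<close>)
      also have "\<dots> = \<epsilon>/2 + prob S" using iS by (simp add: prob_space)
      finally show ?thesis using N[OF that, folded S_def] by (simp add: integral_nonneg_AE)
    qed
    then show "\<exists>no. \<forall>n\<ge>no. norm (expectation (\<lambda>\<omega>. norm (?u n \<omega>)) - 0) < \<epsilon>" by blast
  qed
  from tendsto_L1_AE_subseq[OF int this] obtain r where r: "strict_mono r"
    "AE \<omega> in M. (\<lambda>k. ?u (r k) \<omega>) \<longlonglongrightarrow> 0" by auto
  have "(\<lambda>k. d (r k) \<omega>) \<longlonglongrightarrow> 0" if "(\<lambda>k. ?u (r k) \<omega>) \<longlonglongrightarrow> 0" for \<omega>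
  proof -
    have "eventually (\<lambda>k. ?u (r k) \<omega> < 1) sequentially"
      by (rule order_tendstoD[OF that]) simp
    then have "eventually (\<lambda>k. ?u (r k) \<omega> = \<bar>d (r k) \<omega>\<bar>) sequentially"
      by eventually_elim auto
    from Lim_transform_eventually[OF that this] show ?thesis by (simp add: tendsto_rabs_zero_iff)
  qed
  with r that show ?thesis by (metis (mono_tags, lifting) AE_mp AE_I2)
qed

lemma simple_integrand_mono:
  assumes "simple_integrand M F n \<tau> \<xi>"
  shows "i \<le> j \<Longrightarrow> j \<le> n \<Longrightarrow> \<tau> i \<le> \<tau> j"
proof (induction j)
  case (Suc j)
  have "\<tau> j < \<tau> (Suc j)" using assms Suc.prems by (simp add: simple_integrand_def)
  then show ?case using Suc by (cases "i = Suc j") auto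
qed simp

lemma simple_integrand_indicator:
  assumes si: "simple_integrand M F n \<tau> \<xi>" and j: "j < n" "\<tau> j < u" "u \<le> \<tau> (Suc j)" and k: "k < n"
  shows "indicator {\<tau> k<..\<tau> (Suc k)} u = (if k = j then 1 else 0 :: real)"
  using j k simple_integrand_mono[OF si, of "Suc k" j] simple_integrand_mono[OF si, of "Suc j" k]
  by (cases k j rule: linorder_cases) (auto split: split_indicator)

lemma simple_process_eq:
  assumes si: "simple_integrand M F n \<tau> \<xi>" and j: "j < n" "\<tau> j < u" "u \<le> \<tau> (Suc j)"
  shows "simple_process n \<tau> \<xi> u \<omega> = \<xi> j \<omega>"
proof -
  have "simple_process n \<tau> \<xi> u \<omega> = (\<Sum>k<n. if k = j then \<xi> k \<omega> else 0)"
    unfolding simple_process_def using simple_integrand_indicator[OF si j] by (intro sum.cong) auto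
  then show ?thesis using j by simp
qed

section \<open>Increments of elementary integrals as sums over one grid\<close>

context brownian
begin

definition increment_grid ::
    "nat \<Rightarrow> (nat \<Rightarrow> real) \<Rightarrow> (nat \<Rightarrow> 'w \<Rightarrow> real^'d^'d) \<Rightarrow> real \<Rightarrow> real \<Rightarrow> ('w \<Rightarrow> real^'d^'d) \<Rightarrow>
      (nat \<Rightarrow> real) \<Rightarrow> (nat \<Rightarrow> 'w \<Rightarrow> real^'d^'d) \<Rightarrow> real \<Rightarrow> nat \<Rightarrow> bool" where
  "increment_grid n \<tau> \<xi> s t V p \<eta> C m \<longleftrightarrow>
     p 0 = s \<and> p m = t \<and> (\<forall>i<m. p i \<le> p (Suc i)) \<and>
     (\<forall>i<m. \<eta> i \<in> borel_measurable (F (p i))) \<and>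
     (\<forall>i<m. \<forall>\<omega>\<in>space M. norm (\<eta> i \<omega>) \<le> C) \<and>
     (\<forall>\<omega>. simple_ito_integral n \<tau> \<xi> B t \<omega> - simple_ito_integral n \<tau> \<xi> B s \<omega> - V \<omega> *v (B t \<omega> - B s \<omega>)
        = (\<Sum>i<m. \<eta> i \<omega> *v (B (p (Suc i)) \<omega> - B (p i) \<omega>))) \<and>
     (\<forall>i<m. \<forall>u \<omega>. p i < u \<longrightarrow> u \<le> p (Suc i) \<longrightarrow> simple_process n \<tau> \<xi> u \<omega> - V \<omega> = \<eta> i \<omega>)"

lemma simple_increment_grid:
  fixes V :: "'w \<Rightarrow> real^'d^'d"
  assumes si: "simple_integrand M F n \<tau> \<xi>" and st: "0 \<le> s" "s \<le> t"
    and V: "V \<in> borel_measurable (F s)" "\<And>\<omega>. \<omega> \<in> space M \<Longrightarrow> norm (V \<omega>) \<le> C'"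
  obtains p \<eta> C m where "increment_grid n \<tau> \<xi> s t V p \<eta> C m"
proof -
  define c where "c = (\<lambda>x. max s (min x t))"
  \<comment> \<open>The grid points are \<open>s\<close>, the times \<tau> 0, ..., \<tau> n clipped
    to [s, t], and \<open>t\<close>. In the first and the last cell the simple process vanishes,
    which leaves \<open>- V\<close>.\<close>
  define p where "p = (\<lambda>i. case i of 0 \<Rightarrow> s | Suc j \<Rightarrow> if j \<le> n then c (\<tau> j) else t)"
  \<comment> \<open>If \<open>\<tau> j\<close> is larger than \<open>t\<close>, the cell is clipped
    to the single point \<open>t\<close>, where \<open>\<xi> j\<close> need not be known yet;
    \<open>- V\<close> is then a measurable substitute that multiplies a zero increment.\<close>
  define \<eta> where "\<eta> = (\<lambda>i \<omega>. case i of 0 \<Rightarrow> - V \<omega> | Suc j \<Rightarrow> if j < n \<and> \<tau> j \<le> t then \<xi> j \<omega> - V \<omega> else - V \<omega>)"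
  have \<tau>: "0 \<le> \<tau> 0" "\<And>i. i < n \<Longrightarrow> \<tau> i < \<tau> (Suc i)" and
    \<xi>: "\<And>i. i < n \<Longrightarrow> \<xi> i \<in> borel_measurable (F (\<tau> i))" "\<And>i. i < n \<Longrightarrow> bounded (\<xi> i ` space M)"
    using si by (auto simp: simple_integrand_def)
  note \<tau>m = simple_integrand_mono[OF si]
  have cs: "s \<le> c x" "c x \<le> t" "x \<le> y \<Longrightarrow> c x \<le> c y" for x y using st by (auto simp: c_def)
  have ps: "s \<le> p i" for i using st cs by (auto simp: p_def split: nat.split)
  have \<xi>b: "\<exists>b. \<forall>\<omega>\<in>space M. norm (\<xi> i \<omega>) \<le> b" if "i < n" for i
    using \<xi>(2)[OF that] by (auto simp: bounded_iff)
  then obtain b where b: "\<And>i \<omega>. i < n \<Longrightarrow> \<omega> \<in> space M \<Longrightarrow> norm (\<xi> i \<omega>) \<le> b i" by metis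
  define C where "C = (\<Sum>i<n. \<bar>b i\<bar>) + \<bar>C'\<bar>"
  have bC: "\<bar>b i\<bar> + \<bar>C'\<bar> \<le> C" if "i < n" for i
    unfolding C_def using that by (auto intro: member_le_sum)
  have C'C: "\<bar>C'\<bar> \<le> C" unfolding C_def by (auto intro: sum_nonneg)
  have "increment_grid n \<tau> \<xi> s t V p \<eta> C (Suc (Suc n))"
    unfolding increment_grid_def
  proof (intro conjI allI ballI impI)
    show "p 0 = s" by (simp add: p_def)
    show "p (Suc (Suc n)) = t" by (simp add: p_def)
    show "p i \<le> p (Suc i)" if "i < Suc (Suc n)" for i
      using that cs(1,2) cs(3)[of "\<tau> (i - 1)" "\<tau> i"] \<tau>(2)[of "i - 1"] st
      by (auto simp: p_def split: nat.split)
    show "\<eta> i \<in> borel_measurable (F (p i))" if "i < Suc (Suc n)" for i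
    proof -
      have Vp: "V \<in> borel_measurable (F (p i))" by (rule measurable_F_mono[OF ps V(1)])
      show ?thesis
      proof (cases "\<exists>j<n. i = Suc j \<and> \<tau> j \<le> t")
        case True
        then obtain j where j: "j < n" "i = Suc j" "\<tau> j \<le> t" by auto
        then have "\<xi> j \<in> borel_measurable (F (p i))"
          by (intro measurable_F_mono[OF _ \<xi>(1)]) (auto simp: p_def c_def)
        then show ?thesis using Vp j by (simp add: \<eta>_def)
      next
        case False
        then have "\<eta> i = (\<lambda>\<omega>. - V \<omega>)" by (auto simp: \<eta>_def fun_eq_iff split: nat.split)
        then show ?thesis using Vp by simp
      qed
    qed
    show "norm (\<eta> i \<omega>) \<le> C" if "i < Suc (Suc n)" "\<omega> \<in> space M" for i \<omega>
    proof (cases "\<exists>j<n. i = Suc j \<and> \<tau> j \<le> t")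
      case True
      then obtain j where j: "j < n" "i = Suc j" "\<tau> j \<le> t" by auto
      then have "norm (\<eta> i \<omega>) \<le> norm (\<xi> j \<omega>) + norm (V \<omega>)" by (simp add: \<eta>_def norm_triangle_ineq4)
      then show ?thesis using b[OF j(1) that(2)] V(2)[OF that(2)] bC[OF j(1)] by linarith
    next
      case False
      then have "\<eta> i = (\<lambda>\<omega>. - V \<omega>)" by (auto simp: \<eta>_def fun_eq_iff split: nat.split)
      then show ?thesis using V(2)[OF that(2)] C'C by simp
    qed
    show "simple_ito_integral n \<tau> \<xi> B t \<omega> - simple_ito_integral n \<tau> \<xi> B s \<omega> - V \<omega> *v (B t \<omega> - B s \<omega>)
      = (\<Sum>i<Suc (Suc n). \<eta> i \<omega> *v (B (p (Suc i)) \<omega> - B (p i) \<omega>))" for \<omega>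
    proof -
      have 1: "\<xi> j \<omega> *v (B (min (\<tau> (Suc j)) t) \<omega> - B (min (\<tau> j) t) \<omega>) - \<xi> j \<omega> *v (B (min (\<tau> (Suc j)) s) \<omega> - B (min (\<tau> j) s) \<omega>)
        = \<eta> (Suc j) \<omega> *v (B (p (Suc (Suc j))) \<omega> - B (p (Suc j)) \<omega>) + V \<omega> *v (B (p (Suc (Suc j))) \<omega> - B (p (Suc j)) \<omega>)"
        if "j < n" for j
      proof -
        have "(B (min (\<tau> (Suc j)) t) \<omega> - B (min (\<tau> j) t) \<omega>) - (B (min (\<tau> (Suc j)) s) \<omega> - B (min (\<tau> j) s) \<omega>)
           = B (c (\<tau> (Suc j))) \<omega> - B (c (\<tau> j)) \<omega>"
          using \<tau>(2)[OF that] st unfolding c_def by (auto simp: min_def max_def)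
        moreover have "p (Suc (Suc j)) = c (\<tau> (Suc j))" "p (Suc j) = c (\<tau> j)" using that by (auto simp: p_def)
        moreover have "c (\<tau> (Suc j)) = c (\<tau> j)" if "\<not> \<tau> j \<le> t"
          using that \<tau>(2)[OF \<open>j < n\<close>] by (auto simp: c_def)
        ultimately show ?thesis using that
          by (cases "\<tau> j \<le> t") (auto simp: \<eta>_def matrix_vector_mult_diff_distrib[symmetric] matrix_vector_mult_diff_rdistrib)
      qed
      have 2: "simple_ito_integral n \<tau> \<xi> B t \<omega> - simple_ito_integral n \<tau> \<xi> B s \<omega>
        = (\<Sum>j<n. \<eta> (Suc j) \<omega> *v (B (p (Suc (Suc j))) \<omega> - B (p (Suc j)) \<omega>)) + V \<omega> *v (\<Sum>j<n. (B (p (Suc (Suc j))) \<omega> - B (p (Suc j)) \<omega>))"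
        unfolding simple_ito_integral_def sum_subtractf[symmetric] linear_sum[OF matrix_vector_mul_linear]
          sum.distrib[symmetric]
        by (intro sum.cong refl 1) simp
      have 3: "(\<Sum>j<n. (B (p (Suc (Suc j))) \<omega> - B (p (Suc j)) \<omega>)) = B (p (Suc n)) \<omega> - B (p (Suc 0)) \<omega>"
        by (rule sum_lessThan_telescope)
      have 4: "\<eta> 0 \<omega> = - V \<omega>" "\<eta> (Suc n) \<omega> = - V \<omega>" "p 0 = s" "p (Suc (Suc n)) = t" by (auto simp: \<eta>_def p_def)
      have neg: "(- A) *v x = - (A *v x)" for A :: "real^'d^'d" and x
        using matrix_vector_mult_diff_rdistrib[of 0 A x] by simp
      show ?thesis
        unfolding 2 3 sum.lessThan_Suc_shift[of _ "Suc n"] sum.lessThan_Suc[of _ n] o_def 4 neg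
        by (simp add: matrix_vector_mult_diff_distrib)
    qed
    show "simple_process n \<tau> \<xi> u \<omega> - V \<omega> = \<eta> i \<omega>" if "i < Suc (Suc n)" "p i < u" "u \<le> p (Suc i)" for i u \<omega>
    proof (cases "\<exists>j<n. i = Suc j")
      case True
      then obtain j where j: "j < n" "i = Suc j" by auto
      then have u: "c (\<tau> j) < u" "u \<le> c (\<tau> (Suc j))" using that by (auto simp: p_def)
      then have u': "\<tau> j < u" "u \<le> \<tau> (Suc j)" "\<tau> j \<le> t" by (auto simp: c_def)
      from simple_process_eq[OF si j(1) u'(1,2)]
      show ?thesis using j u' by (simp add: \<eta>_def)
    next
      case False
      have "indicat_real {\<tau> k<..\<tau> (Suc k)} u = 0" if "k < n" for k
      proof -
        have "i = 0 \<or> i = Suc n" using False \<open>i < Suc (Suc n)\<close> by (cases i) auto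
        then have "u \<le> \<tau> 0 \<or> \<tau> n < u"
        proof
          assume "i = 0"
          then show ?thesis using \<open>p i < u\<close> \<open>u \<le> p (Suc i)\<close> by (auto simp: p_def c_def)
        next
          assume "i = Suc n"
          then show ?thesis using \<open>p i < u\<close> \<open>u \<le> p (Suc i)\<close> by (auto simp: p_def c_def)
        qed
        then show ?thesis using \<tau>m[of 0 k] \<tau>m[of "Suc k" n] that by (auto split: split_indicator)
      qed
      then have "simple_process n \<tau> \<xi> u \<omega> = 0" by (simp add: simple_process_def)
      moreover have "\<eta> i \<omega> = - V \<omega>" using False that by (auto simp: \<eta>_def split: nat.split)
      ultimately show ?thesis by simp
    qed
  qed
  then show thesis by (rule that)
qed

text \<open>Both sides are the same sum over the grid: the left one by orthogonality of the
  increments, the right one because the integrand is a step function. Multiplying the coefficients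
  by the indicator of \<open>A\<close> keeps them adapted since \<open>A\<close> belongs to
  \<open>F s\<close>.\<close>

lemma simple_increment_isometry:
  fixes V :: "'w \<Rightarrow> real^'d^'d"
  assumes si: "simple_integrand M F n \<tau> \<xi>" and st: "0 \<le> s" "s \<le> t"
    and V: "V \<in> borel_measurable (F s)" "\<And>\<omega>. \<omega> \<in> space M \<Longrightarrow> norm (V \<omega>) \<le> C'"
    and A: "A \<in> sets (F s)"
  shows "(\<integral>\<^sup>+\<omega>\<in>A. ennreal ((norm (simple_ito_integral n \<tau> \<xi> B t \<omega> - simple_ito_integral n \<tau> \<xi> B s \<omega>
             - V \<omega> *v (B t \<omega> - B s \<omega>)))\<^sup>2) \<partial>M)
    = (\<integral>\<^sup>+\<omega>\<in>A. (\<integral>\<^sup>+u\<in>{s..t}. ennreal ((norm (simple_process n \<tau> \<xi> u \<omega> - V \<omega>))\<^sup>2) \<partial>lborel) \<partial>M)"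
proof -
  obtain p \<eta> C m where g: "increment_grid n \<tau> \<xi> s t V p \<eta> C m"
    using simple_increment_grid[OF si st V] by blast
  have p: "p 0 = s" "p m = t" "\<And>i. i < m \<Longrightarrow> p i \<le> p (Suc i)"
    and \<eta>: "\<And>i. i < m \<Longrightarrow> \<eta> i \<in> borel_measurable (F (p i))"
    and C: "\<And>i \<omega>. i < m \<Longrightarrow> \<omega> \<in> space M \<Longrightarrow> norm (\<eta> i \<omega>) \<le> C"
    and I: "\<And>\<omega>. simple_ito_integral n \<tau> \<xi> B t \<omega> - simple_ito_integral n \<tau> \<xi> B s \<omega> - V \<omega> *v (B t \<omega> - B s \<omega>)
      = (\<Sum>i<m. \<eta> i \<omega> *v (B (p (Suc i)) \<omega> - B (p i) \<omega>))"
    and sp: "\<And>i u \<omega>. i < m \<Longrightarrow> p i < u \<Longrightarrow> u \<le> p (Suc i) \<Longrightarrow> simple_process n \<tau> \<xi> u \<omega> - V \<omega> = \<eta> i \<omega>"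
    using g by (auto simp: increment_grid_def)
  define \<eta>' where "\<eta>' = (\<lambda>i \<omega>. indicator A \<omega> *\<^sub>R \<eta> i \<omega>)"
  have ps: "i \<le> m \<Longrightarrow> s \<le> p i" for i
    by (induction i) (use p in \<open>auto intro: order_trans\<close>)
  have m\<eta>': "\<eta>' i \<in> borel_measurable (F (p i))" if "i < m" for i
  proof -
    have [measurable]: "A \<in> sets (F (p i))" "\<eta> i \<in> borel_measurable (F (p i))"
      using A sets_F_mono[OF ps[of i]] \<eta>[OF that] that by auto
    show ?thesis unfolding \<eta>'_def by measurable
  qed
  have C': "norm (\<eta>' i \<omega>) \<le> C" if "i < m" "\<omega> \<in> space M" for i \<omega>
    using C[OF that] order_trans[OF norm_ge_zero C[OF that]] by (auto simp: \<eta>'_def split: split_indicator)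
  have sq: "(norm (\<eta>' i \<omega>))\<^sup>2 = (norm (\<eta> i \<omega>))\<^sup>2 * indicator A \<omega>" for i \<omega>
    by (auto simp: \<eta>'_def split: split_indicator)
  have iso: "has_bochner_integral M (\<lambda>\<omega>. (norm (\<Sum>i<m. \<eta>' i \<omega> *v (B (p (Suc i)) \<omega> - B (p i) \<omega>)))\<^sup>2)
    (\<Sum>i<m. (p (Suc i) - p i) * expectation (\<lambda>\<omega>. (norm (\<eta>' i \<omega>))\<^sup>2))"
    by (rule grid_isometry) (use p st m\<eta>' C' in auto)
  have eq: "(norm (\<Sum>i<m. \<eta>' i \<omega> *v (B (p (Suc i)) \<omega> - B (p i) \<omega>)))\<^sup>2
     = (norm (\<Sum>i<m. \<eta> i \<omega> *v (B (p (Suc i)) \<omega> - B (p i) \<omega>)))\<^sup>2 * indicator A \<omega>" for \<omega>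
    by (auto simp: \<eta>'_def split: split_indicator)
  have int: "integrable M (\<lambda>\<omega>. (norm (\<eta>' i \<omega>))\<^sup>2)" if "i < m" for i
    by (rule integrable_const_bound[of _ "C\<^sup>2"])
      (use C'[OF that] measurable_F_M[OF m\<eta>'[OF that]] in \<open>auto intro!: AE_I2 power_mono\<close>)
  have "(\<integral>\<^sup>+\<omega>\<in>A. ennreal ((norm (simple_ito_integral n \<tau> \<xi> B t \<omega> - simple_ito_integral n \<tau> \<xi> B s \<omega>
             - V \<omega> *v (B t \<omega> - B s \<omega>)))\<^sup>2) \<partial>M)
     = (\<integral>\<^sup>+\<omega>. ennreal ((norm (\<Sum>i<m. \<eta>' i \<omega> *v (B (p (Suc i)) \<omega> - B (p i) \<omega>)))\<^sup>2) \<partial>M)"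
    unfolding I eq by (intro nn_integral_cong) (auto split: split_indicator)
  also have "\<dots> = ennreal (\<Sum>i<m. (p (Suc i) - p i) * expectation (\<lambda>\<omega>. (norm (\<eta>' i \<omega>))\<^sup>2))"
    using iso by (subst nn_integral_eq_integral) (auto simp: has_bochner_integral_iff)
  also have "\<dots> = (\<Sum>i<m. ennreal (p (Suc i) - p i) * ennreal (expectation (\<lambda>\<omega>. (norm (\<eta>' i \<omega>))\<^sup>2)))"
    using p(3) by (subst sum_ennreal[symmetric]) (auto simp: ennreal_mult' intro!: mult_nonneg_nonneg integral_nonneg_AE)
  also have "\<dots> = (\<Sum>i<m. ennreal (p (Suc i) - p i) * (\<integral>\<^sup>+\<omega>. ennreal ((norm (\<eta>' i \<omega>))\<^sup>2) \<partial>M))"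
    using int by (intro sum.cong refl) (subst nn_integral_eq_integral, auto)
  also have "\<dots> = (\<integral>\<^sup>+\<omega>. (\<Sum>i<m. ennreal (p (Suc i) - p i) * ennreal ((norm (\<eta>' i \<omega>))\<^sup>2)) \<partial>M)"
    using measurable_F_M[OF m\<eta>'] by (subst nn_integral_sum) (auto simp: nn_integral_cmult)
  also have "\<dots> = (\<integral>\<^sup>+\<omega>\<in>A. (\<integral>\<^sup>+u\<in>{s..t}. ennreal ((norm (simple_process n \<tau> \<xi> u \<omega> - V \<omega>))\<^sup>2) \<partial>lborel) \<partial>M)"
  proof (rule nn_integral_cong)
    fix \<omega>
    have "(\<integral>\<^sup>+u\<in>{p 0..p m}. ennreal ((norm (simple_process n \<tau> \<xi> u \<omega> - V \<omega>))\<^sup>2) \<partial>lborel)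
      = (\<Sum>i<m. ennreal ((norm (\<eta> i \<omega>))\<^sup>2) * ennreal (p (Suc i) - p i))"
      by (rule nn_integral_step_function) (use p sp in auto)
    then show "(\<Sum>i<m. ennreal (p (Suc i) - p i) * ennreal ((norm (\<eta>' i \<omega>))\<^sup>2)) =
      (\<integral>\<^sup>+u\<in>{s..t}. ennreal ((norm (simple_process n \<tau> \<xi> u \<omega> - V \<omega>))\<^sup>2) \<partial>lborel) * indicator A \<omega>"
      unfolding p by (auto simp: sq mult.commute split: split_indicator)
  qed
  finally show ?thesis .
qed

text \<open>With \<open>V = 0\<close> the increment is a grid sum, and \<open>w\<close> combined
  with a coefficient is known at the start of the cell of that coefficient.\<close>

lemma simple_increment_mean:
  fixes w :: "'w \<Rightarrow> real^'d"
  assumes si: "simple_integrand M F n \<tau> \<xi>" and st: "0 \<le> s" "s \<le> t"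
    and w: "w \<in> borel_measurable (F s)" "\<And>\<omega>. \<omega> \<in> space M \<Longrightarrow> norm (w \<omega>) \<le> W"
  shows "has_bochner_integral M (\<lambda>\<omega>. w \<omega> \<bullet> (simple_ito_integral n \<tau> \<xi> B t \<omega> - simple_ito_integral n \<tau> \<xi> B s \<omega>)) 0"
proof -
  have z: "(\<lambda>_. 0) \<in> borel_measurable (F s)" "\<And>\<omega>. \<omega> \<in> space M \<Longrightarrow> norm (0::real^'d^'d) \<le> 0" by auto
  obtain p \<eta> C m where g: "increment_grid n \<tau> \<xi> s t (\<lambda>_. 0) p \<eta> C m"
    by (rule simple_increment_grid[OF si st z(1), of 0]) auto
  have p: "p 0 = s" "p m = t" "\<And>i. i < m \<Longrightarrow> p i \<le> p (Suc i)"
    and \<eta>: "\<And>i. i < m \<Longrightarrow> \<eta> i \<in> borel_measurable (F (p i))"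
    and C: "\<And>i \<omega>. i < m \<Longrightarrow> \<omega> \<in> space M \<Longrightarrow> norm (\<eta> i \<omega>) \<le> C"
    and I: "\<And>\<omega>. simple_ito_integral n \<tau> \<xi> B t \<omega> - simple_ito_integral n \<tau> \<xi> B s \<omega>
      = (\<Sum>i<m. \<eta> i \<omega> *v (B (p (Suc i)) \<omega> - B (p i) \<omega>))"
    using g by (auto simp: increment_grid_def)
  have ps: "i \<le> m \<Longrightarrow> s \<le> p i" for i
    by (induction i) (use p in \<open>auto intro: order_trans\<close>)
  have "has_bochner_integral M (\<lambda>\<omega>. (w \<omega> v* \<eta> i \<omega>) \<bullet> (B (p (Suc i)) \<omega> - B (p i) \<omega>)) 0" if i: "i < m" for i
  proof (rule increment_inner_mean)
    show "0 \<le> p i" "p i \<le> p (Suc i)" using ps[of i] st p(3) i by auto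
    have [measurable]: "w \<in> borel_measurable (F (p i))" "\<eta> i \<in> borel_measurable (F (p i))"
      using measurable_F_mono[OF ps w(1)] i \<eta> by auto
    show *: "(\<lambda>\<omega>. w \<omega> v* \<eta> i \<omega>) \<in> borel_measurable (F (p i))" by measurable
    show "integrable M (\<lambda>\<omega>. w \<omega> v* \<eta> i \<omega>)"
    proof (rule integrable_const_bound[of _ "W * C"])
      have "norm (w \<omega> v* \<eta> i \<omega>) \<le> W * C" if "\<omega> \<in> space M" for \<omega>
        by (rule order_trans[OF norm_vector_matrix_mult_le mult_mono])
          (use w(2)[OF that] C[OF i that] in \<open>auto intro: order_trans[OF norm_ge_zero]\<close>)
      then show "AE \<omega> in M. norm (w \<omega> v* \<eta> i \<omega>) \<le> W * C" by auto
    qed (rule measurable_F_M[OF *])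
  qed
  then have "has_bochner_integral M (\<lambda>\<omega>. \<Sum>i<m. (w \<omega> v* \<eta> i \<omega>) \<bullet> (B (p (Suc i)) \<omega> - B (p i) \<omega>)) (\<Sum>i<m. 0)"
    by (intro has_bochner_integral_sum) auto
  then show ?thesis using I by (simp add: inner_sum_right dot_lmul_matrix)
qed

lemma simple_process_jointly_measurable:
  assumes si: "simple_integrand M F n \<tau> \<xi>"
  shows "(\<lambda>(u, \<omega>). simple_process n \<tau> \<xi> u \<omega>) \<in> borel_measurable (restrict_space borel {0..t} \<Otimes>\<^sub>M M)"
proof -
  have "\<xi> i \<in> borel_measurable M" if "i < n" for i
    using si that measurable_F_M[of "\<xi> i" "\<tau> i"] by (simp add: simple_integrand_def)
  moreover have "indicat_real {\<tau> i<..\<tau> (Suc i)} \<in> borel_measurable (restrict_space borel {0..t})" for i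
    by (intro measurable_restrict_space1) simp
  ultimately show ?thesis
    unfolding simple_process_def split_beta'
    by (intro borel_measurable_sum borel_measurable_scaleR measurable_compose[OF measurable_fst] measurable_compose[OF measurable_snd]) auto
qed

text \<open>Switching an approximating integrand off once its energy exceeds \<open>L\<close> makes it bounded in \<open>L\<^sup>2\<close>, so that
  convergence in probability can be upgraded to convergence in \<open>L\<^sup>2\<close>.\<close>

lemma simple_integrand_kill:
  assumes si: "simple_integrand M F n \<tau> \<xi>" and "0 \<le> L"
  obtains \<xi>' where "simple_integrand M F n \<tau> \<xi>'"
    "\<And>\<omega>. (\<integral>\<^sup>+u\<in>{0..t}. ennreal ((norm (simple_process n \<tau> \<xi>' u \<omega>))\<^sup>2) \<partial>lborel) \<le> ennreal L"
    "\<And>\<omega> i. (\<integral>\<^sup>+u\<in>{0..t}. ennreal ((norm (simple_process n \<tau> \<xi> u \<omega>))\<^sup>2) \<partial>lborel) \<le> ennreal L \<Longrightarrow> i < n \<Longrightarrow> \<xi>' i \<omega> = \<xi> i \<omega>"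
proof -
  \<comment> \<open>The length of the part of the i-th cell that lies before \<open>t\<close>; the
    outer maximum makes it 0 for cells that start after \<open>t\<close>.\<close>
  define len where "len = (\<lambda>i. max (\<tau> i) (min (\<tau> (Suc i)) t) - \<tau> i)"
  \<comment> \<open>The energy is tested up to and including cell \<open>i\<close>. It is already
    known at time \<open>\<tau> i\<close>, because \<open>\<xi> i\<close> is fixed when its cell
    starts; so the switched-off integrand stays adapted and never overshoots
    \<open>L\<close>.\<close>
  define \<xi>' where "\<xi>' = (\<lambda>i \<omega>. if (\<Sum>j\<le>i. (norm (\<xi> j \<omega>))\<^sup>2 * len j) \<le> L then \<xi> i \<omega> else 0)"
  have \<tau>: "0 \<le> \<tau> 0" "\<And>i. i < n \<Longrightarrow> \<tau> i < \<tau> (Suc i)" and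
    \<xi>: "\<And>i. i < n \<Longrightarrow> \<xi> i \<in> borel_measurable (F (\<tau> i))" "\<And>i. i < n \<Longrightarrow> bounded (\<xi> i ` space M)"
    using si by (auto simp: simple_integrand_def)
  note \<tau>m = simple_integrand_mono[OF si]
  have len: "0 \<le> len i" for i by (simp add: len_def)
  have sq: "(\<integral>\<^sup>+u\<in>{0..t}. ennreal ((norm (simple_process n \<tau> \<zeta> u \<omega>))\<^sup>2) \<partial>lborel)
     = ennreal (\<Sum>i<n. (norm (\<zeta> i \<omega>))\<^sup>2 * len i)" if si': "simple_integrand M F n \<tau> \<zeta>" for \<zeta> \<omega>
  proof -
    have "ennreal ((norm (simple_process n \<tau> \<zeta> u \<omega>))\<^sup>2) * indicator {0..t} u
      = (\<Sum>i<n. ennreal ((norm (\<zeta> i \<omega>))\<^sup>2) * indicator {\<tau> i<..max (\<tau> i) (min (\<tau> (Suc i)) t)} u)" for u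
    proof (cases "\<exists>j<n. \<tau> j < u \<and> u \<le> \<tau> (Suc j)")
      case True
      then obtain j where j: "j < n" "\<tau> j < u" "u \<le> \<tau> (Suc j)" by auto
      have "(\<Sum>i<n. ennreal ((norm (\<zeta> i \<omega>))\<^sup>2) * indicator {\<tau> i<..max (\<tau> i) (min (\<tau> (Suc i)) t)} u)
        = (\<Sum>i<n. if i = j then ennreal ((norm (\<zeta> i \<omega>))\<^sup>2) * indicator {0..t} u else 0)"
      proof (intro sum.cong refl)
        fix i assume "i \<in> {..<n}"
        then have i: "i < n" by simp
        have "0 < u" using \<tau>m[of 0 j] j \<tau>(1) by auto
        then show "ennreal ((norm (\<zeta> i \<omega>))\<^sup>2) * indicator {\<tau> i<..max (\<tau> i) (min (\<tau> (Suc i)) t)} u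
          = (if i = j then ennreal ((norm (\<zeta> i \<omega>))\<^sup>2) * indicator {0..t} u else 0)"
          using simple_integrand_indicator[OF si' j i] j
          by (auto split: split_indicator split_indicator_asm if_splits)
      qed
      also have "\<dots> = ennreal ((norm (\<zeta> j \<omega>))\<^sup>2) * indicator {0..t} u" using j by simp
      finally show ?thesis using simple_process_eq[OF si' j] by simp
    next
      case False
      then have "simple_process n \<tau> \<zeta> u \<omega> = 0"
        unfolding simple_process_def by (intro sum.neutral) (auto split: split_indicator)
      moreover have "(\<Sum>i<n. ennreal ((norm (\<zeta> i \<omega>))\<^sup>2) * indicator {\<tau> i<..max (\<tau> i) (min (\<tau> (Suc i)) t)} u) = 0"
        using False by (intro sum.neutral) (auto split: split_indicator)
      ultimately show ?thesis by simp
    qed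
    then have "(\<integral>\<^sup>+u\<in>{0..t}. ennreal ((norm (simple_process n \<tau> \<zeta> u \<omega>))\<^sup>2) \<partial>lborel)
      = (\<integral>\<^sup>+u. (\<Sum>i<n. ennreal ((norm (\<zeta> i \<omega>))\<^sup>2) * indicator {\<tau> i<..max (\<tau> i) (min (\<tau> (Suc i)) t)} u) \<partial>lborel)"
      by simp
    also have "\<dots> = (\<Sum>i<n. ennreal ((norm (\<zeta> i \<omega>))\<^sup>2) * ennreal (len i))"
      by (subst nn_integral_sum) (auto simp: nn_integral_cmult_indicator len_def)
    also have "\<dots> = ennreal (\<Sum>i<n. (norm (\<zeta> i \<omega>))\<^sup>2 * len i)"
      using len by (subst sum_ennreal[symmetric]) (auto simp: ennreal_mult)
    finally show ?thesis .
  qed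
  have si': "simple_integrand M F n \<tau> \<xi>'"
    unfolding simple_integrand_def
  proof (intro conjI allI impI \<tau>)
    fix i assume i: "i < n"
    have [measurable]: "\<xi> j \<in> borel_measurable (F (\<tau> i))" if "j \<in> {..i}" for j
      using that i by (intro measurable_F_mono[OF _ \<xi>(1)] \<tau>m) auto
    then have [measurable]: "(\<lambda>\<omega>. \<Sum>j\<le>i. (norm (\<xi> j \<omega>))\<^sup>2 * len j) \<in> borel_measurable (F (\<tau> i))"
      by (intro borel_measurable_sum borel_measurable_times borel_measurable_power measurable_compose[OF _ borel_measurable_norm]) auto
    have [measurable]: "\<xi> i \<in> borel_measurable (F (\<tau> i))" using \<xi>(1)[OF i] .
    show "\<xi>' i \<in> borel_measurable (F (\<tau> i))" unfolding \<xi>'_def by measurable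
    have "\<xi>' i ` space M \<subseteq> insert 0 (\<xi> i ` space M)" by (auto simp: \<xi>'_def)
    then show "bounded (\<xi>' i ` space M)" by (rule bounded_subset[rotated]) (use \<xi>(2)[OF i] in simp)
  qed auto
  have le: "(\<Sum>i<m. (norm (\<xi>' i \<omega>))\<^sup>2 * len i) \<le> (\<Sum>i<m. (norm (\<xi> i \<omega>))\<^sup>2 * len i)" for m \<omega>
    by (intro sum_mono mult_right_mono len) (auto simp: \<xi>'_def)
  have leL: "(\<Sum>i<m. (norm (\<xi>' i \<omega>))\<^sup>2 * len i) \<le> L" for m \<omega>
  proof (induction m)
    case (Suc m)
    show ?case
    proof (cases "(\<Sum>j\<le>m. (norm (\<xi> j \<omega>))\<^sup>2 * len j) \<le> L")
      case True
      then show ?thesis using le[of \<omega> "Suc m"] by (simp add: lessThan_Suc_atMost)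
    next
      case False
      then show ?thesis using Suc by (simp add: \<xi>'_def)
    qed
  qed (use \<open>0 \<le> L\<close> in simp)
  show thesis
  proof (rule that[of \<xi>', OF si'])
    show "(\<integral>\<^sup>+u\<in>{0..t}. ennreal ((norm (simple_process n \<tau> \<xi>' u \<omega>))\<^sup>2) \<partial>lborel) \<le> ennreal L" for \<omega>
      unfolding sq[OF si'] by (intro ennreal_leI leL)
    fix \<omega> i assume h: "(\<integral>\<^sup>+u\<in>{0..t}. ennreal ((norm (simple_process n \<tau> \<xi> u \<omega>))\<^sup>2) \<partial>lborel) \<le> ennreal L" and i: "i < n"
    have "(\<Sum>j\<le>i. (norm (\<xi> j \<omega>))\<^sup>2 * len j) \<le> (\<Sum>j<n. (norm (\<xi> j \<omega>))\<^sup>2 * len j)"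
      using i len by (intro sum_mono2) auto
    also have "\<dots> \<le> L" using h \<open>0 \<le> L\<close> unfolding sq[OF si] by (simp add: ennreal_le_iff)
    finally show "\<xi>' i \<omega> = \<xi> i \<omega>" by (simp add: \<xi>'_def)
  qed
qed

end

lemma tendsto_0_squeeze:
  fixes a b :: "nat \<Rightarrow> real"
  assumes "\<And>k. 0 \<le> a k" "\<And>k. a k \<le> b k" "b \<longlonglongrightarrow> 0"
  shows "a \<longlonglongrightarrow> 0"
  by (rule tendsto_sandwich[OF _ _ tendsto_const assms(3)]) (use assms in auto)

lemma norm_diff_sq_le:
  "(norm (x - z))\<^sup>2 \<le> 2 * (norm (y - z))\<^sup>2 + 2 * (norm (x - y :: 'a::real_normed_vector))\<^sup>2"
proof -
  have "(norm (x - z))\<^sup>2 \<le> (norm (y - z) + norm (x - y))\<^sup>2"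
    using norm_triangle_ineq[of "x - y" "y - z"] by (intro power_mono) auto
  also have "\<dots> \<le> 2 * (norm (y - z))\<^sup>2 + 2 * (norm (x - y))\<^sup>2"
    using sum_squares_bound[of "norm (y - z)" "norm (x - y)"] by (simp add: power2_sum)
  finally show ?thesis .
qed

lemma ennreal_norm_diff_sq_le:
  "ennreal ((norm (x - z))\<^sup>2) \<le> 2 * ennreal ((norm (y - z))\<^sup>2) + 2 * ennreal ((norm (x - y :: 'a::real_normed_vector))\<^sup>2)"
proof -
  have "ennreal ((norm (x - z))\<^sup>2) \<le> ennreal (2 * (norm (y - z))\<^sup>2 + 2 * (norm (x - y))\<^sup>2)"
    by (rule ennreal_leI[OF norm_diff_sq_le])
  then show ?thesis by (simp add: ennreal_mult' ennreal_plus)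
qed

section \<open>Ito integrals of bounded integrands as mean square limits\<close>

context brownian
begin

lemma progressive_joint:
  assumes "progressive F H" "0 \<le> t"
  shows "(\<lambda>(u, \<omega>). H u \<omega>) \<in> borel_measurable (restrict_space borel {0..t} \<Otimes>\<^sub>M M)"
proof -
  have f: "(\<lambda>(u, \<omega>). H u \<omega>) \<in> borel_measurable (restrict_space borel {0..t} \<Otimes>\<^sub>M F t)"
    using assms by (simp add: progressive_def)
  have "(\<lambda>x. x) \<in> measurable M (F t)" by (rule measurable_F_M[of _ t]) simp
  then have "(\<lambda>p. (fst p, snd p)) \<in> measurable (restrict_space borel {0..t} \<Otimes>\<^sub>M M) (restrict_space borel {0..t} \<Otimes>\<^sub>M F t)"
    by (intro measurable_Pair measurable_compose[OF measurable_snd] measurable_fst)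
  from measurable_compose[OF this f] show ?thesis by (simp add: split_beta')
qed

lemma progressive_adapted:
  assumes "progressive F H" "0 \<le> t"
  shows "H t \<in> borel_measurable (F t)"
proof -
  have f: "(\<lambda>(u, \<omega>). H u \<omega>) \<in> borel_measurable (restrict_space borel {0..t} \<Otimes>\<^sub>M F t)"
    using assms by (simp add: progressive_def)
  from measurable_compose[OF measurable_Pair1' f, of t] assms(2) show ?thesis
    by (simp add: space_restrict_space)
qed

lemma simple_ito_integral_measurable:
  assumes si: "simple_integrand M F n \<tau> \<xi>" and u: "0 \<le> u"
  shows "simple_ito_integral n \<tau> \<xi> B u \<in> borel_measurable M"
proof -
  have "\<xi> i \<in> borel_measurable M" if "i < n" for i
    using si that measurable_F_M[of "\<xi> i" "\<tau> i"] by (simp add: simple_integrand_def)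
  moreover have "0 \<le> \<tau> i" if "i \<le> n" for i
    using simple_integrand_mono[OF si, of 0 i] si that by (simp add: simple_integrand_def)
  ultimately show ?thesis using u
    unfolding simple_ito_integral_def[abs_def]
    by (intro borel_measurable_sum borel_measurable_matrix_vector_mult borel_measurable_diff B_measurable) auto
qed

text \<open>The definition of the integral offers convergence in probability only. Because
  \<open>H\<close> is bounded, the approximations can be switched off at a level \<open>L\<close>
  which is exceeded only with vanishing probability. Their energy distance to \<open>H\<close> is
  then bounded, and its expectation converges as well.\<close>

lemma ito_approximation:
  fixes H :: "real \<Rightarrow> 'w \<Rightarrow> real^'d^'d"
  assumes ito: "is_ito_integral M F B H I" and t: "0 \<le> t"
    and bd: "\<And>u \<omega>. \<omega> \<in> space M \<Longrightarrow> norm (H u \<omega>) \<le> C"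
  obtains n \<tau> \<xi> L where "\<And>k. simple_integrand M F (n k) (\<tau> k) (\<xi> k)"
    "\<And>k \<omega>. (\<integral>\<^sup>+u\<in>{0..t}. ennreal ((norm (simple_process (n k) (\<tau> k) (\<xi> k) u \<omega>))\<^sup>2) \<partial>lborel) \<le> ennreal L"
    "(\<lambda>k. \<integral>\<^sup>+\<omega>. (\<integral>\<^sup>+u\<in>{0..t}. ennreal ((norm (simple_process (n k) (\<tau> k) (\<xi> k) u \<omega> - H u \<omega>))\<^sup>2) \<partial>lborel) \<partial>M) \<longlonglongrightarrow> 0"
    "\<And>u \<epsilon>. 0 \<le> u \<Longrightarrow> u \<le> t \<Longrightarrow> 0 < \<epsilon> \<Longrightarrow>
      (\<lambda>k. prob {\<omega> \<in> space M. \<epsilon> < norm (simple_ito_integral (n k) (\<tau> k) (\<xi> k) B u \<omega> - I u \<omega>)}) \<longlonglongrightarrow> 0"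
proof -
  obtain n \<tau> \<xi> where si: "\<And>k. simple_integrand M F (n k) (\<tau> k) (\<xi> k)" and
    L2: "\<And>t \<epsilon>. 0 \<le> t \<Longrightarrow> 0 < \<epsilon> \<Longrightarrow> (\<lambda>k. measure M {\<omega> \<in> space M. ennreal \<epsilon> <
             (\<integral>\<^sup>+ s\<in>{0..t}. ennreal ((norm (simple_process (n k) (\<tau> k) (\<xi> k) s \<omega> - H s \<omega>))\<^sup>2) \<partial>lborel)})
            \<longlonglongrightarrow> 0" and
    P: "\<And>t \<epsilon>. 0 \<le> t \<Longrightarrow> 0 < \<epsilon> \<Longrightarrow> (\<lambda>k. measure M {\<omega> \<in> space M. \<epsilon> <
             norm (simple_ito_integral (n k) (\<tau> k) (\<xi> k) B t \<omega> - I t \<omega>)}) \<longlonglongrightarrow> 0"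
    and prog: "progressive F H" and Im: "\<And>t. 0 \<le> t \<Longrightarrow> I t \<in> borel_measurable M"
    using ito unfolding is_ito_integral_def by blast
  \<comment> \<open>If the energy distance to \<open>H\<close> on [0, t] is at most 1, the energy of
    the approximation is at most twice that of \<open>H\<close> plus 2, so nothing is switched
    off.\<close>
  define L where "L = 2 * (C\<^sup>2 * t) + 2"
  have L0: "0 \<le> L" using t by (simp add: L_def)
  obtain \<xi>' where si': "\<And>k. simple_integrand M F (n k) (\<tau> k) (\<xi>' k)"
    and \<xi>'L: "\<And>k \<omega>. (\<integral>\<^sup>+u\<in>{0..t}. ennreal ((norm (simple_process (n k) (\<tau> k) (\<xi>' k) u \<omega>))\<^sup>2) \<partial>lborel) \<le> ennreal L"
    and \<xi>'eq: "\<And>k \<omega> i. (\<integral>\<^sup>+u\<in>{0..t}. ennreal ((norm (simple_process (n k) (\<tau> k) (\<xi> k) u \<omega>))\<^sup>2) \<partial>lborel) \<le> ennreal L \<Longrightarrow> i < n k \<Longrightarrow> \<xi>' k i \<omega> = \<xi> k i \<omega>"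
  proof -
    have "\<forall>k. \<exists>z. simple_integrand M F (n k) (\<tau> k) z \<and>
      (\<forall>\<omega>. (\<integral>\<^sup>+u\<in>{0..t}. ennreal ((norm (simple_process (n k) (\<tau> k) z u \<omega>))\<^sup>2) \<partial>lborel) \<le> ennreal L) \<and>
      (\<forall>\<omega> i. (\<integral>\<^sup>+u\<in>{0..t}. ennreal ((norm (simple_process (n k) (\<tau> k) (\<xi> k) u \<omega>))\<^sup>2) \<partial>lborel) \<le> ennreal L \<longrightarrow> i < n k \<longrightarrow> z i \<omega> = \<xi> k i \<omega>)" (is "\<forall>k. ?P k")
    proof
      show "?P k" for k by (rule simple_integrand_kill[OF si[of k] L0, of t]) blast
    qed
    from choice[OF this] obtain z where z: "\<And>k. simple_integrand M F (n k) (\<tau> k) (z k)"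
      "\<And>k \<omega>. (\<integral>\<^sup>+u\<in>{0..t}. ennreal ((norm (simple_process (n k) (\<tau> k) (z k) u \<omega>))\<^sup>2) \<partial>lborel) \<le> ennreal L"
      "\<And>k \<omega> i. (\<integral>\<^sup>+u\<in>{0..t}. ennreal ((norm (simple_process (n k) (\<tau> k) (\<xi> k) u \<omega>))\<^sup>2) \<partial>lborel) \<le> ennreal L \<Longrightarrow> i < n k \<Longrightarrow> z k i \<omega> = \<xi> k i \<omega>"
      by blast
    then show ?thesis by (rule that)
  qed
  have joint: "(\<lambda>(u, \<omega>). ennreal ((norm (simple_process (n k) (\<tau> k) \<zeta> u \<omega> - H u \<omega>))\<^sup>2)) \<in> borel_measurable (restrict_space borel {0..t} \<Otimes>\<^sub>M M)"
    if "simple_integrand M F (n k) (\<tau> k) \<zeta>" for k \<zeta>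
    using simple_process_jointly_measurable[OF that, of t] progressive_joint[OF prog t]
    unfolding split_beta' by measurable
  define D where "D = (\<lambda>k \<omega>. \<integral>\<^sup>+u\<in>{0..t}. ennreal ((norm (simple_process (n k) (\<tau> k) (\<xi> k) u \<omega> - H u \<omega>))\<^sup>2) \<partial>lborel)"
  define D' where "D' = (\<lambda>k \<omega>. \<integral>\<^sup>+u\<in>{0..t}. ennreal ((norm (simple_process (n k) (\<tau> k) (\<xi>' k) u \<omega> - H u \<omega>))\<^sup>2) \<partial>lborel)"
  have [measurable]: "D k \<in> borel_measurable M" "D' k \<in> borel_measurable M" for k
    unfolding D_def D'_def by (intro borel_measurable_set_nn_integral joint si si'; simp)+
  have Hint: "(\<integral>\<^sup>+u\<in>{0..t}. ennreal ((norm (H u \<omega>))\<^sup>2) \<partial>lborel) \<le> ennreal (C\<^sup>2 * t)" if "\<omega> \<in> space M" for \<omega>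
  proof -
    have "(\<integral>\<^sup>+u\<in>{0..t}. ennreal ((norm (H u \<omega>))\<^sup>2) \<partial>lborel) \<le> (\<integral>\<^sup>+u\<in>{0..t}. ennreal (C\<^sup>2) \<partial>lborel)"
      using bd[OF that] by (intro nn_integral_mono) (auto intro!: ennreal_leI power_mono split: split_indicator)
    then show ?thesis using t by (simp add: nn_integral_cmult_indicator ennreal_mult)
  qed
  have two: "(\<integral>\<^sup>+u\<in>{0..t}. ennreal ((norm (x u - z u))\<^sup>2) \<partial>lborel)
     \<le> 2 * (\<integral>\<^sup>+u\<in>{0..t}. ennreal ((norm (y u - z u))\<^sup>2) \<partial>lborel) + 2 * (\<integral>\<^sup>+u\<in>{0..t}. ennreal ((norm (x u - y u))\<^sup>2) \<partial>lborel)"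
    if xyz: "x \<in> borel_measurable (restrict_space borel {0..t})" "y \<in> borel_measurable (restrict_space borel {0..t})"
       "z \<in> borel_measurable (restrict_space borel {0..t})"
    for x y z :: "real \<Rightarrow> real^'d^'d"
  proof -
    have m: "(\<lambda>u. ennreal ((norm (y u - z u))\<^sup>2)) \<in> borel_measurable (restrict_space lborel {0..t})"
       "(\<lambda>u. ennreal ((norm (x u - y u))\<^sup>2)) \<in> borel_measurable (restrict_space lborel {0..t})"
    proof -
      have [measurable]: "x \<in> borel_measurable (restrict_space lborel {0..t})" "y \<in> borel_measurable (restrict_space lborel {0..t})"
        "z \<in> borel_measurable (restrict_space lborel {0..t})"
        using xyz by (simp_all cong: measurable_cong_sets add: sets_restrict_space)
      show "(\<lambda>u. ennreal ((norm (y u - z u))\<^sup>2)) \<in> borel_measurable (restrict_space lborel {0..t})"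
       "(\<lambda>u. ennreal ((norm (x u - y u))\<^sup>2)) \<in> borel_measurable (restrict_space lborel {0..t})"
        by measurable
    qed
    have "(\<integral>\<^sup>+u. ennreal ((norm (x u - z u))\<^sup>2) \<partial>restrict_space lborel {0..t})
      \<le> (\<integral>\<^sup>+u. 2 * ennreal ((norm (y u - z u))\<^sup>2) + 2 * ennreal ((norm (x u - y u))\<^sup>2) \<partial>restrict_space lborel {0..t})"
      by (intro nn_integral_mono ennreal_norm_diff_sq_le)
    also have "\<dots> = 2 * (\<integral>\<^sup>+u. ennreal ((norm (y u - z u))\<^sup>2) \<partial>restrict_space lborel {0..t})
       + 2 * (\<integral>\<^sup>+u. ennreal ((norm (x u - y u))\<^sup>2) \<partial>restrict_space lborel {0..t})"
      using m by (simp add: nn_integral_add nn_integral_cmult)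
    finally show ?thesis by (simp add: nn_integral_restrict_space)
  qed
  have sec: "(\<lambda>u. H u \<omega>) \<in> borel_measurable (restrict_space borel {0..t})"
    "simple_integrand M F (n k) (\<tau> k) \<zeta> \<Longrightarrow> (\<lambda>u. simple_process (n k) (\<tau> k) \<zeta> u \<omega>) \<in> borel_measurable (restrict_space borel {0..t})"
    if "\<omega> \<in> space M" for \<omega> k \<zeta>
    using joint_measurable_section[OF progressive_joint[OF prog t] that]
      joint_measurable_section[OF simple_process_jointly_measurable that] by auto
  have close: "i < n k \<Longrightarrow> \<xi>' k i \<omega> = \<xi> k i \<omega>" if w: "\<omega> \<in> space M" and D: "D k \<omega> \<le> 1" for k i \<omega>
  proof (rule \<xi>'eq)
    have "(\<integral>\<^sup>+u\<in>{0..t}. ennreal ((norm (simple_process (n k) (\<tau> k) (\<xi> k) u \<omega> - 0))\<^sup>2) \<partial>lborel)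
      \<le> 2 * (\<integral>\<^sup>+u\<in>{0..t}. ennreal ((norm (H u \<omega> - 0))\<^sup>2) \<partial>lborel) + 2 * D k \<omega>"
      unfolding D_def by (intro two sec[OF w] si measurable_const) simp
    also have "\<dots> \<le> 2 * ennreal (C\<^sup>2 * t) + 2 * 1"
      using Hint[OF w] D by (intro add_mono mult_left_mono) auto
    also have "\<dots> = ennreal L"
      using t by (simp add: L_def ennreal_plus ennreal_mult')
    finally show "(\<integral>\<^sup>+u\<in>{0..t}. ennreal ((norm (simple_process (n k) (\<tau> k) (\<xi> k) u \<omega>))\<^sup>2) \<partial>lborel) \<le> ennreal L"
      by simp
  qed auto
  have spi: "simple_process (n k) (\<tau> k) (\<xi>' k) u \<omega> = simple_process (n k) (\<tau> k) (\<xi> k) u \<omega>"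
    "simple_ito_integral (n k) (\<tau> k) (\<xi>' k) B u \<omega> = simple_ito_integral (n k) (\<tau> k) (\<xi> k) B u \<omega>"
    if "\<omega> \<in> space M" "D k \<omega> \<le> 1" for k u \<omega>
    using close[OF that] by (auto simp: simple_process_def simple_ito_integral_def)
  define K where "K = 2 * (C\<^sup>2 * t) + 2 * L"
  have K0: "0 \<le> K" using t L0 by (simp add: K_def)
  have D'K: "D' k \<omega> \<le> ennreal K" if w: "\<omega> \<in> space M" for k \<omega>
  proof -
    have "D' k \<omega> \<le> 2 * (\<integral>\<^sup>+u\<in>{0..t}. ennreal ((norm (0 - H u \<omega>))\<^sup>2) \<partial>lborel)
      + 2 * (\<integral>\<^sup>+u\<in>{0..t}. ennreal ((norm (simple_process (n k) (\<tau> k) (\<xi>' k) u \<omega> - 0))\<^sup>2) \<partial>lborel)"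
      unfolding D'_def by (intro two sec[OF w] si' measurable_const) simp
    also have "\<dots> \<le> 2 * ennreal (C\<^sup>2 * t) + 2 * ennreal L"
      using Hint[OF w] \<xi>'L by (intro add_mono mult_left_mono) auto
    also have "\<dots> = ennreal K" using t L0 by (simp add: K_def ennreal_plus ennreal_mult')
    finally show ?thesis .
  qed
  have conv1: "(\<lambda>k. prob {\<omega> \<in> space M. ennreal \<epsilon> < D k \<omega>}) \<longlonglongrightarrow> 0" if "0 < \<epsilon>" for \<epsilon>
    using L2[OF t that] by (simp add: D_def)
  show thesis
  proof (rule that[OF si' \<xi>'L])
    have "(\<lambda>k. \<integral>\<^sup>+\<omega>. D' k \<omega> \<partial>M) \<longlonglongrightarrow> 0"
    proof (rule order_tendstoI)
      fix y :: ennreal assume "0 < y"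
      \<comment> \<open>\<open>e \<le> 1\<close> guarantees that outside the exceptional event the
        energy distance is at most 1, where the switched-off integrand is the original one.\<close>
      obtain e where e: "0 < e" "e \<le> 1" "ennreal e < y"
      proof (cases y)
        case (real r)
        then show ?thesis using \<open>0 < y\<close> by (intro that[of "min 1 (r/2)"]) (auto simp: ennreal_less_iff)
      qed (auto intro: that[of 1])
      have "(\<lambda>k. K * prob {\<omega> \<in> space M. ennreal (e/2) < D k \<omega>}) \<longlonglongrightarrow> K * 0"
        using e by (intro tendsto_mult_left conv1) simp
      then have "eventually (\<lambda>k. K * prob {\<omega> \<in> space M. ennreal (e/2) < D k \<omega>} < e/2) sequentially"
        by (rule order_tendstoD) (use e in simp)
      then show "eventually (\<lambda>k. (\<integral>\<^sup>+\<omega>. D' k \<omega> \<partial>M) < y) sequentially"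
      proof eventually_elim
        case (elim k)
        let ?E = "{\<omega> \<in> space M. ennreal (e/2) < D k \<omega>}"
        have "D' k \<omega> \<le> ennreal (e/2) + ennreal K * indicator ?E \<omega>" if w: "\<omega> \<in> space M" for \<omega>
        proof (cases "ennreal (e/2) < D k \<omega>")
          case True
          then show ?thesis using D'K[OF w, of k] w by (simp add: add_increasing)
        next
          case False
          then have "D k \<omega> \<le> ennreal (e/2)" by simp
          moreover have "ennreal (e/2) \<le> 1" using e by simp
          ultimately have "D k \<omega> \<le> 1" by (rule order_trans)
          from spi(1)[OF w this] have "D' k \<omega> = D k \<omega>" by (simp add: D_def D'_def)
          then show ?thesis using False by simp
        qed
        then have "(\<integral>\<^sup>+\<omega>. D' k \<omega> \<partial>M) \<le> (\<integral>\<^sup>+\<omega>. ennreal (e/2) + ennreal K * indicator ?E \<omega> \<partial>M)"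
          by (intro nn_integral_mono) auto
        also have "\<dots> = ennreal (e/2) + ennreal K * emeasure M ?E"
          by (simp add: nn_integral_add nn_integral_cmult_indicator emeasure_space_1)
        also have "\<dots> = ennreal (e/2 + K * prob ?E)"
          using e K0 by (simp add: emeasure_eq_measure ennreal_mult' ennreal_plus)
        also have "\<dots> \<le> ennreal e" using elim by (intro ennreal_leI) simp
        finally show ?case using e(3) by (rule order_le_less_trans)
      qed
    qed simp
    then show "(\<lambda>k. \<integral>\<^sup>+\<omega>. (\<integral>\<^sup>+u\<in>{0..t}. ennreal ((norm (simple_process (n k) (\<tau> k) (\<xi>' k) u \<omega> - H u \<omega>))\<^sup>2) \<partial>lborel) \<partial>M) \<longlonglongrightarrow> 0"
      by (simp add: D'_def)
  next
    fix u \<epsilon> :: real assume u: "0 \<le> u" "u \<le> t" and e: "0 < \<epsilon>"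
    note simpm = simple_ito_integral_measurable[OF si u(1)]
    let ?S = "\<lambda>k. {\<omega> \<in> space M. \<epsilon> < norm (simple_ito_integral (n k) (\<tau> k) (\<xi> k) B u \<omega> - I u \<omega>)}"
    let ?S' = "\<lambda>k. {\<omega> \<in> space M. \<epsilon> < norm (simple_ito_integral (n k) (\<tau> k) (\<xi>' k) B u \<omega> - I u \<omega>)}"
    let ?E = "\<lambda>k. {\<omega> \<in> space M. ennreal 1 < D k \<omega>}"
    have [measurable]: "?S k \<in> sets M" "?E k \<in> sets M" for k
      using simpm[of k] Im[OF u(1)] by measurable
    have "prob (?S' k) \<le> prob (?S k) + prob (?E k)" for k
    proof -
      have "prob (?S' k) \<le> prob (?S k \<union> ?E k)"
        using spi(2)[of _ k u] by (intro finite_measure_mono) (auto simp: not_less[symmetric] simp del: not_less)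
      also have "\<dots> \<le> prob (?S k) + prob (?E k)" by (intro measure_Un_le) auto
      finally show ?thesis .
    qed
    moreover have "(\<lambda>k. prob (?S k) + prob (?E k)) \<longlonglongrightarrow> 0 + 0"
      by (intro tendsto_add conv1 P u e) simp
    ultimately show "(\<lambda>k. prob (?S' k)) \<longlonglongrightarrow> 0"
      by (intro tendsto_0_squeeze[OF measure_nonneg]) simp_all
  qed
qed

text \<open>For simple integrands this is an isometry. An almost surely convergent subsequence and
  Fatou's lemma carry it to the limit as an inequality. The factor 2 comes from separating
  \<open>H - V\<close> from the approximation error; later only the smallness of the bound
  matters.\<close>

lemma ito_increment_L2:
  fixes H :: "real \<Rightarrow> 'w \<Rightarrow> real^'d^'d"
  assumes ito: "is_ito_integral M F B H I" and st: "0 \<le> s" "s \<le> t"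
    and bd: "\<And>u \<omega>. \<omega> \<in> space M \<Longrightarrow> norm (H u \<omega>) \<le> C"
    and V: "V \<in> borel_measurable (F s)" "\<And>\<omega>. \<omega> \<in> space M \<Longrightarrow> norm (V \<omega>) \<le> C'"
    and A: "A \<in> sets (F s)"
  shows "(\<integral>\<^sup>+\<omega>\<in>A. ennreal ((norm (I t \<omega> - I s \<omega> - V \<omega> *v (B t \<omega> - B s \<omega>)))\<^sup>2) \<partial>M)
    \<le> 2 * (\<integral>\<^sup>+\<omega>\<in>A. (\<integral>\<^sup>+u\<in>{s..t}. ennreal ((norm (H u \<omega> - V \<omega>))\<^sup>2) \<partial>lborel) \<partial>M)"
proof -
  have t: "0 \<le> t" using st by simp
  have prog: "progressive F H" and Im: "\<And>t. 0 \<le> t \<Longrightarrow> I t \<in> borel_measurable M"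
    using ito unfolding is_ito_integral_def by blast+
  have [measurable]: "A \<in> sets M" "V \<in> borel_measurable M" "I t \<in> borel_measurable M" "I s \<in> borel_measurable M"
    "B t \<in> borel_measurable M" "B s \<in> borel_measurable M"
    using A V(1) sets_F_M measurable_F_M Im st t B_measurable by auto
  obtain n \<tau> \<xi> L where si: "\<And>k. simple_integrand M F (n k) (\<tau> k) (\<xi> k)"
    and lim: "(\<lambda>k. \<integral>\<^sup>+\<omega>. (\<integral>\<^sup>+u\<in>{0..t}. ennreal ((norm (simple_process (n k) (\<tau> k) (\<xi> k) u \<omega> - H u \<omega>))\<^sup>2) \<partial>lborel) \<partial>M) \<longlonglongrightarrow> 0"
    and P: "\<And>u \<epsilon>. 0 \<le> u \<Longrightarrow> u \<le> t \<Longrightarrow> 0 < \<epsilon> \<Longrightarrow>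
      (\<lambda>k. prob {\<omega> \<in> space M. \<epsilon> < norm (simple_ito_integral (n k) (\<tau> k) (\<xi> k) B u \<omega> - I u \<omega>)}) \<longlonglongrightarrow> 0"
    by (rule ito_approximation[OF ito t bd]) auto
  define J where "J = (\<lambda>k u. simple_ito_integral (n k) (\<tau> k) (\<xi> k) B u)"
  define S where "S = (\<lambda>k u. simple_process (n k) (\<tau> k) (\<xi> k) u)"
  define Z where "Z = (\<lambda>\<omega>. norm (I t \<omega> - I s \<omega> - V \<omega> *v (B t \<omega> - B s \<omega>)) * indicator A \<omega>)"
  define Zk where "Zk = (\<lambda>k \<omega>. norm (J k t \<omega> - J k s \<omega> - V \<omega> *v (B t \<omega> - B s \<omega>)) * indicator A \<omega>)"
  have Jm[measurable]: "J k t \<in> borel_measurable M" "J k s \<in> borel_measurable M" for k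
    unfolding J_def using simple_ito_integral_measurable[OF si] st t by auto
  have [measurable]: "Z \<in> borel_measurable M" "Zk k \<in> borel_measurable M" for k
    unfolding Z_def Zk_def by measurable
  have diff: "\<bar>Zk k \<omega> - Z \<omega>\<bar> \<le> norm (J k t \<omega> - I t \<omega>) + norm (J k s \<omega> - I s \<omega>)" for k \<omega>
  proof -
    let ?a = "J k t \<omega> - J k s \<omega> - V \<omega> *v (B t \<omega> - B s \<omega>)" and ?b = "I t \<omega> - I s \<omega> - V \<omega> *v (B t \<omega> - B s \<omega>)"
    have "\<bar>norm ?a - norm ?b\<bar> \<le> norm (?a - ?b)" by (rule norm_triangle_ineq3)
    also have "?a - ?b = (J k t \<omega> - I t \<omega>) - (J k s \<omega> - I s \<omega>)" by simp
    also have "norm \<dots> \<le> norm (J k t \<omega> - I t \<omega>) + norm (J k s \<omega> - I s \<omega>)" by (rule norm_triangle_ineq4)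
    finally show ?thesis by (auto simp: Z_def Zk_def split: split_indicator)
  qed
  have "(\<lambda>k. prob {\<omega> \<in> space M. \<epsilon> < \<bar>Zk k \<omega> - Z \<omega>\<bar>}) \<longlonglongrightarrow> 0" if e: "0 < \<epsilon>" for \<epsilon>
  proof -
    let ?E = "\<lambda>k u. {\<omega> \<in> space M. \<epsilon>/2 < norm (J k u \<omega> - I u \<omega>)}"
    have "prob {\<omega> \<in> space M. \<epsilon> < \<bar>Zk k \<omega> - Z \<omega>\<bar>} \<le> prob (?E k t) + prob (?E k s)" for k
    proof -
      have "\<epsilon>/2 < norm (J k t \<omega> - I t \<omega>) \<or> \<epsilon>/2 < norm (J k s \<omega> - I s \<omega>)" if "\<epsilon> < \<bar>Zk k \<omega> - Z \<omega>\<bar>" for \<omega>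
        using that diff[of k \<omega>] by linarith
      then have "prob {\<omega> \<in> space M. \<epsilon> < \<bar>Zk k \<omega> - Z \<omega>\<bar>} \<le> prob (?E k t \<union> ?E k s)"
        by (intro finite_measure_mono) auto
      also have "\<dots> \<le> prob (?E k t) + prob (?E k s)" by (intro measure_Un_le) auto
      finally show ?thesis .
    qed
    moreover have "(\<lambda>k. prob (?E k t) + prob (?E k s)) \<longlonglongrightarrow> 0 + 0"
      unfolding J_def using e st by (intro tendsto_add P) auto
    ultimately show ?thesis
      by (intro tendsto_0_squeeze[OF measure_nonneg]) simp_all
  qed
  then obtain r where r: "strict_mono r" "AE \<omega> in M. (\<lambda>k. Zk (r k) \<omega> - Z \<omega>) \<longlonglongrightarrow> 0"
    by (rule AE_convergent_subsequence[of "\<lambda>k \<omega>. Zk k \<omega> - Z \<omega>", rotated]) auto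
  have joint: "(\<lambda>(u, \<omega>). H u \<omega>) \<in> borel_measurable (restrict_space borel {s..t} \<Otimes>\<^sub>M M)"
    "(\<lambda>(u, \<omega>). S k u \<omega>) \<in> borel_measurable (restrict_space borel {s..t} \<Otimes>\<^sub>M M)" for k
    using st by (auto simp: S_def intro!: joint_measurable_subset[of _ "{0..t}" _ _ "{s..t}"] progressive_joint[OF prog t] simple_process_jointly_measurable si)
  let ?b = "\<integral>\<^sup>+\<omega>\<in>A. (\<integral>\<^sup>+u\<in>{s..t}. ennreal ((norm (H u \<omega> - V \<omega>))\<^sup>2) \<partial>lborel) \<partial>M"
  let ?e = "\<lambda>k. \<integral>\<^sup>+\<omega>. (\<integral>\<^sup>+u\<in>{0..t}. ennreal ((norm (S k u \<omega> - H u \<omega>))\<^sup>2) \<partial>lborel) \<partial>M"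
  have bound: "(\<integral>\<^sup>+\<omega>. ennreal ((Zk k \<omega>)\<^sup>2) \<partial>M) \<le> 2 * ?b + 2 * ?e k" for k
  proof -
    let ?f = "\<lambda>u \<omega>. ennreal ((norm (H u \<omega> - V \<omega>))\<^sup>2) * indicator A \<omega>"
    let ?g = "\<lambda>u \<omega>. ennreal ((norm (S k u \<omega> - H u \<omega>))\<^sup>2) * indicator A \<omega>"
    have "(\<integral>\<^sup>+\<omega>. ennreal ((Zk k \<omega>)\<^sup>2) \<partial>M)
      = (\<integral>\<^sup>+\<omega>\<in>A. ennreal ((norm (J k t \<omega> - J k s \<omega> - V \<omega> *v (B t \<omega> - B s \<omega>)))\<^sup>2) \<partial>M)"
      by (intro nn_integral_cong) (auto simp: Zk_def split: split_indicator)
    also have "\<dots> = (\<integral>\<^sup>+\<omega>\<in>A. (\<integral>\<^sup>+u\<in>{s..t}. ennreal ((norm (S k u \<omega> - V \<omega>))\<^sup>2) \<partial>lborel) \<partial>M)"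
      unfolding J_def S_def by (rule simple_increment_isometry[OF si st V A])
    also have "\<dots> \<le> (\<integral>\<^sup>+\<omega>. (\<integral>\<^sup>+u\<in>{s..t}. (2 * ?f u \<omega> + 2 * ?g u \<omega>) \<partial>lborel) \<partial>M)"
    proof (rule nn_integral_mono)
      fix \<omega>
      show "(\<integral>\<^sup>+u\<in>{s..t}. ennreal ((norm (S k u \<omega> - V \<omega>))\<^sup>2) \<partial>lborel) * indicator A \<omega>
        \<le> (\<integral>\<^sup>+u\<in>{s..t}. (2 * ?f u \<omega> + 2 * ?g u \<omega>) \<partial>lborel)"
        by (auto split: split_indicator intro!: nn_integral_mono ennreal_norm_diff_sq_le)
    qed
    also have "\<dots> = 2 * (\<integral>\<^sup>+\<omega>. (\<integral>\<^sup>+u\<in>{s..t}. ?f u \<omega> \<partial>lborel) \<partial>M) + 2 * (\<integral>\<^sup>+\<omega>. (\<integral>\<^sup>+u\<in>{s..t}. ?g u \<omega> \<partial>lborel) \<partial>M)"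
      using joint(1) joint(2)[of k] by (intro iterated_nn_integral_linear) (auto simp: split_beta')
    also have "(\<integral>\<^sup>+\<omega>. (\<integral>\<^sup>+u\<in>{s..t}. ?f u \<omega> \<partial>lborel) \<partial>M) = ?b"
      by (intro nn_integral_cong) (auto split: split_indicator)
    also have "2 * ?b + 2 * (\<integral>\<^sup>+\<omega>. (\<integral>\<^sup>+u\<in>{s..t}. ?g u \<omega> \<partial>lborel) \<partial>M) \<le> 2 * ?b + 2 * ?e k"
      using st by (intro add_left_mono mult_left_mono nn_integral_mono) (auto split: split_indicator)
    finally show ?thesis .
  qed
  have lim': "(\<lambda>k. 2 * ?b + 2 * ?e (r k)) \<longlonglongrightarrow> 2 * ?b + 2 * 0"
    using LIMSEQ_subseq_LIMSEQ[OF lim r(1)] unfolding S_def o_def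
    by (intro tendsto_add tendsto_const ennreal_tendsto_cmult) auto
  have "(\<integral>\<^sup>+\<omega>\<in>A. ennreal ((norm (I t \<omega> - I s \<omega> - V \<omega> *v (B t \<omega> - B s \<omega>)))\<^sup>2) \<partial>M)
    = (\<integral>\<^sup>+\<omega>. ennreal ((Z \<omega>)\<^sup>2) \<partial>M)"
    by (intro nn_integral_cong) (auto simp: Z_def split: split_indicator)
  also have "\<dots> = (\<integral>\<^sup>+\<omega>. liminf (\<lambda>k. ennreal ((Zk (r k) \<omega>)\<^sup>2)) \<partial>M)"
  proof (rule nn_integral_cong_AE)
    show "AE \<omega> in M. ennreal ((Z \<omega>)\<^sup>2) = liminf (\<lambda>k. ennreal ((Zk (r k) \<omega>)\<^sup>2))"
      using r(2)
    proof eventually_elim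
      case (elim \<omega>)
      then have "(\<lambda>k. Zk (r k) \<omega>) \<longlonglongrightarrow> Z \<omega>" by (simp add: LIM_zero_iff)
      then have "(\<lambda>k. ennreal ((Zk (r k) \<omega>)\<^sup>2)) \<longlonglongrightarrow> ennreal ((Z \<omega>)\<^sup>2)"
        by (intro tendsto_ennrealI tendsto_power)
      from lim_imp_Liminf[OF _ this] show ?case by simp
    qed
  qed
  also have "\<dots> \<le> liminf (\<lambda>k. \<integral>\<^sup>+\<omega>. ennreal ((Zk (r k) \<omega>)\<^sup>2) \<partial>M)"
    by (rule nn_integral_liminf) auto
  also have "\<dots> \<le> liminf (\<lambda>k. 2 * ?b + 2 * ?e (r k))"
    by (intro Liminf_mono always_eventually allI bound)
  also have "\<dots> = 2 * ?b" using lim_imp_Liminf[OF _ lim'] by simp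
  finally show ?thesis .
qed

text \<open>The elementary integrals have mean zero and converge in probability. Their second
  moments and that of the limit have a common bound \<open>K\<close>, which makes them uniformly
  integrable, so the means converge.\<close>

lemma ito_increment_mean:
  fixes H :: "real \<Rightarrow> 'w \<Rightarrow> real^'d^'d" and w :: "'w \<Rightarrow> real^'d"
  assumes ito: "is_ito_integral M F B H I" and st: "0 \<le> s" "s \<le> t"
    and bd: "\<And>u \<omega>. \<omega> \<in> space M \<Longrightarrow> norm (H u \<omega>) \<le> C"
    and w: "w \<in> borel_measurable (F s)" "\<And>\<omega>. \<omega> \<in> space M \<Longrightarrow> norm (w \<omega>) \<le> W"
  shows "has_bochner_integral M (\<lambda>\<omega>. w \<omega> \<bullet> (I t \<omega> - I s \<omega>)) 0"
proof -
  have t: "0 \<le> t" using st by simp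
  have Im: "\<And>t. 0 \<le> t \<Longrightarrow> I t \<in> borel_measurable M"
    using ito unfolding is_ito_integral_def by blast
  have [measurable]: "w \<in> borel_measurable M" "I t \<in> borel_measurable M" "I s \<in> borel_measurable M"
    using w(1) measurable_F_M Im st t by auto
  obtain n \<tau> \<xi> L where si: "\<And>k. simple_integrand M F (n k) (\<tau> k) (\<xi> k)"
    and L: "\<And>k \<omega>. (\<integral>\<^sup>+u\<in>{0..t}. ennreal ((norm (simple_process (n k) (\<tau> k) (\<xi> k) u \<omega>))\<^sup>2) \<partial>lborel) \<le> ennreal L"
    and P: "\<And>u \<epsilon>. 0 \<le> u \<Longrightarrow> u \<le> t \<Longrightarrow> 0 < \<epsilon> \<Longrightarrow>
      (\<lambda>k. prob {\<omega> \<in> space M. \<epsilon> < norm (simple_ito_integral (n k) (\<tau> k) (\<xi> k) B u \<omega> - I u \<omega>)}) \<longlonglongrightarrow> 0"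
    by (rule ito_approximation[OF ito t bd]) auto
  define J where "J = (\<lambda>k u. simple_ito_integral (n k) (\<tau> k) (\<xi> k) B u)"
  define X where "X = (\<lambda>\<omega>. I t \<omega> - I s \<omega>)"
  define Xk where "Xk = (\<lambda>k \<omega>. J k t \<omega> - J k s \<omega>)"
  have [measurable]: "J k t \<in> borel_measurable M" "J k s \<in> borel_measurable M" for k
    unfolding J_def using simple_ito_integral_measurable[OF si] st t by auto
  have [measurable]: "X \<in> borel_measurable M" "Xk k \<in> borel_measurable M" for k
    unfolding X_def Xk_def by measurable
  obtain K where K: "0 < K" "(\<integral>\<^sup>+\<omega>. ennreal ((norm (X \<omega>))\<^sup>2) \<partial>M) \<le> ennreal K"
    "\<And>k. (\<integral>\<^sup>+\<omega>. ennreal ((norm (Xk k \<omega>))\<^sup>2) \<partial>M) \<le> ennreal K"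
  proof
    define K where "K = 2 * (C\<^sup>2 * t) + \<bar>L\<bar> + 1"
    have "0 \<le> C\<^sup>2 * t" using t by simp
    then show "0 < K" unfolding K_def by linarith
    have "(\<integral>\<^sup>+\<omega>. ennreal ((norm (X \<omega>))\<^sup>2) \<partial>M)
      = (\<integral>\<^sup>+\<omega>\<in>space M. ennreal ((norm (I t \<omega> - I s \<omega> - 0 *v (B t \<omega> - B s \<omega>)))\<^sup>2) \<partial>M)"
      by (intro nn_integral_cong) (simp add: X_def)
    also have "\<dots> \<le> 2 * (\<integral>\<^sup>+\<omega>\<in>space M. (\<integral>\<^sup>+u\<in>{s..t}. ennreal ((norm (H u \<omega> - 0))\<^sup>2) \<partial>lborel) \<partial>M)"
      by (rule ito_increment_L2[OF ito st bd, of "\<lambda>_. 0" 0]) (auto simp: space_F[of s, symmetric])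
    also have "\<dots> \<le> 2 * (\<integral>\<^sup>+\<omega>. ennreal (C\<^sup>2 * t) \<partial>M)"
    proof (intro mult_left_mono nn_integral_mono)
      fix \<omega> assume w: "\<omega> \<in> space M"
      have "(\<integral>\<^sup>+u\<in>{s..t}. ennreal ((norm (H u \<omega> - 0))\<^sup>2) \<partial>lborel) \<le> (\<integral>\<^sup>+u\<in>{0..t}. ennreal (C\<^sup>2) \<partial>lborel)"
        using bd[OF w] st by (intro nn_integral_mono) (auto intro!: ennreal_leI power_mono split: split_indicator)
      then show "(\<integral>\<^sup>+u\<in>{s..t}. ennreal ((norm (H u \<omega> - 0))\<^sup>2) \<partial>lborel) * indicator (space M) \<omega> \<le> ennreal (C\<^sup>2 * t)"
        using t w by (simp add: nn_integral_cmult_indicator ennreal_mult)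
    qed simp
    also have "\<dots> = ennreal (2 * (C\<^sup>2 * t))" using t by (simp add: emeasure_space_1 ennreal_mult')
    also have "\<dots> \<le> ennreal K" by (intro ennreal_leI) (simp add: K_def)
    finally show "(\<integral>\<^sup>+\<omega>. ennreal ((norm (X \<omega>))\<^sup>2) \<partial>M) \<le> ennreal K" .
    fix k
    have "(\<integral>\<^sup>+\<omega>. ennreal ((norm (Xk k \<omega>))\<^sup>2) \<partial>M)
      = (\<integral>\<^sup>+\<omega>\<in>space M. ennreal ((norm (J k t \<omega> - J k s \<omega> - 0 *v (B t \<omega> - B s \<omega>)))\<^sup>2) \<partial>M)"
      by (intro nn_integral_cong) (simp add: Xk_def)
    also have "\<dots> = (\<integral>\<^sup>+\<omega>\<in>space M. (\<integral>\<^sup>+u\<in>{s..t}. ennreal ((norm (simple_process (n k) (\<tau> k) (\<xi> k) u \<omega> - 0))\<^sup>2) \<partial>lborel) \<partial>M)"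
      unfolding J_def by (rule simple_increment_isometry[OF si st, of "\<lambda>_. 0" 0]) (auto simp: space_F[of s, symmetric])
    also have "\<dots> \<le> (\<integral>\<^sup>+\<omega>. ennreal L \<partial>M)"
    proof (intro nn_integral_mono)
      fix \<omega> assume w: "\<omega> \<in> space M"
      have "(\<integral>\<^sup>+u\<in>{s..t}. ennreal ((norm (simple_process (n k) (\<tau> k) (\<xi> k) u \<omega> - 0))\<^sup>2) \<partial>lborel)
        \<le> (\<integral>\<^sup>+u\<in>{0..t}. ennreal ((norm (simple_process (n k) (\<tau> k) (\<xi> k) u \<omega>))\<^sup>2) \<partial>lborel)"
        using st by (intro nn_integral_mono) (auto split: split_indicator)
      also have "\<dots> \<le> ennreal L" by (rule L)
      finally show "(\<integral>\<^sup>+u\<in>{s..t}. ennreal ((norm (simple_process (n k) (\<tau> k) (\<xi> k) u \<omega> - 0))\<^sup>2) \<partial>lborel) * indicator (space M) \<omega> \<le> ennreal L"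
        using w by simp
    qed
    also have "\<dots> \<le> ennreal K"
      using \<open>0 \<le> C\<^sup>2 * t\<close> ennreal_leI[of L K] by (simp add: emeasure_space_1 K_def)
    finally show "(\<integral>\<^sup>+\<omega>. ennreal ((norm (Xk k \<omega>))\<^sup>2) \<partial>M) \<le> ennreal K" .
  qed
  have sqint: "integrable M (\<lambda>\<omega>. (norm (Y \<omega>))\<^sup>2)" "expectation (\<lambda>\<omega>. (norm (Y \<omega>))\<^sup>2) \<le> K" "integrable M Y"
    if [measurable]: "Y \<in> borel_measurable M" and le: "(\<integral>\<^sup>+\<omega>. ennreal ((norm (Y \<omega>))\<^sup>2) \<partial>M) \<le> ennreal K"
    for Y :: "'w \<Rightarrow> real^'d"
  proof -
    show i: "integrable M (\<lambda>\<omega>. (norm (Y \<omega>))\<^sup>2)"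
      using le by (intro integrableI_bounded) (auto intro: le_less_trans)
    show "expectation (\<lambda>\<omega>. (norm (Y \<omega>))\<^sup>2) \<le> K"
      using le K(1) by (subst (asm) nn_integral_eq_integral[OF i]) auto
    have "norm (Y \<omega>) \<le> 1 + (norm (Y \<omega>))\<^sup>2" for \<omega>
      using zero_le_power2[of "norm (Y \<omega>) - 1/2"] by (simp add: power2_diff power_divide)
    then show "integrable M Y"
      using i by (intro Bochner_Integration.integrable_bound[of _ "\<lambda>\<omega>. 1 + (norm (Y \<omega>))\<^sup>2" Y])
        (auto intro!: AE_I2 order_trans[OF _ abs_ge_self])
  qed
  have Xm: "X \<in> borel_measurable M" "\<And>k. Xk k \<in> borel_measurable M" by measurable
  note X = sqint[OF Xm(1) K(2)] and Xk = sqint[OF Xm(2) K(3)]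
  have wX: "integrable M (\<lambda>\<omega>. w \<omega> \<bullet> Y \<omega>)" if "integrable M Y" for Y
  proof (rule Bochner_Integration.integrable_bound)
    show "integrable M (\<lambda>\<omega>. W * norm (Y \<omega>))" using that by simp
    show "(\<lambda>\<omega>. w \<omega> \<bullet> Y \<omega>) \<in> borel_measurable M" using that by measurable
    show "AE \<omega> in M. norm (w \<omega> \<bullet> Y \<omega>) \<le> norm (W * norm (Y \<omega>))"
    proof (rule AE_I2)
      fix \<omega> assume "\<omega> \<in> space M"
      have "\<bar>w \<omega> \<bullet> Y \<omega>\<bar> \<le> norm (w \<omega>) * norm (Y \<omega>)" by (rule Cauchy_Schwarz_ineq2)
      also have "\<dots> \<le> W * norm (Y \<omega>)" using w(2)[OF \<open>\<omega> \<in> space M\<close>] by (intro mult_right_mono) auto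
      finally show "norm (w \<omega> \<bullet> Y \<omega>) \<le> norm (W * norm (Y \<omega>))" by auto
    qed
  qed
  have "\<bar>expectation (\<lambda>\<omega>. w \<omega> \<bullet> X \<omega>)\<bar> \<le> 0 + \<epsilon>" if e: "0 < \<epsilon>" for \<epsilon>
  proof -
    define W' where "W' = \<bar>W\<bar> + 1"
    have W': "0 < W'" "\<And>\<omega>. \<omega> \<in> space M \<Longrightarrow> norm (w \<omega>) \<le> W'" using w(2) by (force simp: W'_def)+
    \<comment> \<open>The choices make \<open>W' * \<delta>\<close> and
      \<open>W' * \<theta> * 4 * K\<close> equal to \<epsilon>/4 each. The probability of
      \<open>S\<close> divided by \<theta> is made small by the choice of \<open>k\<close>
      afterwards.\<close>
    define \<delta> where "\<delta> = \<epsilon> / (4 * W')"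
    define \<theta> where "\<theta> = \<epsilon> / (16 * W' * K)"
    have d: "0 < \<delta>" "0 < \<theta>" using e W' K(1) by (auto simp: \<delta>_def \<theta>_def)
    let ?E = "\<lambda>k u. {\<omega> \<in> space M. \<delta>/2 < norm (J k u \<omega> - I u \<omega>)}"
    have "(\<lambda>k. (prob (?E k t) + prob (?E k s)) * (W' / \<theta>)) \<longlonglongrightarrow> (0 + 0) * (W' / \<theta>)"
      unfolding J_def using d st by (intro tendsto_mult tendsto_const tendsto_add P) auto
    then have "eventually (\<lambda>k. (prob (?E k t) + prob (?E k s)) * (W' / \<theta>) < \<epsilon> / 4) sequentially"
      by (rule order_tendstoD) (use e in simp)
    then obtain k where k: "(prob (?E k t) + prob (?E k s)) * (W' / \<theta>) < \<epsilon> / 4"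
      by (auto simp: eventually_sequentially)
    define S where "S = ?E k t \<union> ?E k s"
    have [measurable]: "S \<in> sets M" unfolding S_def by measurable
    have S: "prob S \<le> prob (?E k t) + prob (?E k s)" unfolding S_def by (intro measure_Un_le) auto
    have iS: "integrable M (indicat_real S)" by (rule integrable_const_bound[of _ 1]) auto
    let ?D = "\<lambda>\<omega>. norm (X \<omega> - Xk k \<omega>)"
    have pw: "\<bar>w \<omega> \<bullet> X \<omega> - w \<omega> \<bullet> Xk k \<omega>\<bar> \<le> W' * (\<delta> + \<theta> * (2 * (norm (X \<omega>))\<^sup>2 + 2 * (norm (Xk k \<omega>))\<^sup>2) + indicator S \<omega> / \<theta>)"
      if "\<omega> \<in> space M" for \<omega>
    proof -
      have sq: "(?D \<omega>)\<^sup>2 \<le> 2 * (norm (X \<omega>))\<^sup>2 + 2 * (norm (Xk k \<omega>))\<^sup>2"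
        using norm_diff_sq_le[of "X \<omega>" "Xk k \<omega>" 0] norm_diff_sq_le[of "X \<omega>" "Xk k \<omega>" "0"]
          norm_diff_sq_le[where x="X \<omega>" and y=0 and z="Xk k \<omega>"] by simp
      \<comment> \<open>Quantitative uniform integrability: off \<open>S\<close> the difference is
        at most \<delta>, and on \<open>S\<close> Young's inequality trades it for a small multiple
        of its square.\<close>
      have "?D \<omega> \<le> \<delta> + \<theta> * (?D \<omega>)\<^sup>2 + indicator S \<omega> / \<theta>"
      proof (cases "\<omega> \<in> S")
        case True
        have "0 \<le> (\<theta> * ?D \<omega> - 1/2)\<^sup>2" by simp
        then have "\<theta> * ?D \<omega> \<le> \<theta> * (\<theta> * (?D \<omega>)\<^sup>2 + 1 / \<theta>)"
          using d by (simp add: power2_diff power_mult_distrib algebra_simps power2_eq_square)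
        then have "?D \<omega> \<le> \<theta> * (?D \<omega>)\<^sup>2 + 1 / \<theta>" using d by (simp only: mult_le_cancel_left_pos)
        then show ?thesis using True d by simp
      next
        case False
        have "?D \<omega> = norm ((J k s \<omega> - I s \<omega>) - (J k t \<omega> - I t \<omega>))" by (simp add: X_def Xk_def algebra_simps)
        also have "\<dots> \<le> norm (J k s \<omega> - I s \<omega>) + norm (J k t \<omega> - I t \<omega>)" by (rule norm_triangle_ineq4)
        also have "\<dots> \<le> \<delta>" using False that by (auto simp: S_def not_less)
        finally show ?thesis using d by (simp add: False add_increasing2)
      qed
      also have "\<dots> \<le> \<delta> + \<theta> * (2 * (norm (X \<omega>))\<^sup>2 + 2 * (norm (Xk k \<omega>))\<^sup>2) + indicator S \<omega> / \<theta>"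
        using sq d by (intro add_mono mult_left_mono) auto
      finally have *: "?D \<omega> \<le> \<delta> + \<theta> * (2 * (norm (X \<omega>))\<^sup>2 + 2 * (norm (Xk k \<omega>))\<^sup>2) + indicator S \<omega> / \<theta>" .
      have "\<bar>w \<omega> \<bullet> X \<omega> - w \<omega> \<bullet> Xk k \<omega>\<bar> \<le> norm (w \<omega>) * ?D \<omega>"
        unfolding inner_diff_right[symmetric] by (rule Cauchy_Schwarz_ineq2)
      also have "\<dots> \<le> W' * (\<delta> + \<theta> * (2 * (norm (X \<omega>))\<^sup>2 + 2 * (norm (Xk k \<omega>))\<^sup>2) + indicator S \<omega> / \<theta>)"
        by (intro mult_mono W' that *) (use W' in auto)
      finally show ?thesis .
    qed
    have mk: "has_bochner_integral M (\<lambda>\<omega>. w \<omega> \<bullet> Xk k \<omega>) 0"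
      unfolding Xk_def J_def by (rule simple_increment_mean[OF si st w])
    have iX: "integrable M X" "integrable M (Xk k)" "integrable M (\<lambda>\<omega>. (norm (X \<omega>))\<^sup>2)" "integrable M (\<lambda>\<omega>. (norm (Xk k \<omega>))\<^sup>2)"
      by (fact X Xk)+
    have "\<bar>expectation (\<lambda>\<omega>. w \<omega> \<bullet> X \<omega>)\<bar> = \<bar>expectation (\<lambda>\<omega>. w \<omega> \<bullet> X \<omega> - w \<omega> \<bullet> Xk k \<omega>)\<bar>"
      using wX[OF iX(1)] wX[OF iX(2)] mk by (simp add: has_bochner_integral_iff)
    also have "\<dots> \<le> expectation (\<lambda>\<omega>. \<bar>w \<omega> \<bullet> X \<omega> - w \<omega> \<bullet> Xk k \<omega>\<bar>)"
      by (rule integral_abs_bound)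
    also have "\<dots> \<le> expectation (\<lambda>\<omega>. W' * (\<delta> + \<theta> * (2 * (norm (X \<omega>))\<^sup>2 + 2 * (norm (Xk k \<omega>))\<^sup>2) + indicator S \<omega> / \<theta>))"
      using wX[OF iX(1)] wX[OF iX(2)] iX iS by (intro integral_mono) (auto intro: pw)
    also have "\<dots> = W' * (\<delta> + \<theta> * (2 * expectation (\<lambda>\<omega>. (norm (X \<omega>))\<^sup>2) + 2 * expectation (\<lambda>\<omega>. (norm (Xk k \<omega>))\<^sup>2)) + prob S / \<theta>)"
      using iX iS by (simp add: prob_space)
    also have "\<dots> \<le> W' * (\<delta> + \<theta> * (2 * K + 2 * K) + prob S / \<theta>)"
      using W' d X(2) Xk(2)[of k] by (intro mult_left_mono add_mono) auto
    also have "\<dots> = \<epsilon> / 4 + \<epsilon> / 4 + prob S * (W' / \<theta>)"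
      using W' K(1) by (simp add: \<delta>_def \<theta>_def field_simps)
    also have "\<dots> \<le> \<epsilon> / 4 + \<epsilon> / 4 + (prob (?E k t) + prob (?E k s)) * (W' / \<theta>)"
      using S W' d by (intro add_left_mono mult_right_mono) auto
    also have "\<dots> \<le> \<epsilon>" using k e by linarith
    finally show ?thesis by simp
  qed
  then have "\<bar>expectation (\<lambda>\<omega>. w \<omega> \<bullet> X \<omega>)\<bar> \<le> 0" by (rule field_le_epsilon)
  moreover have "integrable M X" by (rule X(3))
  ultimately show ?thesis using wX[of X] by (simp add: has_bochner_integral_iff X_def)
qed

end

section \<open>A one-step expansion of the radial process\<close>

text \<open>Here \<open>\<rho>\<close> and \<open>r'\<close> are the distances before and after a step. The reflected noise multiplies the
  difference vector by \<open>1 + a\<close>; the remaining increment has norm \<open>N\<close> and component \<open>p\<close> along that vector.\<close>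

lemma radial_step_upper:
  fixes \<delta> R \<rho> a p N r' :: real
  assumes \<delta>: "0 < \<delta>" "\<delta> \<le> \<rho>" "\<rho> \<le> R" and r': "0 \<le> r'" and pN: "\<bar>p\<bar> \<le> N"
    and eq: "r'\<^sup>2 = ((1 + a) * \<rho>)\<^sup>2 + 2 * ((1 + a) * \<rho>) * p + N\<^sup>2"
  shows "r' \<le> \<rho> + (\<rho> * a + p) + (16 * R + 16 + 1 / \<delta>) * (a ^ 4 + N\<^sup>2)"
proof -
  define q where "q = (16 * R + 16 + 1 / \<delta>) * (a ^ 4 + N\<^sup>2)"
  have a4: "0 \<le> a ^ 4" by simp
  have R: "0 < R" using \<delta> by linarith
  have qa: "(16 * R + 16) * a ^ 4 \<le> q" and qN: "16 * N\<^sup>2 \<le> q" and q\<delta>: "N\<^sup>2 / \<delta> \<le> q"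
  proof -
    have "q = (16 * R + 16) * a ^ 4 + a ^ 4 / \<delta> + 16 * N\<^sup>2 + 16 * R * N\<^sup>2 + N\<^sup>2 / \<delta>"
      unfolding q_def by (simp add: algebra_simps)
    moreover have "0 \<le> (16 * R + 16) * a ^ 4" "0 \<le> a ^ 4 / \<delta>" "0 \<le> 16 * N\<^sup>2" "0 \<le> 16 * R * N\<^sup>2" "0 \<le> N\<^sup>2 / \<delta>"
      using R \<delta> by auto
    ultimately show "(16 * R + 16) * a ^ 4 \<le> q" "16 * N\<^sup>2 \<le> q" "N\<^sup>2 / \<delta> \<le> q" by linarith+
  qed
  have p2: "p\<^sup>2 \<le> N\<^sup>2" using pN by (metis abs_le_square_iff abs_ge_zero abs_of_nonneg order_trans)
  show ?thesis
  proof (cases "\<bar>a\<bar> \<le> 1/2")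
    case True
    \<comment> \<open>For small \<open>a\<close> the stretched length \<open>y\<close> stays above
      \<delta>/2, and the tangent bound for the square root shows that \<open>r'\<close> exceeds
      \<open>y + p\<close> by at most N^2/(2y), which \<open>q\<close> dominates.\<close>
    define y where "y = (1 + a) * \<rho>"
    have y: "\<delta> / 2 \<le> y"
    proof -
      have "1/2 * \<delta> \<le> (1 + a) * \<rho>" using True \<delta> by (intro mult_mono) auto
      then show ?thesis by (simp add: y_def)
    qed
    then have y0: "0 < y" using \<delta> by linarith
    have Ny: "N\<^sup>2 / (2 * y) \<le> q"
    proof -
      have "N\<^sup>2 / (2 * y) \<le> N\<^sup>2 / \<delta>" using y \<delta> by (intro divide_left_mono) auto
      then show ?thesis using q\<delta> by linarith
    qed
    then have N2: "N\<^sup>2 \<le> 2 * y * q" using y0 by (simp add: field_simps)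
    \<comment> \<open>Squares may be compared only once \<open>y + p + q\<close> is known to be
      nonnegative; this follows from p^2 \<le> N^2 \<le> 2yq.\<close>
    have "0 \<le> (y + p)\<^sup>2 + y\<^sup>2" by simp
    then have "- (2 * y * (y + p)) \<le> p\<^sup>2" by (simp add: power2_eq_square algebra_simps)
    then have "0 \<le> 2 * y * (y + p + q)" using N2 p2 by (simp add: algebra_simps)
    then have s: "0 \<le> y + p + q" using y0 by (simp add: zero_le_mult_iff)
    have "r'\<^sup>2 = y\<^sup>2 + 2 * y * p + N\<^sup>2" using eq by (simp add: y_def)
    also have "\<dots> \<le> y\<^sup>2 + 2 * y * p + 2 * y * q + (p + q)\<^sup>2" using N2 zero_le_power2[of "p + q"] by linarith
    also have "\<dots> = (y + p + q)\<^sup>2" by (simp add: power2_eq_square algebra_simps)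
    finally have "r' \<le> y + p + q" using s power2_le_imp_le by blast
    then show ?thesis unfolding q_def[symmetric] by (simp add: y_def algebra_simps)
  next
    \<comment> \<open>Now |a| exceeds 1/2, so |a| \<le> 8 a^4 and 1 \<le> 16 a^4, and the plain
      triangle inequality is affordable. This is the origin of the constants 16 R and 16.\<close>
    case False
    have "r'\<^sup>2 \<le> (\<bar>(1 + a) * \<rho>\<bar> + N)\<^sup>2"
    proof -
      define w where "w = (1 + a) * \<rho>"
      have "w * p \<le> \<bar>w\<bar> * \<bar>p\<bar>" using abs_ge_self[of "w * p"] by (simp only: abs_mult)
      also have "\<dots> \<le> \<bar>w\<bar> * N" using pN by (intro mult_left_mono) auto
      finally have "w * p \<le> \<bar>w\<bar> * N" .
      moreover have "(\<bar>w\<bar> + N)\<^sup>2 = w\<^sup>2 + 2 * (\<bar>w\<bar> * N) + N\<^sup>2" by (simp add: power2_sum)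
      moreover have "r'\<^sup>2 = w\<^sup>2 + 2 * (w * p) + N\<^sup>2" using eq by (simp add: w_def)
      ultimately show ?thesis unfolding w_def[symmetric] by linarith
    qed
    then have "r' \<le> \<bar>(1 + a) * \<rho>\<bar> + N" using pN by (intro power2_le_imp_le[of r']) auto
    also have "\<bar>(1 + a) * \<rho>\<bar> \<le> \<rho> + \<rho> * \<bar>a\<bar>"
      using \<delta> abs_triangle_ineq[of \<rho> "\<rho> * a"] by (simp add: abs_mult algebra_simps)
    finally have "r' \<le> \<rho> + \<rho> * \<bar>a\<bar> + N" by simp
    moreover have "2 * (\<rho> * \<bar>a\<bar>) \<le> 16 * R * a ^ 4"
    proof -
      have "1/8 \<le> \<bar>a\<bar> ^ 3" using False power_mono[of "1/2" "\<bar>a\<bar>" 3] by (simp add: power3_eq_cube)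
      then have "\<bar>a\<bar> * (1/8) \<le> \<bar>a\<bar> * \<bar>a\<bar> ^ 3" by (intro mult_left_mono) auto
      moreover have "\<bar>a\<bar> * \<bar>a\<bar> ^ 3 = \<bar>a\<bar> ^ 4" by (simp add: numeral_eq_Suc)
      moreover have "\<bar>a\<bar> ^ 4 = a ^ 4" by (simp add: power_even_abs)
      ultimately have "\<bar>a\<bar> \<le> 8 * a ^ 4" by linarith
      then have "\<rho> * \<bar>a\<bar> \<le> R * (8 * a ^ 4)" using \<delta> by (intro mult_mono) auto
      then show ?thesis by simp
    qed
    moreover have "2 * N \<le> 16 * a ^ 4 + N\<^sup>2"
    proof -
      have "(1/2) ^ 4 \<le> \<bar>a\<bar> ^ 4" using False by (intro power_mono) auto
      then have "1 \<le> 16 * a ^ 4" by (simp add: power4_eq_xxxx)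
      moreover have "0 \<le> (N - 1)\<^sup>2" by simp
      ultimately show ?thesis by (simp add: power2_diff)
    qed
    moreover have "16 * R * a ^ 4 + 16 * a ^ 4 + N\<^sup>2 \<le> q"
    proof -
      have "16 * R * a ^ 4 + 16 * a ^ 4 + N\<^sup>2 \<le> (16 * R + 16 + 1 / \<delta>) * a ^ 4 + (16 * R + 16 + 1 / \<delta>) * N\<^sup>2"
      proof -
        have "(16 * R + 16) * a ^ 4 \<le> (16 * R + 16 + 1 / \<delta>) * a ^ 4" using \<delta> by (intro mult_right_mono) auto
        moreover have "1 * N\<^sup>2 \<le> (16 * R + 16 + 1 / \<delta>) * N\<^sup>2" using \<delta> R by (intro mult_right_mono) auto
        ultimately show ?thesis by (simp add: algebra_simps)
      qed
      then show ?thesis by (simp add: q_def algebra_simps)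
    qed
    moreover have "- (\<rho> * \<bar>a\<bar>) \<le> \<rho> * a"
    proof -
      have "\<rho> * - \<bar>a\<bar> \<le> \<rho> * a" using \<delta> by (intro mult_left_mono) auto
      then show ?thesis by simp
    qed
    moreover have "- N \<le> p" using pN by linarith
    ultimately show ?thesis unfolding q_def[symmetric] by linarith
  qed
qed

text \<open>The coefficient of a^2 may be any \<theta> > 0 at the price of a large \<open>K\<close>,
  while a^4 and N^2 will be negligible when summed. The Taylor bound is available only for
  increments up to \<open>v0\<close>; a larger increment \<open>v\<close> is handled by concavity,
  since then v^2 is itself at most a multiple of a^4 + N^2.\<close>

lemma radial_step:
  fixes f fp h :: "real \<Rightarrow> real"
  assumes \<delta>: "0 < \<delta>" "\<delta> \<le> R" and v0: "0 < v0" "v0 \<le> \<delta>" and H0: "0 \<le> H0" and \<theta>: "0 < \<theta>"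
    and mono: "\<And>x y. 0 \<le> x \<Longrightarrow> x \<le> y \<Longrightarrow> f x \<le> f y"
    and lip: "\<And>y q. 0 \<le> y \<Longrightarrow> 0 \<le> q \<Longrightarrow> f (y + q) \<le> f y + q"
    and conc: "\<And>x y. \<delta> \<le> x \<Longrightarrow> x \<le> R \<Longrightarrow> 0 \<le> y \<Longrightarrow> f y \<le> f x + fp x * (y - x)"
    and fp: "\<And>x. \<delta> \<le> x \<Longrightarrow> x \<le> R \<Longrightarrow> 0 \<le> fp x \<and> fp x \<le> 1"
    and h: "\<And>x. \<delta> \<le> x \<Longrightarrow> x \<le> R \<Longrightarrow> \<bar>h x\<bar> \<le> H0"
    and taylor: "\<And>x v. \<delta> \<le> x \<Longrightarrow> x \<le> R \<Longrightarrow> \<bar>v\<bar> \<le> v0 \<Longrightarrow> f (x + v) \<le> f x + fp x * v + h x / 2 * v\<^sup>2"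
  obtains K where "0 \<le> K"
    "\<And>\<rho> a p N r'. \<delta> \<le> \<rho> \<Longrightarrow> \<rho> \<le> R \<Longrightarrow> 0 \<le> r' \<Longrightarrow> \<bar>p\<bar> \<le> N \<Longrightarrow>
       r'\<^sup>2 = ((1 + a) * \<rho>)\<^sup>2 + 2 * ((1 + a) * \<rho>) * p + N\<^sup>2 \<Longrightarrow>
       f r' \<le> f \<rho> + fp \<rho> * (\<rho> * a + p) + h \<rho> / 2 * (\<rho> * a)\<^sup>2 + \<theta> * a\<^sup>2 + K * (a ^ 4 + N\<^sup>2)"
proof -
  define C1 where "C1 = 16 * R + 16 + 1 / \<delta>"
  \<comment> \<open>\<open>C2\<close> bounds v^2 when |v| > v0: either |p| dominates and v^2 \<le> 4
    N^2, or v0 \<le> 2 |\<rho> a| and v^2 \<le> 16 (\<rho> a)^4 / v0^2. \<open>C3\<close> contains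
    the Young constant for the mixed term in \<open>a\<close> and \<open>N\<close>.\<close>
  define C2 where "C2 = 4 + 16 * R ^ 4 / v0\<^sup>2"
  define C3 where "C3 = H0 / 2 + (H0 * R)\<^sup>2 / (4 * \<theta>)"
  have C: "0 \<le> C1" "0 \<le> C2" "0 \<le> C3" using \<delta> H0 \<theta> by (auto simp: C1_def C2_def C3_def)
  show thesis
  proof (rule that[of "C1 + H0 / 2 * C2 + C3"])
    show "0 \<le> C1 + H0 / 2 * C2 + C3" using C H0 by auto
    fix \<rho> a p N r' :: real
    assume \<rho>: "\<delta> \<le> \<rho>" "\<rho> \<le> R" and r': "0 \<le> r'" and pN: "\<bar>p\<bar> \<le> N"
      and eq: "r'\<^sup>2 = ((1 + a) * \<rho>)\<^sup>2 + 2 * ((1 + a) * \<rho>) * p + N\<^sup>2"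
    define v where "v = \<rho> * a + p"
    define q where "q = C1 * (a ^ 4 + N\<^sup>2)"
    define m where "m = a ^ 4 + N\<^sup>2"
    have m: "0 \<le> m" "a ^ 4 \<le> m" "N\<^sup>2 \<le> m" by (auto simp: m_def)
    have \<rho>0: "0 < \<rho>" using \<rho> \<delta> by linarith
    have q: "0 \<le> q" using C m by (simp add: q_def m_def)
    have up: "r' \<le> \<rho> + v + q"
      using radial_step_upper[OF \<delta>(1) \<rho> r' pN eq] by (simp add: v_def q_def C1_def)
    have p2: "p\<^sup>2 \<le> N\<^sup>2" using pN by (metis abs_le_square_iff abs_ge_zero abs_of_nonneg order_trans)
    have hb: "\<bar>h \<rho>\<bar> \<le> H0" using h \<rho> by blast
    have fpb: "0 \<le> fp \<rho>" "fp \<rho> \<le> 1" using fp[OF \<rho>] by auto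
    have A: "f r' \<le> f \<rho> + fp \<rho> * v + h \<rho> / 2 * v\<^sup>2 + q + H0 / 2 * (C2 * m)"
    proof (cases "\<bar>v\<bar> \<le> v0")
      case True
      have 0: "0 \<le> \<rho> + v" using True v0 \<rho> by linarith
      have "f r' \<le> f (\<rho> + v + q)" by (rule mono[OF r' up])
      also have "\<dots> \<le> f (\<rho> + v) + q" by (rule lip[OF 0 q])
      also have "\<dots> \<le> f \<rho> + fp \<rho> * v + h \<rho> / 2 * v\<^sup>2 + q" using taylor[OF \<rho> True] by simp
      finally show ?thesis using H0 C m by (simp add: add_increasing2)
    next
      case False
      have "f r' \<le> f \<rho> + fp \<rho> * (r' - \<rho>)" by (rule conc[OF \<rho> r'])
      also have "\<dots> \<le> f \<rho> + fp \<rho> * (v + q)" using up fpb by (intro add_left_mono mult_left_mono) auto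
      also have "\<dots> \<le> f \<rho> + fp \<rho> * v + q"
        using mult_right_mono[OF fpb(2) q] by (simp add: algebra_simps)
      finally have 1: "f r' \<le> f \<rho> + fp \<rho> * v + q" .
      have "v\<^sup>2 \<le> C2 * m"
      proof (cases "\<bar>\<rho> * a\<bar> \<le> \<bar>p\<bar>")
        case True
        have "\<bar>v\<bar> \<le> 2 * \<bar>p\<bar>" using True unfolding v_def by linarith
        then have "v\<^sup>2 \<le> (2 * \<bar>p\<bar>)\<^sup>2" by (metis abs_ge_zero power2_abs power_mono)
        also have "\<dots> \<le> 4 * m" using p2 m by simp
        also have "\<dots> \<le> C2 * m" using m by (intro mult_right_mono) (auto simp: C2_def)
        finally show ?thesis .
      next
        case F: False
        then have 2: "\<bar>v\<bar> \<le> 2 * \<bar>\<rho> * a\<bar>" unfolding v_def by linarith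
        then have "v0 \<le> 2 * \<bar>\<rho> * a\<bar>" using False by linarith
        then have v02: "v0\<^sup>2 \<le> (2 * \<bar>\<rho> * a\<bar>)\<^sup>2" using v0 by (intro power_mono) auto
        have "v\<^sup>2 \<le> (2 * \<bar>\<rho> * a\<bar>)\<^sup>2" using 2 by (metis abs_ge_zero power2_abs power_mono)
        also have "\<dots> * v0\<^sup>2 \<le> (2 * \<bar>\<rho> * a\<bar>)\<^sup>2 * (2 * \<bar>\<rho> * a\<bar>)\<^sup>2"
          using v02 by (intro mult_left_mono) auto
        also have "\<dots> = 16 * \<rho> ^ 4 * a ^ 4" by (simp add: power_mult_distrib power2_eq_square power4_eq_xxxx)
        also have "\<dots> \<le> 16 * R ^ 4 * m" using \<rho> \<rho>0 m by (intro mult_mono power_mono) auto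
        finally have "v\<^sup>2 * v0\<^sup>2 \<le> 16 * R ^ 4 * m" using v0 by simp
        then have "v\<^sup>2 \<le> 16 * R ^ 4 / v0\<^sup>2 * m" using v0 by (simp add: field_simps)
        also have "\<dots> \<le> C2 * m" using m by (intro mult_right_mono) (auto simp: C2_def)
        finally show ?thesis .
      qed
      then have "H0 / 2 * v\<^sup>2 \<le> H0 / 2 * (C2 * m)" using H0 by (intro mult_left_mono) auto
      moreover have "- (H0 / 2 * v\<^sup>2) \<le> h \<rho> / 2 * v\<^sup>2"
        using hb mult_right_mono[of "- H0 / 2" "h \<rho> / 2" "v\<^sup>2"] by auto
      ultimately show ?thesis using 1 by linarith
    qed
    have B: "h \<rho> / 2 * v\<^sup>2 \<le> h \<rho> / 2 * (\<rho> * a)\<^sup>2 + \<theta> * a\<^sup>2 + C3 * m"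
    proof -
      have "h \<rho> / 2 * v\<^sup>2 - h \<rho> / 2 * (\<rho> * a)\<^sup>2 = h \<rho> / 2 * (2 * (\<rho> * a) * p + p\<^sup>2)"
        by (simp add: v_def power2_eq_square algebra_simps)
      also have "\<dots> \<le> H0 / 2 * (2 * (R * \<bar>a\<bar>) * N + N\<^sup>2)"
      proof -
        have "\<bar>2 * (\<rho> * a) * p + p\<^sup>2\<bar> \<le> 2 * (R * \<bar>a\<bar>) * N + N\<^sup>2"
        proof -
          have "\<bar>2 * (\<rho> * a) * p\<bar> \<le> 2 * (R * \<bar>a\<bar>) * N"
            unfolding abs_mult using \<rho> \<rho>0 pN by (intro mult_mono) auto
          then show ?thesis using p2 abs_triangle_ineq[of "2 * (\<rho> * a) * p" "p\<^sup>2"] by simp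
        qed
        then have "\<bar>h \<rho> / 2\<bar> * \<bar>2 * (\<rho> * a) * p + p\<^sup>2\<bar> \<le> H0 / 2 * (2 * (R * \<bar>a\<bar>) * N + N\<^sup>2)"
          using hb H0 by (intro mult_mono) auto
        then show ?thesis
          unfolding abs_mult[symmetric] by (rule order_trans[OF abs_ge_self])
      qed
      also have "\<dots> = (H0 * R) * \<bar>a\<bar> * N + H0 / 2 * N\<^sup>2" by (simp add: algebra_simps)
      also have "(H0 * R) * \<bar>a\<bar> * N \<le> \<theta> * a\<^sup>2 + (H0 * R)\<^sup>2 / (4 * \<theta>) * N\<^sup>2"
      proof -
        have "0 \<le> (2 * \<theta> * \<bar>a\<bar> - H0 * R * N)\<^sup>2" by simp
        then have "4 * \<theta> * ((H0 * R) * \<bar>a\<bar> * N) \<le> 4 * \<theta> * (\<theta> * a\<^sup>2) + (H0 * R)\<^sup>2 * N\<^sup>2"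
          by (simp add: power2_diff power_mult_distrib power2_eq_square[of \<theta>] algebra_simps)
        then have "4 * \<theta> * ((H0 * R) * \<bar>a\<bar> * N) \<le> 4 * \<theta> * (\<theta> * a\<^sup>2 + (H0 * R)\<^sup>2 / (4 * \<theta>) * N\<^sup>2)"
          using \<theta> by (simp add: algebra_simps)
        then show ?thesis using \<theta> by (rule_tac mult_left_le_imp_le[of "4 * \<theta>"]) auto
      qed
      finally have "h \<rho> / 2 * v\<^sup>2 \<le> h \<rho> / 2 * (\<rho> * a)\<^sup>2 + \<theta> * a\<^sup>2 + C3 * N\<^sup>2"
        by (simp add: C3_def algebra_simps)
      moreover have "C3 * N\<^sup>2 \<le> C3 * m" using C m by (intro mult_left_mono)
      ultimately show ?thesis by linarith
    qed
    show "f r' \<le> f \<rho> + fp \<rho> * (\<rho> * a + p) + h \<rho> / 2 * (\<rho> * a)\<^sup>2 + \<theta> * a\<^sup>2 + (C1 + H0 / 2 * C2 + C3) * (a ^ 4 + N\<^sup>2)"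
      using A B unfolding v_def[symmetric] m_def[symmetric] q_def m_def[symmetric]
      by (simp add: algebra_simps)
  qed
qed

section \<open>The norm induced by G and the reflection matrix\<close>

lemma continuous_on_matrix_vector_mult[continuous_intros]:
  fixes A :: "'a::topological_space \<Rightarrow> real^'n^'m"
  assumes "continuous_on S A" "continuous_on S x"
  shows "continuous_on S (\<lambda>u. A u *v x u)"
  unfolding matrix_vector_mult_def using assms by (intro continuous_intros)

locale spd_matrix =
  fixes G :: "real^'d^'d"
  assumes sym: "transpose G = G" and pos: "\<And>z. z \<noteq> 0 \<Longrightarrow> z \<bullet> (G *v z) > 0"
begin

lemma inner_G_commute: "x \<bullet> (G *v y) = y \<bullet> (G *v x)"
  by (metis dot_lmul_matrix inner_commute sym vector_transpose_matrix)

lemma inner_G_nonneg: "0 \<le> z \<bullet> (G *v z)"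
  using pos[of z] by (cases "z = 0") auto

lemma Gnorm_nonneg: "0 \<le> Gnorm G z"
  by (simp add: Gnorm_def inner_G_nonneg)

lemma Gnorm_sq: "(Gnorm G z)\<^sup>2 = z \<bullet> (G *v z)"
  by (simp add: Gnorm_def inner_G_nonneg)

lemma Gnorm_zero_iff: "Gnorm G z = 0 \<longleftrightarrow> z = 0"
  using pos[of z] by (cases "z = 0") (auto simp: Gnorm_def)

lemma Gnorm_0[simp]: "Gnorm G 0 = 0"
  by (simp add: Gnorm_def)

lemma Gnorm_pos: "z \<noteq> 0 \<Longrightarrow> 0 < Gnorm G z"
  using pos[of z] by (simp add: Gnorm_def)

lemma Gnorm_scaleR: "Gnorm G (r *\<^sub>R z) = \<bar>r\<bar> * Gnorm G z"
  by (simp add: Gnorm_def scaleR_matrix_vector_assoc[symmetric] matrix_vector_mult_scaleR real_sqrt_mult mult.assoc[symmetric])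

lemma continuous_on_Gnorm[continuous_intros]:
  "continuous_on S z \<Longrightarrow> continuous_on S (\<lambda>u. Gnorm G (z u))"
  unfolding Gnorm_def by (intro continuous_intros)

lemma borel_measurable_Gnorm[measurable]: "Gnorm G \<in> borel_measurable borel"
  by (intro borel_measurable_continuous_onI continuous_on_Gnorm continuous_on_id)

lemma Gnorm_bounds:
  obtains l u where "0 < l" "0 < u" "\<And>z. l * norm z \<le> Gnorm G z" "\<And>z. Gnorm G z \<le> u * norm z"
proof -
  obtain j :: 'd where True by auto
  have ne: "sphere (0::real^'d) 1 \<noteq> {}"
    by (auto intro!: exI[of _ "axis j 1"])
  have c: "continuous_on (sphere 0 1) (\<lambda>z. Gnorm G z)" by (intro continuous_intros)
  obtain z1 where z1: "norm z1 = 1" "\<And>z. norm z = 1 \<Longrightarrow> Gnorm G z1 \<le> Gnorm G z"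
    using continuous_attains_inf[OF compact_sphere ne c] by (auto simp: dist_norm)
  obtain z2 where z2: "norm z2 = 1" "\<And>z. norm z = 1 \<Longrightarrow> Gnorm G z \<le> Gnorm G z2"
    using continuous_attains_sup[OF compact_sphere ne c] by (auto simp: dist_norm)
  have eq: "Gnorm G z = norm z * Gnorm G (z /\<^sub>R norm z)" for z
    by (cases "z = 0") (auto simp: Gnorm_scaleR Gnorm_zero_iff)
  show thesis
  proof (rule that[of "Gnorm G z1" "Gnorm G z2"])
    show "0 < Gnorm G z1" "0 < Gnorm G z2" using z1(1) z2(1) by (auto intro!: Gnorm_pos)
    fix z :: "real^'d"
    have *: "Gnorm G z1 \<le> Gnorm G (z /\<^sub>R norm z) \<and> Gnorm G (z /\<^sub>R norm z) \<le> Gnorm G z2" if "z \<noteq> 0"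
      using that by (auto intro: z1 z2)
    show "Gnorm G z1 * norm z \<le> Gnorm G z"
    proof (cases "z = 0")
      case False
      then have "norm z * Gnorm G z1 \<le> norm z * Gnorm G (z /\<^sub>R norm z)" using * by (intro mult_left_mono) auto
      then show ?thesis using eq[of z] by (simp add: mult.commute)
    qed simp
    show "Gnorm G z \<le> Gnorm G z2 * norm z"
    proof (cases "z = 0")
      case False
      then have "norm z * Gnorm G (z /\<^sub>R norm z) \<le> norm z * Gnorm G z2" using * by (intro mult_left_mono) auto
      then show ?thesis using eq[of z] by (simp add: mult.commute)
    qed simp
  qed
qed

lemma inner_G_Cauchy_Schwarz: "\<bar>x \<bullet> (G *v y)\<bar> \<le> Gnorm G x * Gnorm G y"
proof (cases "y = 0")
  case False
  define r where "r = (x \<bullet> (G *v y)) / (Gnorm G y)\<^sup>2"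
  have y: "0 < (Gnorm G y)\<^sup>2" using Gnorm_pos[OF False] by simp
  have "0 \<le> (x - r *\<^sub>R y) \<bullet> (G *v (x - r *\<^sub>R y))" by (rule inner_G_nonneg)
  also have "\<dots> = (Gnorm G x)\<^sup>2 - 2 * r * (x \<bullet> (G *v y)) + r\<^sup>2 * (Gnorm G y)\<^sup>2"
    unfolding Gnorm_sq
    by (simp add: matrix_vector_mult_diff_distrib inner_diff_left inner_diff_right matrix_vector_mult_scaleR
        inner_G_commute[of y x] power2_eq_square algebra_simps)
  also have "\<dots> = (Gnorm G x)\<^sup>2 - (x \<bullet> (G *v y))\<^sup>2 / (Gnorm G y)\<^sup>2"
    using y by (simp add: r_def power_divide power2_eq_square field_simps)
  finally have "(x \<bullet> (G *v y))\<^sup>2 \<le> (Gnorm G x * Gnorm G y)\<^sup>2"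
    using y by (simp add: field_simps power_mult_distrib)
  then have "\<bar>x \<bullet> (G *v y)\<bar> \<le> \<bar>Gnorm G x * Gnorm G y\<bar>" by (simp add: abs_le_square_iff)
  then show ?thesis by (simp add: Gnorm_nonneg)
qed (simp add: Gnorm_nonneg)

text \<open>The form that \<open>radial_step\<close> asks for: \<open>z\<close> is stretched along
  itself by 1 + a, while an arbitrary \<open>e\<close> is seen only through its norm and its
  component along \<open>z\<close>.\<close>

lemma Gnorm_radial_expansion:
  assumes "z \<noteq> 0"
  shows "(Gnorm G ((1 + a) *\<^sub>R z + e))\<^sup>2 = ((1 + a) * Gnorm G z)\<^sup>2
      + 2 * ((1 + a) * Gnorm G z) * (z \<bullet> (G *v e) / Gnorm G z) + (Gnorm G e)\<^sup>2"
proof -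
  have "(Gnorm G ((1 + a) *\<^sub>R z + e))\<^sup>2 = (1 + a)\<^sup>2 * (Gnorm G z)\<^sup>2 + 2 * (1 + a) * (z \<bullet> (G *v e)) + (Gnorm G e)\<^sup>2"
    unfolding Gnorm_sq
    by (simp add: matrix_vector_right_distrib inner_add_left inner_add_right matrix_vector_mult_scaleR
        inner_G_commute[of e z] power2_eq_square algebra_simps)
  then show ?thesis using Gnorm_pos[OF assms] by (simp add: power_mult_distrib)
qed

lemma radial_coefficient_bound: "\<bar>z \<bullet> (G *v e) / Gnorm G z\<bar> \<le> Gnorm G e"
proof (cases "z = 0")
  case False
  then have p: "0 < Gnorm G z" by (rule Gnorm_pos)
  have "\<bar>z \<bullet> (G *v e) / Gnorm G z\<bar> = \<bar>z \<bullet> (G *v e)\<bar> / Gnorm G z" using p by (simp add: abs_divide)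
  also have "\<dots> \<le> Gnorm G e"
    using inner_G_Cauchy_Schwarz[of z e] by (simp add: pos_divide_le_eq[OF p] mult.commute)
  finally show ?thesis .
qed (simp add: Gnorm_nonneg)

end

locale diffusion_matrices = spd_matrix G for G :: "real^'d^'d" +
  fixes \<sigma> :: "real^'d^'d"
  assumes det_pos: "det \<sigma> > 0"
begin

lemma sigma_inv: "\<sigma> *v (matrix_inv \<sigma> *v z) = z"
proof -
  have "invertible \<sigma>" using det_pos by (simp add: invertible_det_nz)
  then have "\<sigma> ** matrix_inv \<sigma> = mat 1"
    unfolding invertible_def matrix_inv_def by (rule someI2_ex) simp
  then show ?thesis by (simp add: matrix_vector_mul_assoc)
qed

lemma sigma_inv_nonzero: "z \<noteq> 0 \<Longrightarrow> matrix_inv \<sigma> *v z \<noteq> 0"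
proof
  assume z: "z \<noteq> 0" and 0: "matrix_inv \<sigma> *v z = 0"
  have "z = \<sigma> *v (matrix_inv \<sigma> *v z)" by (rule sigma_inv[symmetric])
  also have "\<dots> = 0" unfolding 0 by (rule matrix_vector_mult_0_right)
  finally show False using z by contradiction
qed

text \<open>Keeps the noise factor 2/|\<sigma>^{-1} z| bounded as long as the two processes are
  apart; it follows from z = \<sigma> \<sigma>^{-1} z.\<close>

lemma sigma_inv_lower:
  obtains l where "0 < l" "\<And>z. l * Gnorm G z \<le> norm (matrix_inv \<sigma> *v z)"
proof -
  obtain l0 u where u: "0 < l0" "0 < u" "\<And>z. l0 * norm z \<le> Gnorm G z" "\<And>z. Gnorm G z \<le> u * norm z"
    by (rule Gnorm_bounds) (rule that)
  define l where "l = 1 / (u * (norm \<sigma> + 1))"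
  have n: "0 < u * (norm \<sigma> + 1)" using u by (simp add: add_nonneg_pos)
  show thesis
  proof (rule that[of l])
    show "0 < l" using n by (simp add: l_def)
    fix z
    have "Gnorm G z \<le> u * norm (\<sigma> *v (matrix_inv \<sigma> *v z))" using u(4)[of z] by (simp add: sigma_inv)
    also have "\<dots> \<le> u * ((norm \<sigma> + 1) * norm (matrix_inv \<sigma> *v z))"
      using u(2) norm_matrix_vector_mult_le[of \<sigma> "matrix_inv \<sigma> *v z"]
      by (intro mult_left_mono) (auto simp: algebra_simps intro: order_trans)
    finally show "l * Gnorm G z \<le> norm (matrix_inv \<sigma> *v z)" using n by (simp add: l_def field_simps)
  qed
qed

text \<open>By homogeneity it suffices to treat \<open>Gnorm G z = 1\<close>. The set that defines
  \<open>alpha\<close> must be shown to be bounded before its \<open>Sup\<close> can serve as an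
  upper bound.\<close>

lemma alpha_bound: "(norm (matrix_inv \<sigma> *v z))\<^sup>2 \<le> alpha \<sigma> G * (Gnorm G z)\<^sup>2"
  and alpha_pos: "0 < alpha \<sigma> G"
proof -
  obtain l u0 where l: "0 < l" "0 < u0" "\<And>z. l * norm z \<le> Gnorm G z" "\<And>z. Gnorm G z \<le> u0 * norm z"
    by (rule Gnorm_bounds) (rule that)
  let ?S = "{(norm (matrix_inv \<sigma> *v z))\<^sup>2 | z. Gnorm G z = 1}"
  have bdd: "bdd_above ?S"
  proof (rule bdd_aboveI)
    fix x assume "x \<in> ?S"
    then obtain z where z: "x = (norm (matrix_inv \<sigma> *v z))\<^sup>2" "Gnorm G z = 1" by auto
    have "norm z \<le> 1 / l" using l(3)[of z] l(1) z(2) by (simp add: field_simps)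
    have "norm (matrix_inv \<sigma> *v z) \<le> norm (matrix_inv \<sigma>) * norm z" by (rule norm_matrix_vector_mult_le)
    also have "\<dots> \<le> norm (matrix_inv \<sigma>) * (1 / l)" using \<open>norm z \<le> 1 / l\<close> by (intro mult_left_mono) auto
    finally show "x \<le> (norm (matrix_inv \<sigma>) * (1 / l))\<^sup>2" unfolding z(1) by (intro power_mono) auto
  qed
  have up: "(norm (matrix_inv \<sigma> *v z))\<^sup>2 \<le> alpha \<sigma> G * (Gnorm G z)\<^sup>2" for z
  proof (cases "z = 0")
    case False
    let ?e = "(1 / Gnorm G z) *\<^sub>R z"
    have p: "0 < Gnorm G z" using False by (rule Gnorm_pos)
    have "Gnorm G ?e = 1" using p by (simp add: Gnorm_scaleR)
    then have "(norm (matrix_inv \<sigma> *v ?e))\<^sup>2 \<le> alpha \<sigma> G"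
      unfolding alpha_def using bdd by (intro cSup_upper) blast+
    then show ?thesis using p by (simp add: matrix_vector_mult_scaleR power_divide field_simps power_mult_distrib)
  qed simp
  then show "(norm (matrix_inv \<sigma> *v z))\<^sup>2 \<le> alpha \<sigma> G * (Gnorm G z)\<^sup>2" .
  obtain j :: 'd where True by auto
  have ne: "(axis j 1 :: real^'d) \<noteq> 0" by (simp add: axis_eq_0_iff)
  have "0 < (norm (matrix_inv \<sigma> *v (axis j 1)))\<^sup>2"
    using sigma_inv_nonzero[OF ne] by simp
  moreover have "alpha \<sigma> G * (Gnorm G (axis j 1))\<^sup>2 \<le> 0" if "alpha \<sigma> G \<le> 0"
    using that by (intro mult_nonpos_nonneg) auto
  ultimately show "0 < alpha \<sigma> G" using up[of "axis j 1"] by linarith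
qed

lemma reflection_mat_mult: "reflection_mat e *v x = x - (2 * (e \<bullet> x)) *\<^sub>R e"
proof -
  have "(\<chi> i j. 2 * (e $ i * e $ j)) *v x = (2 * (e \<bullet> x)) *\<^sub>R e"
    by (simp add: vec_eq_iff matrix_vector_mult_def inner_vec_def sum_distrib_left sum_distrib_right mult_ac)
  then show ?thesis by (simp add: reflection_mat_def matrix_vector_mult_diff_rdistrib)
qed

text \<open>Applying \<sigma> undoes the inverse inside the reflection direction, so the difference
  of the two noises is a multiple of \<open>z\<close> itself. The squared norm of its coefficient
  vector, 4/|\<sigma>^{-1} z|^2, is the variance rate of the relative radial noise.\<close>

lemma reflection_noise:
  assumes "z \<noteq> 0"
  shows "\<sigma> *v x - (\<sigma> ** reflection_mat (reflection_dir \<sigma> z)) *v x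
    = (((2 / (norm (matrix_inv \<sigma> *v z))\<^sup>2) *\<^sub>R (matrix_inv \<sigma> *v z)) \<bullet> x) *\<^sub>R z"
proof -
  let ?y = "matrix_inv \<sigma> *v z"
  have "\<sigma> *v x - (\<sigma> ** reflection_mat (reflection_dir \<sigma> z)) *v x = \<sigma> *v (x - reflection_mat (reflection_dir \<sigma> z) *v x)"
    by (simp add: matrix_vector_mul_assoc[symmetric] matrix_vector_mult_diff_distrib)
  also have "\<dots> = (2 * (reflection_dir \<sigma> z \<bullet> x)) *\<^sub>R (\<sigma> *v reflection_dir \<sigma> z)"
    by (simp add: reflection_mat_mult matrix_vector_mult_scaleR)
  also have "\<sigma> *v reflection_dir \<sigma> z = (1 / norm ?y) *\<^sub>R z"
    by (simp add: reflection_dir_def matrix_vector_mult_scaleR sigma_inv)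
  finally show ?thesis by (simp add: reflection_dir_def power2_eq_square)
qed

lemma norm_reflection_dir_le: "norm (reflection_dir \<sigma> z) \<le> 1"
  by (simp add: reflection_dir_def)

lemma continuous_on_reflection_mat[continuous_intros]:
  assumes "continuous_on S e"
  shows "continuous_on S (\<lambda>u. \<sigma> ** reflection_mat (e u))"
proof -
  have "(\<lambda>u. \<sigma> ** reflection_mat (e u))
    = (\<lambda>u. \<chi> i j. \<Sum>k\<in>UNIV. \<sigma> $ i $ k * (mat 1 $ k $ j - 2 * (e u $ k * e u $ j)))"
    by (simp add: fun_eq_iff vec_eq_iff matrix_matrix_mult_def reflection_mat_def)
  then show ?thesis using assms by (simp only:) (intro continuous_intros)
qed

text \<open>The direction lies in the compact unit ball for every \<open>z\<close>; at
  \<open>z = 0\<close> division by zero makes it 0.\<close>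

lemma reflection_bounded:
  obtains C where "0 < C" "\<And>z. norm (\<sigma> ** reflection_mat (reflection_dir \<sigma> z)) \<le> C"
proof -
  have "compact ((\<lambda>e. \<sigma> ** reflection_mat e) ` cball 0 1)"
    by (intro compact_continuous_image continuous_intros compact_cball)
  then obtain C where C: "0 < C" "\<forall>x\<in>(\<lambda>e. \<sigma> ** reflection_mat e) ` cball 0 1. norm x \<le> C"
    using compact_imp_bounded bounded_pos by blast
  show thesis
  proof (rule that[OF C(1)])
    show "norm (\<sigma> ** reflection_mat (reflection_dir \<sigma> z)) \<le> C" for z
      using norm_reflection_dir_le[of z] by (intro C(2)[rule_format] imageI) simp
  qed
qed

lemma continuous_on_reflection_dir[continuous_intros]:
  assumes "continuous_on S z" "\<And>u. u \<in> S \<Longrightarrow> z u \<noteq> 0"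
  shows "continuous_on S (\<lambda>u. reflection_dir \<sigma> (z u))"
proof -
  have "norm (matrix_inv \<sigma> *v z u) \<noteq> 0" if "u \<in> S" for u
    using sigma_inv_nonzero[OF assms(2)[OF that]] by simp
  then show ?thesis
    unfolding reflection_dir_def using assms(1)
    by (intro continuous_on_scaleR continuous_on_divide continuous_on_const continuous_on_norm
        continuous_on_matrix_vector_mult ballI)
qed

end

section \<open>Continuous processes\<close>

text \<open>Allows events over all times in [0, t] to be tested on a countable set. The point
  \<open>t\<close> is adjoined because the open interval is empty for \<open>t = 0\<close>.\<close>

lemma closure_rational_times:
  assumes "0 \<le> t"
  shows "closure (insert t ({0<..<t} \<inter> \<rat>)) = {0..t::real}"
proof -
  have "closure ({0<..<t} \<inter> \<rat>) = closure {0<..<t}"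
    by (rule closure_open_Int_superset) (auto simp: Rats_closure_real)
  moreover have "insert t (closure {0<..<t}) = {0..t}"
  proof (cases "t = 0")
    case False
    then have "0 < t" using assms by simp
    then show ?thesis by (subst closure_greaterThanLessThan) auto
  qed simp
  ultimately show ?thesis by (simp only: closure_insert)
qed

text \<open>The process is the pointwise limit of its samples at the times floor(u (n+1)) / (n+1),
  which are nonnegative and do not exceed \<open>u\<close>, hence are covered by the continuity of
  the path.\<close>

lemma continuous_process_joint:
  fixes W :: "real \<Rightarrow> 'w \<Rightarrow> 'a::euclidean_space"
  assumes c: "\<And>\<omega>. \<omega> \<in> space N \<Longrightarrow> continuous_on {0..} (\<lambda>u. W u \<omega>)"
    and m: "\<And>u. 0 \<le> u \<Longrightarrow> W u \<in> borel_measurable N"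
  shows "(\<lambda>(u, \<omega>). W u \<omega>) \<in> borel_measurable (restrict_space borel {0..t} \<Otimes>\<^sub>M N)"
proof -
  define f where "f = (\<lambda>(n::nat) p. W (real (nat \<lfloor>fst p * real (Suc n)\<rfloor>) / real (Suc n)) (snd p))"
  have "(\<lambda>p. W (fst p) (snd p)) \<in> borel_measurable (restrict_space borel {0..t} \<Otimes>\<^sub>M N)"
  proof (rule borel_measurable_LIMSEQ_metric)
    fix n
    have "(\<lambda>p::real \<times> 'w. W (real i / real (Suc n)) (snd p)) \<in> borel_measurable (restrict_space borel {0..t} \<Otimes>\<^sub>M N)" for i
      by (rule measurable_compose[OF measurable_snd m]) simp
    moreover have "(\<lambda>p::real \<times> 'w. nat \<lfloor>fst p * real (Suc n)\<rfloor>) \<in> measurable (restrict_space borel {0..t} \<Otimes>\<^sub>M N) (count_space UNIV)"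
    proof -
      have "(\<lambda>u::real. nat \<lfloor>u * real (Suc n)\<rfloor>) \<in> measurable (restrict_space borel {0..t}) (count_space UNIV)"
        by (rule measurable_restrict_space1) measurable
      from measurable_compose[OF measurable_fst this] show ?thesis .
    qed
    ultimately show "f n \<in> borel_measurable (restrict_space borel {0..t} \<Otimes>\<^sub>M N)"
      unfolding f_def by (rule measurable_compose_countable)
  next
    fix p assume p: "p \<in> space (restrict_space borel {0..t} \<Otimes>\<^sub>M N)"
    then have u: "0 \<le> fst p" and w: "snd p \<in> space N"
      by (auto simp: space_pair_measure space_restrict_space)
    let ?d = "\<lambda>n. real (nat \<lfloor>fst p * real (Suc n)\<rfloor>) / real (Suc n)"
    have lo: "fst p - inverse (real (Suc n)) \<le> ?d n" and hi: "?d n \<le> fst p" for n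
    proof -
      have 0: "0 \<le> \<lfloor>fst p * real (Suc n)\<rfloor>" using u by simp
      have "fst p * real (Suc n) - 1 \<le> real (nat \<lfloor>fst p * real (Suc n)\<rfloor>)" "real (nat \<lfloor>fst p * real (Suc n)\<rfloor>) \<le> fst p * real (Suc n)"
        using 0 by linarith+
      then have "(fst p * real (Suc n) - 1) / real (Suc n) \<le> ?d n" "?d n \<le> fst p * real (Suc n) / real (Suc n)"
        by (intro divide_right_mono; simp)+
      then show "fst p - inverse (real (Suc n)) \<le> ?d n" "?d n \<le> fst p"
        by (simp_all add: diff_divide_distrib inverse_eq_divide)
    qed
    have "?d \<longlonglongrightarrow> fst p"
    proof (rule tendsto_sandwich)
      show "(\<lambda>n. fst p - inverse (real (Suc n))) \<longlonglongrightarrow> fst p"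
        using tendsto_diff[OF tendsto_const LIMSEQ_inverse_real_of_nat, of "fst p"] by simp
    qed (use lo hi in auto)
    then show "(\<lambda>n. f n p) \<longlonglongrightarrow> W (fst p) (snd p)"
      unfolding f_def using u
      by (intro continuous_on_tendsto_compose[OF c[OF w]]) auto
  qed
  then show ?thesis by (simp add: split_beta')
qed

text \<open>For \<open>L > 0\<close> this is the radial retraction onto the ball of radius
  \<open>L\<close>. Applied to the difference of the drifts it gives a process that is bounded and
  continuous along all paths and unchanged in the region that matters.\<close>

definition cut :: "real \<Rightarrow> 'a::real_normed_vector \<Rightarrow> 'a" where
  "cut L v = (L / max L (norm v)) *\<^sub>R v"

lemma cut_eq: "0 < L \<Longrightarrow> norm v \<le> L \<Longrightarrow> cut L v = v"
  by (simp add: cut_def)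

lemma norm_cut_le: "0 < L \<Longrightarrow> norm (cut L v) \<le> L"
  by (auto simp: cut_def max_def field_simps)

lemma continuous_on_cut[continuous_intros]:
  "0 < L \<Longrightarrow> continuous_on S f \<Longrightarrow> continuous_on S (\<lambda>u. cut L (f u))"
  unfolding cut_def by (intro continuous_intros) (auto simp: max_def)

section \<open>The coupled pair before it meets, and the region to which it is confined\<close>

locale reflection_pair = brownian M F B + diffusion_matrices G \<sigma>
  for M :: "'w measure" and F and B :: "real \<Rightarrow> 'w \<Rightarrow> real^'d" and G \<sigma> :: "real^'d^'d" +
  fixes b :: "real^'d \<Rightarrow> real^'d" and X Y I :: "real \<Rightarrow> 'w \<Rightarrow> real^'d"
  assumes b_cont: "continuous_on UNIV b"
    and X_F: "\<And>t. 0 \<le> t \<Longrightarrow> X t \<in> borel_measurable (F t)"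
    and Y_F: "\<And>t. 0 \<le> t \<Longrightarrow> Y t \<in> borel_measurable (F t)"
    and X_cont: "\<And>\<omega>. \<omega> \<in> space M \<Longrightarrow> continuous_on {0..} (\<lambda>t. X t \<omega>)"
    and Y_cont: "\<And>\<omega>. \<omega> \<in> space M \<Longrightarrow> continuous_on {0..} (\<lambda>t. Y t \<omega>)"
    and X_eq: "AE \<omega> in M. \<forall>t\<ge>0. X t \<omega> = X 0 \<omega> + (LBINT s:{0..t}. b (X s \<omega>)) + \<sigma> *v B t \<omega>"
    and ito: "is_ito_integral M F B
            (\<lambda>s \<omega>. if ereal s < coupling_time X Y \<omega>
                    then \<sigma> ** reflection_mat (reflection_dir \<sigma> (X s \<omega> - Y s \<omega>)) else 0) I"
    and Y_eq: "AE \<omega> in M. \<forall>t\<ge>0. ereal t < coupling_time X Y \<omega> \<longrightarrow>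
             Y t \<omega> = Y 0 \<omega> + (LBINT s:{0..t}. b (Y s \<omega>)) + I t \<omega>"
begin

abbreviation Z :: "real \<Rightarrow> 'w \<Rightarrow> real^'d" where "Z t \<omega> \<equiv> X t \<omega> - Y t \<omega>"

definition H :: "real \<Rightarrow> 'w \<Rightarrow> real^'d^'d" where
  "H s \<omega> = (if ereal s < coupling_time X Y \<omega> then \<sigma> ** reflection_mat (reflection_dir \<sigma> (Z s \<omega>)) else 0)"

text \<open>All three conditions are closed, so they pass to limits in time, and they weaken as
  \<open>m\<close> grows.\<close>

definition inside :: "real \<Rightarrow> real^'d \<Rightarrow> real^'d \<Rightarrow> bool" where
  "inside m x y \<longleftrightarrow> norm x \<le> m \<and> norm y \<le> m \<and> 1 \<le> m * Gnorm G (x - y)"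

definition stay :: "real \<Rightarrow> real \<Rightarrow> 'w set" where
  "stay m t = {\<omega> \<in> space M. \<forall>u\<in>{0..t}. inside m (X u \<omega>) (Y u \<omega>)}"

lemma ito_H: "is_ito_integral M F B H I"
  using ito unfolding H_def[abs_def] .

lemma H_bounded: obtains C where "0 < C" "\<And>u \<omega>. norm (H u \<omega>) \<le> C"
proof -
  obtain C where "0 < C" "\<And>z. norm (\<sigma> ** reflection_mat (reflection_dir \<sigma> z)) \<le> C"
    by (rule reflection_bounded) (rule that)
  then show thesis by (intro that[of C]) (auto simp: H_def)
qed

lemma Z_cont: "\<omega> \<in> space M \<Longrightarrow> continuous_on {0..} (\<lambda>t. Z t \<omega>)"
  by (intro continuous_on_diff X_cont Y_cont)

lemma inside_closure:
  assumes w: "\<omega> \<in> space M" and S: "S \<subseteq> {0..}" and ins: "\<And>u. u \<in> S \<Longrightarrow> inside m (X u \<omega>) (Y u \<omega>)"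
    and v: "v \<in> closure S"
  shows "inside m (X v \<omega>) (Y v \<omega>)"
proof -
  have sub: "closure S \<subseteq> {0..}" using S by (intro closure_minimal) auto
  have cl: "f v \<le> a" if f: "continuous_on {0..} f" and "\<And>u. u \<in> S \<Longrightarrow> f u \<le> a" for f :: "real \<Rightarrow> real" and a
    by (rule continuous_le_on_closure[OF continuous_on_subset[OF f sub] v]) (rule that(2))
  have "norm (X v \<omega>) \<le> m"
    using ins by (intro cl[OF continuous_on_norm[OF X_cont[OF w]]]) (simp add: inside_def)
  moreover have "norm (Y v \<omega>) \<le> m"
    using ins by (intro cl[OF continuous_on_norm[OF Y_cont[OF w]]]) (simp add: inside_def)
  moreover have "- m * Gnorm G (Z v \<omega>) \<le> - 1"
    using ins by (intro cl[OF continuous_on_mult[OF continuous_on_const continuous_on_Gnorm[OF Z_cont[OF w]]]])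
      (simp add: inside_def)
  ultimately show ?thesis by (simp add: inside_def)
qed

lemma stay_sets:
  assumes "0 \<le> t"
  shows "stay m t \<in> sets (F t)"
proof -
  let ?C = "insert t ({0<..<t} \<inter> \<rat>)"
  define S where "S = (\<lambda>u. {\<omega> \<in> space (F t). inside m (X u \<omega>) (Y u \<omega>)})"
  have S: "S u \<in> sets (F t)" if "u \<in> ?C" for u
  proof -
    have [measurable]: "X u \<in> borel_measurable (F t)" "Y u \<in> borel_measurable (F t)"
      using that assms by (auto intro!: measurable_F_mono[OF _ X_F] measurable_F_mono[OF _ Y_F])
    show ?thesis unfolding S_def inside_def by measurable
  qed
  have "(\<Inter>u\<in>?C. S u) = stay m t"
  proof (intro equalityI subsetI)
    fix \<omega> assume "\<omega> \<in> (\<Inter>u\<in>?C. S u)"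
    then have w: "\<omega> \<in> space M" and C: "\<And>u. u \<in> ?C \<Longrightarrow> inside m (X u \<omega>) (Y u \<omega>)"
      by (auto simp: S_def space_F)
    have "?C \<subseteq> {0..}" using assms by auto
    then have "inside m (X u \<omega>) (Y u \<omega>)" if "u \<in> {0..t}" for u
      using that unfolding closure_rational_times[OF assms, symmetric] by (intro inside_closure[OF w _ C])
    then show "\<omega> \<in> stay m t" using w by (simp add: stay_def)
  qed (use assms in \<open>auto simp: S_def stay_def space_F\<close>)
  moreover have "(\<Inter>u\<in>?C. S u) \<in> sets (F t)"
    using S by (intro sets.countable_INT') (auto simp: countable_rat)
  ultimately show ?thesis by (rule subst)
qed

lemma stay_antimono: "s \<le> t \<Longrightarrow> stay m t \<subseteq> stay m s"
  by (auto simp: stay_def)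

lemma inside_mono: "m \<le> m' \<Longrightarrow> inside m x y \<Longrightarrow> inside m' x y"
  using mult_right_mono[OF _ Gnorm_nonneg[of "x - y"], of m m'] unfolding inside_def by linarith

lemma stay_mono: "m \<le> m' \<Longrightarrow> stay m t \<subseteq> stay m' t"
  by (auto simp: stay_def intro: inside_mono)

lemma inside_nonzero: "inside m x y \<Longrightarrow> x - y \<noteq> 0"
  by (auto simp: inside_def)

text \<open>The infimum could still equal \<open>t\<close> if the paths met at times decreasing to
  \<open>t\<close>; continuity at \<open>t\<close> excludes this on a short interval beyond
  \<open>t\<close>.\<close>

lemma coupling_time_gt:
  assumes w: "\<omega> \<in> space M" and t: "0 \<le> t" and nz: "\<And>u. 0 \<le> u \<Longrightarrow> u \<le> t \<Longrightarrow> Z u \<omega> \<noteq> 0"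
  shows "ereal t < coupling_time X Y \<omega>"
proof -
  have "Z t \<omega> \<noteq> 0" using nz t by simp
  then obtain e where e: "0 < e" "\<And>u. u \<in> {0..} \<Longrightarrow> dist u t < e \<Longrightarrow> dist (Z u \<omega>) (Z t \<omega>) < norm (Z t \<omega>)"
    using Z_cont[OF w] t unfolding continuous_on_iff by (metis atLeast_iff zero_less_norm_iff)
  have "Z u \<omega> \<noteq> 0" if "0 \<le> u" "u < t + e" for u
  proof (cases "u \<le> t")
    case False
    then show ?thesis using e(2)[of u] that by (auto simp: dist_real_def dist_norm norm_minus_commute)
  qed (use nz that in auto)
  then have "ereal (t + e) \<le> coupling_time X Y \<omega>"
    unfolding coupling_time_def by (intro Inf_greatest) (force simp: not_less[symmetric])
  moreover have "ereal t < ereal (t + e)" using e by simp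
  ultimately show ?thesis by (rule less_le_trans[rotated])
qed

lemma before_coupling_nonzero:
  assumes "ereal t < coupling_time X Y \<omega>" "0 \<le> u" "u \<le> t"
  shows "Z u \<omega> \<noteq> 0"
proof
  assume "Z u \<omega> = 0"
  then have "coupling_time X Y \<omega> \<le> ereal u"
    unfolding coupling_time_def using assms by (intro Inf_lower) auto
  then show False using assms by (metis ereal_less_eq(3) leD order_trans)
qed

lemma stay_before_coupling:
  assumes "\<omega> \<in> stay m t" "0 \<le> u" "u \<le> t"
  shows "ereal u < coupling_time X Y \<omega>"
proof (rule coupling_time_gt)
  show "\<omega> \<in> space M" "0 \<le> u" using assms by (auto simp: stay_def)
  show "Z v \<omega> \<noteq> 0" if "0 \<le> v" "v \<le> u" for v
    using assms that by (intro inside_nonzero[of m]) (auto simp: stay_def)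
qed

text \<open>On the compact interval [0, t] both paths are bounded and, as they have not met, their
  distance has a positive minimum; \<open>m\<close> only has to exceed these bounds and the inverse
  of the minimum.\<close>

lemma stay_exhausts:
  assumes w: "\<omega> \<in> space M" and t: "0 \<le> t" "ereal t < coupling_time X Y \<omega>"
  obtains n :: nat where "\<omega> \<in> stay (real (Suc n)) t"
proof -
  have sub: "{0..t} \<subseteq> {0..}" by auto
  have ne: "{0..t} \<noteq> {}" using t by simp
  have c: "continuous_on {0..t} (\<lambda>u. norm (X u \<omega>))" "continuous_on {0..t} (\<lambda>u. norm (Y u \<omega>))" "continuous_on {0..t} (\<lambda>u. Gnorm G (Z u \<omega>))"
    using continuous_on_subset[OF X_cont[OF w] sub] continuous_on_subset[OF Y_cont[OF w] sub]
    by (auto intro!: continuous_intros)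
  obtain x1 where x1: "\<forall>u\<in>{0..t}. norm (X u \<omega>) \<le> norm (X x1 \<omega>)"
    using continuous_attains_sup[OF compact_Icc ne c(1)] by blast
  obtain x2 where x2: "\<forall>u\<in>{0..t}. norm (Y u \<omega>) \<le> norm (Y x2 \<omega>)"
    using continuous_attains_sup[OF compact_Icc ne c(2)] by blast
  obtain x3 where x3: "x3 \<in> {0..t}" "\<forall>u\<in>{0..t}. Gnorm G (Z x3 \<omega>) \<le> Gnorm G (Z u \<omega>)"
    using continuous_attains_inf[OF compact_Icc ne c(3)] by blast
  have g: "0 < Gnorm G (Z x3 \<omega>)"
    using before_coupling_nonzero[OF t(2)] x3(1) by (intro Gnorm_pos) auto
  obtain n :: nat where n: "norm (X x1 \<omega>) + norm (Y x2 \<omega>) + 1 / Gnorm G (Z x3 \<omega>) \<le> real n"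
    using real_arch_simple by blast
  have "0 \<le> 1 / Gnorm G (Z x3 \<omega>)" using g by simp
  then have le: "norm (X x1 \<omega>) \<le> real (Suc n)" "norm (Y x2 \<omega>) \<le> real (Suc n)" "1 / Gnorm G (Z x3 \<omega>) \<le> real (Suc n)"
    using n norm_ge_zero[of "X x1 \<omega>"] norm_ge_zero[of "Y x2 \<omega>"] unfolding of_nat_Suc by linarith+
  have b: "1 \<le> real (Suc n) * Gnorm G (Z x3 \<omega>)"
    using le(3) pos_divide_le_eq[OF g] by blast
  show thesis
  proof (rule that[of n])
    have "inside (real (Suc n)) (X u \<omega>) (Y u \<omega>)" if u: "u \<in> {0..t}" for u
      unfolding inside_def
    proof (intro conjI)
      show "norm (X u \<omega>) \<le> real (Suc n)" using x1 u le(1) by (blast intro: order_trans)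
      show "norm (Y u \<omega>) \<le> real (Suc n)" using x2 u le(2) by (blast intro: order_trans)
      have "real (Suc n) * Gnorm G (Z x3 \<omega>) \<le> real (Suc n) * Gnorm G (Z u \<omega>)"
        using x3(2) u by (intro mult_left_mono) auto
      then show "1 \<le> real (Suc n) * Gnorm G (Z u \<omega>)" using b by linarith
    qed
    then show "\<omega> \<in> stay (real (Suc n)) t" using w by (simp add: stay_def)
  qed
qed

definition drift :: "real \<Rightarrow> real \<Rightarrow> 'w \<Rightarrow> real^'d" where
  "drift L u \<omega> = cut L (b (X u \<omega>) - b (Y u \<omega>))"

lemma drift_cont: "0 < L \<Longrightarrow> \<omega> \<in> space M \<Longrightarrow> continuous_on {0..} (\<lambda>u. drift L u \<omega>)"
  unfolding drift_def
  by (intro continuous_on_cut continuous_on_diff continuous_on_compose2[OF b_cont] X_cont Y_cont) auto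

lemma drift_F: 
  assumes "0 < L" "0 \<le> u" shows "drift L u \<in> borel_measurable (F u)"
proof -
  have [measurable]: "X u \<in> borel_measurable (F u)" "Y u \<in> borel_measurable (F u)"
    using X_F Y_F assms by auto
  have [measurable]: "b \<in> borel_measurable borel" by (rule borel_measurable_continuous_onI[OF b_cont])
  show ?thesis unfolding drift_def[abs_def] cut_def by measurable
qed

lemma drift_bound: "0 < L \<Longrightarrow> norm (drift L u \<omega>) \<le> L"
  unfolding drift_def by (rule norm_cut_le)

lemma drift_joint:
  assumes "0 < L"
  shows "(\<lambda>(u, \<omega>). drift L u \<omega>) \<in> borel_measurable (restrict_space borel {0..t} \<Otimes>\<^sub>M M)"
  by (intro continuous_process_joint drift_cont assms measurable_F_M[OF drift_F])

lemma inside_drift_bound: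
  obtains L where "0 < L" "\<And>x y. inside m x y \<Longrightarrow> norm (b x - b y) \<le> L"
proof -
  have "compact (b ` cball 0 m)"
    by (intro compact_continuous_image continuous_on_subset[OF b_cont]) auto
  then obtain L where L: "0 < L" "\<forall>v\<in>b ` cball 0 m. norm v \<le> L"
    using compact_imp_bounded bounded_pos by blast
  have "norm (b x - b y) \<le> 2 * L" if "inside m x y" for x y
  proof -
    have "norm (b x) \<le> L" "norm (b y) \<le> L" using that L(2) by (auto simp: inside_def)
    then show ?thesis using norm_triangle_ineq4[of "b x" "b y"] by linarith
  qed
  then show thesis using L(1) by (intro that[of "2 * L"]) auto
qed

lemma drift_eq:
  assumes "0 < L" "\<And>x y. inside m x y \<Longrightarrow> norm (b x - b y) \<le> L" "\<omega> \<in> stay m t" "0 \<le> u" "u \<le> t"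
  shows "drift L u \<omega> = b (X u \<omega>) - b (Y u \<omega>)"
  unfolding drift_def using assms by (intro cut_eq assms(2)) (auto simp: stay_def)

text \<open>The restriction to \<open>stay m t\<close> serves two purposes: it places both times
  before the coupling time, where the equation of \<open>Y\<close> is given, and it makes the cut in
  \<open>drift\<close> inactive.\<close>

lemma increment_identity:
  assumes st: "0 \<le> s" "s \<le> t" and L: "0 < L" "\<And>x y. inside m x y \<Longrightarrow> norm (b x - b y) \<le> L"
  shows "AE \<omega> in M. \<omega> \<in> stay m t \<longrightarrow>
    Z t \<omega> = Z s \<omega> + (LBINT u:{s..t}. drift L u \<omega>) + \<sigma> *v (B t \<omega> - B s \<omega>) - (I t \<omega> - I s \<omega>)"
  using X_eq Y_eq AE_space
proof eventually_elim
  case (elim \<omega>)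
  show ?case
  proof
    assume st': "\<omega> \<in> stay m t"
    have T: "ereal s < coupling_time X Y \<omega>" "ereal t < coupling_time X Y \<omega>"
      using stay_before_coupling[OF st'] st by auto
    have i: "set_integrable lborel {p..q} (\<lambda>u. b (X u \<omega>))" "set_integrable lborel {p..q} (\<lambda>u. b (Y u \<omega>))" if "0 \<le> p" for p q
      using that elim(3)
      by (auto intro!: borel_integrable_compact continuous_on_compose2[OF b_cont]
          continuous_on_subset[OF X_cont] continuous_on_subset[OF Y_cont] simp: set_integrable_def)
    have split: "(LBINT u:{0..t}. f u) = (LBINT u:{0..s}. f u) + (LBINT u:{s..t}. f u)"
      if "\<And>p q. 0 \<le> p \<Longrightarrow> set_integrable lborel {p..q} f" for f :: "real \<Rightarrow> real^'d"
    proof -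
      have "{0..t} = {0..s} \<union> {s..t}" using st by auto
      moreover have "(LBINT u:{0..s} \<union> {s..t}. f u) = (LBINT u:{0..s}. f u) + (LBINT u:{s..t}. f u)"
      proof (rule set_integral_Un_AE)
        show "AE u in lborel. \<not> (u \<in> {0..s} \<and> u \<in> {s..t})"
          using AE_lborel_singleton[of s] by eventually_elim auto
      qed (use that st in auto)
      ultimately show ?thesis by simp
    qed
    have "(LBINT u:{s..t}. drift L u \<omega>) = (LBINT u:{s..t}. b (X u \<omega>) - b (Y u \<omega>))"
      using st drift_eq[OF L st'] by (intro set_lebesgue_integral_cong) auto
    also have "\<dots> = (LBINT u:{s..t}. b (X u \<omega>)) - (LBINT u:{s..t}. b (Y u \<omega>))"
      using i st by (intro set_integral_diff) auto
    finally have d: "(LBINT u:{s..t}. drift L u \<omega>) = (LBINT u:{s..t}. b (X u \<omega>)) - (LBINT u:{s..t}. b (Y u \<omega>))" .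
    have sX: "(LBINT s:{0..t}. b (X s \<omega>)) = (LBINT s:{0..s}. b (X s \<omega>)) + (LBINT u:{s..t}. b (X u \<omega>))"
      by (rule split) (rule i)
    have sY: "(LBINT s:{0..t}. b (Y s \<omega>)) = (LBINT s:{0..s}. b (Y s \<omega>)) + (LBINT u:{s..t}. b (Y u \<omega>))"
      by (rule split) (rule i)
    have X: "X t \<omega> = X 0 \<omega> + (LBINT s:{0..t}. b (X s \<omega>)) + \<sigma> *v B t \<omega>" "X s \<omega> = X 0 \<omega> + (LBINT s:{0..s}. b (X s \<omega>)) + \<sigma> *v B s \<omega>"
      by (rule elim(1)[rule_format]; use st in simp)+
    have Y: "Y t \<omega> = Y 0 \<omega> + (LBINT s:{0..t}. b (Y s \<omega>)) + I t \<omega>" "Y s \<omega> = Y 0 \<omega> + (LBINT s:{0..s}. b (Y s \<omega>)) + I s \<omega>"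
      by (rule elim(2)[rule_format]; use st T in simp)+
    show "Z t \<omega> = Z s \<omega> + (LBINT u:{s..t}. drift L u \<omega>) + \<sigma> *v (B t \<omega> - B s \<omega>) - (I t \<omega> - I s \<omega>)"
      unfolding X Y d sX sY by (simp add: matrix_vector_mult_diff_distrib algebra_simps)
  qed
qed

end

section \<open>Freezing the drift and moments of frozen noise\<close>

lemma continuous_set_integrable:
  fixes f :: "real \<Rightarrow> 'a::{banach, second_countable_topology}"
  assumes "continuous_on {s..t} f"
  shows "set_integrable lborel {s..t} f"
  using borel_integrable_compact[OF compact_Icc assms] by (simp add: set_integrable_def)

lemma set_integral_norm_le_const:
  fixes f :: "real \<Rightarrow> 'a::euclidean_space"
  assumes f: "continuous_on {s..t} f" and st: "s \<le> t" and L: "\<And>u. u \<in> {s..t} \<Longrightarrow> norm (f u) \<le> L"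
  shows "norm (LBINT u:{s..t}. f u) \<le> L * (t - s)"
proof -
  have "norm (LBINT u:{s..t}. f u) \<le> (LBINT u:{s..t}. norm (f u))"
    by (rule set_integral_norm_bound[OF continuous_set_integrable[OF f]])
  also have "\<dots> \<le> (LBINT u:{s..t}. L)"
    by (intro set_integral_mono continuous_set_integrable continuous_intros f L)
  also have "\<dots> = L * (t - s)" using st by (simp add: set_lebesgue_integral_def)
  finally show ?thesis .
qed

text \<open>Freezes the drift at the start of the step. Young's inequality x \<le> \<theta> +
  x^2/(4\<theta>) trades the first power of the oscillation for its square, which is the quantity
  that \<open>err\<close> measures.\<close>

lemma inner_set_integral_le:
  fixes \<beta> :: "real \<Rightarrow> 'a::euclidean_space"
  assumes \<beta>: "continuous_on {s..t} \<beta>" and st: "s \<le> t" and \<theta>: "0 < \<theta>"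
  shows "w \<bullet> (LBINT u:{s..t}. \<beta> u) \<le> (t - s) * (w \<bullet> \<beta> s) + \<theta> * (t - s)
     + (norm w)\<^sup>2 / (4 * \<theta>) * enn2real (\<integral>\<^sup>+u\<in>{s..t}. ennreal ((norm (\<beta> u - \<beta> s))\<^sup>2) \<partial>lborel)"
proof -
  have sq: "continuous_on {s..t} (\<lambda>u. (norm (\<beta> u - \<beta> s))\<^sup>2)" using \<beta> by (intro continuous_intros)
  have D: "enn2real (\<integral>\<^sup>+u\<in>{s..t}. ennreal ((norm (\<beta> u - \<beta> s))\<^sup>2) \<partial>lborel) = (LBINT u:{s..t}. (norm (\<beta> u - \<beta> s))\<^sup>2)"
  proof -
    have i: "integrable lborel (\<lambda>u. indicator {s..t} u * (norm (\<beta> u - \<beta> s))\<^sup>2)"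
      using continuous_set_integrable[OF sq] by (simp add: set_integrable_def)
    have "(\<integral>\<^sup>+u\<in>{s..t}. ennreal ((norm (\<beta> u - \<beta> s))\<^sup>2) \<partial>lborel) = (\<integral>\<^sup>+u. ennreal (indicator {s..t} u * (norm (\<beta> u - \<beta> s))\<^sup>2) \<partial>lborel)"
      by (intro nn_integral_cong) (auto split: split_indicator)
    also have "\<dots> = ennreal (LBINT u:{s..t}. (norm (\<beta> u - \<beta> s))\<^sup>2)"
      using nn_integral_eq_integral[OF i] by (simp add: set_lebesgue_integral_def)
    finally show ?thesis by (simp add: set_lebesgue_integral_def)
  qed
  have "w \<bullet> (LBINT u:{s..t}. \<beta> u) = (LBINT u:{s..t}. w \<bullet> \<beta> u)"
    using continuous_set_integrable[OF \<beta>] by (simp add: set_lebesgue_integral_def set_integrable_def inner_scaleR_right[symmetric] del: inner_scaleR_right)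
  also have "\<dots> \<le> (LBINT u:{s..t}. (w \<bullet> \<beta> s + \<theta>) + (norm w)\<^sup>2 / (4 * \<theta>) * (norm (\<beta> u - \<beta> s))\<^sup>2)"
  proof (intro set_integral_mono continuous_set_integrable continuous_intros \<beta>)
    fix u
    have "w \<bullet> \<beta> u - w \<bullet> \<beta> s \<le> norm w * norm (\<beta> u - \<beta> s)"
      unfolding inner_diff_right[symmetric] by (rule norm_cauchy_schwarz)
    moreover have "norm w * norm (\<beta> u - \<beta> s) \<le> \<theta> + (norm w)\<^sup>2 / (4 * \<theta>) * (norm (\<beta> u - \<beta> s))\<^sup>2"
    proof -
      define x where "x = norm w * norm (\<beta> u - \<beta> s)"
      have "0 \<le> (2 * \<theta> - x)\<^sup>2" by simp
      then have "4 * \<theta> * x \<le> 4 * \<theta> * \<theta> + x\<^sup>2" by (simp add: power2_eq_square algebra_simps)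
      then have "x \<le> \<theta> + x\<^sup>2 / (4 * \<theta>)" using \<theta> by (simp add: field_simps)
      then show ?thesis unfolding x_def by (simp add: power_mult_distrib)
    qed
    ultimately show "w \<bullet> \<beta> u \<le> (w \<bullet> \<beta> s + \<theta>) + (norm w)\<^sup>2 / (4 * \<theta>) * (norm (\<beta> u - \<beta> s))\<^sup>2" by linarith
  qed
  also have "\<dots> = (LBINT u:{s..t}. (w \<bullet> \<beta> s + \<theta>)) + (norm w)\<^sup>2 / (4 * \<theta>) * (LBINT u:{s..t}. (norm (\<beta> u - \<beta> s))\<^sup>2)"
    using sq \<theta> by (subst set_integral_add(2)) (auto intro!: continuous_set_integrable continuous_intros)
  also have "(LBINT u:{s..t}. (w \<bullet> \<beta> s + \<theta>)) = (t - s) * (w \<bullet> \<beta> s) + \<theta> * (t - s)"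
    using st by (simp add: set_lebesgue_integral_def algebra_simps)
  finally show ?thesis unfolding D .
qed

lemma borel_measurable_set_lebesgue_integral:
  fixes f :: "real \<Rightarrow> 'w \<Rightarrow> 'a::{banach, second_countable_topology}"
  assumes f: "(\<lambda>(u, \<omega>). f u \<omega>) \<in> borel_measurable (restrict_space borel S \<Otimes>\<^sub>M N)"
    and S: "S \<in> sets borel"
  shows "(\<lambda>\<omega>. LBINT u:S. f u \<omega>) \<in> borel_measurable N"
proof -
  interpret sigma_finite_measure "restrict_space lborel S"
    using S by (rule sigma_finite_restrict_lborel)
  have "(\<lambda>(\<omega>, u). f u \<omega>) \<in> borel_measurable (N \<Otimes>\<^sub>M restrict_space borel S)"
    using measurable_compose[OF measurable_pair_swap' f] by (simp add: split_beta')
  then have "(\<lambda>(\<omega>, u). f u \<omega>) \<in> borel_measurable (N \<Otimes>\<^sub>M restrict_space lborel S)"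
    by (simp cong: measurable_cong_sets sets_pair_measure_cong add: sets_restrict_space)
  from borel_measurable_lebesgue_integral[OF this] S
  show ?thesis by (simp add: integral_restrict_space set_lebesgue_integral_def)
qed

context brownian
begin

text \<open>The covariance of an increment is \<open>t - s\<close> times the identity, so only the
  squared norm of \<zeta> survives. The weight \<open>q\<close> will carry the second order
  coefficient of the distance function.\<close>

lemma increment_inner_square:
  fixes \<zeta> :: "'w \<Rightarrow> real^'d"
  assumes st: "0 \<le> s" "s \<le> t" and \<zeta>: "\<zeta> \<in> borel_measurable (F s)" "\<And>\<omega>. \<omega> \<in> space M \<Longrightarrow> norm (\<zeta> \<omega>) \<le> C"
    and q: "q \<in> borel_measurable (F s)" "\<And>\<omega>. \<omega> \<in> space M \<Longrightarrow> \<bar>q \<omega>\<bar> \<le> Q"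
  shows "has_bochner_integral M (\<lambda>\<omega>. q \<omega> * (\<zeta> \<omega> \<bullet> (B t \<omega> - B s \<omega>))\<^sup>2) ((t - s) * expectation (\<lambda>\<omega>. q \<omega> * (norm (\<zeta> \<omega>))\<^sup>2))"
proof -
  have [measurable]: "\<zeta> \<in> borel_measurable (F s)" "q \<in> borel_measurable (F s)" by fact+
  let ?D = "\<lambda>\<omega>. B t \<omega> - B s \<omega>"
  have meas: "(\<lambda>\<omega>. q \<omega> * (\<zeta> \<omega> $ j * \<zeta> \<omega> $ k)) \<in> borel_measurable (F s)" for j k by measurable
  have int: "integrable M (\<lambda>\<omega>. q \<omega> * (\<zeta> \<omega> $ j * \<zeta> \<omega> $ k))" for j k
  proof (rule integrable_const_bound[of _ "Q * (C * C)"])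
    have "\<bar>q \<omega> * (\<zeta> \<omega> $ j * \<zeta> \<omega> $ k)\<bar> \<le> Q * (C * C)" if w: "\<omega> \<in> space M" for \<omega>
    proof -
      have c: "\<bar>\<zeta> \<omega> $ i\<bar> \<le> C" for i using component_le_norm_cart[of "\<zeta> \<omega>" i] \<zeta>(2)[OF w] by linarith
      then have C0: "0 \<le> C" using abs_ge_zero order_trans by blast
      have Q0: "0 \<le> Q" using q(2)[OF w] by linarith
      show ?thesis unfolding abs_mult using c q(2)[OF w] C0 Q0 by (intro mult_mono) auto
    qed
    then show "AE \<omega> in M. norm (q \<omega> * (\<zeta> \<omega> $ j * \<zeta> \<omega> $ k)) \<le> Q * (C * C)" by auto
  qed (rule measurable_F_M[OF meas])
  have "has_bochner_integral M
     (\<lambda>\<omega>. \<Sum>j\<in>UNIV. \<Sum>k\<in>UNIV. (q \<omega> * (\<zeta> \<omega> $ j * \<zeta> \<omega> $ k)) * (?D \<omega> $ j * ?D \<omega> $ k))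
     (\<Sum>j\<in>UNIV. \<Sum>k\<in>UNIV. (if j = k then (t - s) * expectation (\<lambda>\<omega>. q \<omega> * (\<zeta> \<omega> $ j * \<zeta> \<omega> $ k)) else 0))"
    by (intro has_bochner_integral_sum increment_covariance st int meas)
  moreover have "(\<Sum>j\<in>UNIV. \<Sum>k\<in>UNIV. (q \<omega> * (\<zeta> \<omega> $ j * \<zeta> \<omega> $ k)) * (?D \<omega> $ j * ?D \<omega> $ k)) = q \<omega> * (\<zeta> \<omega> \<bullet> ?D \<omega>)\<^sup>2" for \<omega>
    by (simp add: inner_vec_def power2_eq_square sum_product sum_distrib_left mult_ac)
  moreover have "(\<Sum>j\<in>UNIV. \<Sum>k\<in>UNIV. (if j = k then (t - s) * expectation (\<lambda>\<omega>. q \<omega> * (\<zeta> \<omega> $ j * \<zeta> \<omega> $ k)) else 0))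
     = (t - s) * expectation (\<lambda>\<omega>. q \<omega> * (norm (\<zeta> \<omega>))\<^sup>2)"
  proof -
    have "has_bochner_integral M (\<lambda>\<omega>. \<Sum>j\<in>UNIV. q \<omega> * (\<zeta> \<omega> $ j * \<zeta> \<omega> $ j)) (\<Sum>j\<in>UNIV. expectation (\<lambda>\<omega>. q \<omega> * (\<zeta> \<omega> $ j * \<zeta> \<omega> $ j)))"
      by (intro has_bochner_integral_sum has_bochner_integral_integrable int)
    moreover have "(\<Sum>j\<in>UNIV. q \<omega> * (\<zeta> \<omega> $ j * \<zeta> \<omega> $ j)) = q \<omega> * (norm (\<zeta> \<omega>))\<^sup>2" for \<omega>
      unfolding norm_vec_sq by (simp add: power2_eq_square sum_distrib_left)
    ultimately have "expectation (\<lambda>\<omega>. q \<omega> * (norm (\<zeta> \<omega>))\<^sup>2) = (\<Sum>j\<in>UNIV. expectation (\<lambda>\<omega>. q \<omega> * (\<zeta> \<omega> $ j * \<zeta> \<omega> $ j)))"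
      by (simp add: has_bochner_integral_integral_eq)
    then show ?thesis by (simp add: sum_distrib_left)
  qed
  ultimately show ?thesis by simp
qed

lemma increment_inner_moment4:
  fixes \<zeta> :: "'w \<Rightarrow> real^'d"
  assumes st: "0 \<le> s" "s \<le> t" and \<zeta>: "\<zeta> \<in> borel_measurable (F s)" "\<And>\<omega>. \<omega> \<in> space M \<Longrightarrow> norm (\<zeta> \<omega>) \<le> C"
  shows "integrable M (\<lambda>\<omega>. (\<zeta> \<omega> \<bullet> (B t \<omega> - B s \<omega>)) ^ 4)"
    and "expectation (\<lambda>\<omega>. (\<zeta> \<omega> \<bullet> (B t \<omega> - B s \<omega>)) ^ 4) \<le> C ^ 4 * (3 * (real CARD('d))\<^sup>2 * (t - s)\<^sup>2)"
proof -
  let ?D = "\<lambda>\<omega>. B t \<omega> - B s \<omega>"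
  have [measurable]: "\<zeta> \<in> borel_measurable M" using \<zeta>(1) by (rule measurable_F_M)
  have le: "(\<zeta> \<omega> \<bullet> ?D \<omega>) ^ 4 \<le> C ^ 4 * (norm (?D \<omega>)) ^ 4" if w: "\<omega> \<in> space M" for \<omega>
  proof -
    have "\<bar>\<zeta> \<omega> \<bullet> ?D \<omega>\<bar> \<le> C * norm (?D \<omega>)"
      by (rule order_trans[OF Cauchy_Schwarz_ineq2]) (intro mult_right_mono \<zeta>(2)[OF w] norm_ge_zero)
    then have "\<bar>\<zeta> \<omega> \<bullet> ?D \<omega>\<bar> ^ 4 \<le> (C * norm (?D \<omega>)) ^ 4" by (intro power_mono) auto
    then show ?thesis by (simp add: power_mult_distrib power_even_abs)
  qed
  have i: "integrable M (\<lambda>\<omega>. C ^ 4 * (norm (?D \<omega>)) ^ 4)" using increment_moment4(1)[OF st] by simp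
  show *: "integrable M (\<lambda>\<omega>. (\<zeta> \<omega> \<bullet> ?D \<omega>) ^ 4)"
  proof (rule Bochner_Integration.integrable_bound[OF i])
    have [measurable]: "B t \<in> borel_measurable M" "B s \<in> borel_measurable M" using st by auto
    show "(\<lambda>\<omega>. (\<zeta> \<omega> \<bullet> ?D \<omega>) ^ 4) \<in> borel_measurable M" by measurable
    show "AE \<omega> in M. norm ((\<zeta> \<omega> \<bullet> ?D \<omega>) ^ 4) \<le> norm (C ^ 4 * (norm (?D \<omega>)) ^ 4)"
      using le by (intro AE_I2) (simp add: zero_le_even_power abs_of_nonneg)
  qed
  have "expectation (\<lambda>\<omega>. (\<zeta> \<omega> \<bullet> ?D \<omega>) ^ 4) \<le> expectation (\<lambda>\<omega>. C ^ 4 * (norm (?D \<omega>)) ^ 4)"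
    using * i le by (rule integral_mono)
  also have "\<dots> = C ^ 4 * expectation (\<lambda>\<omega>. (norm (?D \<omega>)) ^ 4)" by simp
  also have "\<dots> \<le> C ^ 4 * (3 * (real CARD('d))\<^sup>2 * (t - s)\<^sup>2)"
    by (intro mult_left_mono increment_moment4(2)[OF st]) auto
  finally show "expectation (\<lambda>\<omega>. (\<zeta> \<omega> \<bullet> ?D \<omega>) ^ 4) \<le> C ^ 4 * (3 * (real CARD('d))\<^sup>2 * (t - s)\<^sup>2)" .
qed

end

section \<open>The expected distance over one step\<close>

context reflection_pair
begin

text \<open>Expected squared oscillation of the integrand and the drift over one step, that is, the
  cost of freezing both at time \<open>s\<close>. The event is \<open>stay m s\<close> and not
  \<open>stay m t\<close>, because the isometry needs an event known at the start of the
  step.\<close>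

definition err :: "real \<Rightarrow> real \<Rightarrow> real \<Rightarrow> real \<Rightarrow> ennreal" where
  "err L m s t = (\<integral>\<^sup>+\<omega>\<in>stay m s. (\<integral>\<^sup>+u\<in>{s..t}.
     (ennreal ((norm (H u \<omega> - H s \<omega>))\<^sup>2) + ennreal ((norm (drift L u \<omega> - drift L s \<omega>))\<^sup>2)) \<partial>lborel) \<partial>M)"

lemma H_F: "0 \<le> s \<Longrightarrow> H s \<in> borel_measurable (F s)"
  using ito_H unfolding is_ito_integral_def by (auto intro: progressive_adapted)

lemma H_joint:
  assumes "0 \<le> s" "s \<le> t"
  shows "(\<lambda>(u, \<omega>). H u \<omega>) \<in> borel_measurable (restrict_space borel {s..t} \<Otimes>\<^sub>M M)"
  using ito_H assms unfolding is_ito_integral_def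
  by (intro joint_measurable_subset[of _ "{0..t}" _ _ "{s..t}"] progressive_joint) auto

lemma norm_diff_sq_bound:
  assumes "norm x \<le> C" "norm (y :: 'a::real_normed_vector) \<le> C"
  shows "(norm (x - y))\<^sup>2 \<le> 4 * C\<^sup>2"
proof -
  have "norm (x - y) \<le> 2 * C" using norm_triangle_ineq4[of x y] assms by linarith
  then have "(norm (x - y))\<^sup>2 \<le> (2 * C)\<^sup>2" by (intro power_mono) auto
  then show ?thesis by (simp add: power_mult_distrib)
qed

lemma err_parts:
  assumes st: "0 \<le> s" "s \<le> t" and L: "0 < L"
  shows "err L m s t < \<top>"
    and "(\<integral>\<^sup>+\<omega>\<in>stay m s. (\<integral>\<^sup>+u\<in>{s..t}. ennreal ((norm (H u \<omega> - H s \<omega>))\<^sup>2) \<partial>lborel) \<partial>M) \<le> err L m s t"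
    and "(\<integral>\<^sup>+\<omega>\<in>stay m s. (\<integral>\<^sup>+u\<in>{s..t}. ennreal ((norm (drift L u \<omega> - drift L s \<omega>))\<^sup>2) \<partial>lborel) \<partial>M) \<le> err L m s t"
proof -
  obtain C where C: "0 < C" "\<And>u \<omega>. norm (H u \<omega>) \<le> C" by (rule H_bounded) (rule that)
  have "err L m s t \<le> (\<integral>\<^sup>+\<omega>. (\<integral>\<^sup>+u\<in>{s..t}. ennreal (4 * C\<^sup>2 + 4 * L\<^sup>2) \<partial>lborel) \<partial>M)"
    unfolding err_def
  proof (rule nn_integral_mono)
    fix \<omega>
    have "ennreal ((norm (H u \<omega> - H s \<omega>))\<^sup>2) + ennreal ((norm (drift L u \<omega> - drift L s \<omega>))\<^sup>2) \<le> ennreal (4 * C\<^sup>2 + 4 * L\<^sup>2)" for u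
      unfolding ennreal_plus[OF zero_le_power2 zero_le_power2, symmetric]
      by (intro ennreal_leI add_mono norm_diff_sq_bound C drift_bound L)
    then have "(\<integral>\<^sup>+u\<in>{s..t}. (ennreal ((norm (H u \<omega> - H s \<omega>))\<^sup>2) + ennreal ((norm (drift L u \<omega> - drift L s \<omega>))\<^sup>2)) \<partial>lborel)
      \<le> (\<integral>\<^sup>+u\<in>{s..t}. ennreal (4 * C\<^sup>2 + 4 * L\<^sup>2) \<partial>lborel)"
      by (intro nn_integral_mono mult_right_mono) auto
    then show "(\<integral>\<^sup>+u\<in>{s..t}. (ennreal ((norm (H u \<omega> - H s \<omega>))\<^sup>2) + ennreal ((norm (drift L u \<omega> - drift L s \<omega>))\<^sup>2)) \<partial>lborel) * indicator (stay m s) \<omega>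
      \<le> (\<integral>\<^sup>+u\<in>{s..t}. ennreal (4 * C\<^sup>2 + 4 * L\<^sup>2) \<partial>lborel)"
      by (auto split: split_indicator)
  qed
  also have "\<dots> < \<top>"
    using st by (simp add: nn_integral_cmult_indicator emeasure_space_1 ennreal_mult_less_top)
  finally show "err L m s t < \<top>" .
  show "(\<integral>\<^sup>+\<omega>\<in>stay m s. (\<integral>\<^sup>+u\<in>{s..t}. ennreal ((norm (H u \<omega> - H s \<omega>))\<^sup>2) \<partial>lborel) \<partial>M) \<le> err L m s t"
    "(\<integral>\<^sup>+\<omega>\<in>stay m s. (\<integral>\<^sup>+u\<in>{s..t}. ennreal ((norm (drift L u \<omega> - drift L s \<omega>))\<^sup>2) \<partial>lborel) \<partial>M) \<le> err L m s t"
    unfolding err_def by (intro nn_integral_mono mult_right_mono; auto intro: add_increasing add_increasing2)+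
qed

lemma integral_le_of_nn_integral:
  fixes g :: "'w \<Rightarrow> real"
  assumes [measurable]: "g \<in> borel_measurable M" and "\<And>\<omega>. 0 \<le> g \<omega>"
    and e: "(\<integral>\<^sup>+\<omega>. ennreal (g \<omega>) \<partial>M) \<le> e" "e < \<top>"
  shows "integrable M g" "expectation g \<le> enn2real e"
proof -
  show "integrable M g"
    by (rule integrableI_nonneg) (use assms in \<open>auto intro: le_less_trans\<close>)
  have "expectation g = enn2real (\<integral>\<^sup>+\<omega>. ennreal (g \<omega>) \<partial>M)"
    by (rule integral_eq_nn_integral) (use assms in auto)
  then show "expectation g \<le> enn2real e" using enn2real_mono[OF e] by simp
qed

lemma one_step:
  fixes f fp h :: "real \<Rightarrow> real"
  assumes m: "0 < m" and L: "0 < L" "\<And>x y. inside m x y \<Longrightarrow> norm (b x - b y) \<le> L"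
    and \<delta>: "0 < \<delta>" "\<And>x y. inside m x y \<Longrightarrow> \<delta> \<le> Gnorm G (x - y) \<and> Gnorm G (x - y) \<le> R"
    and f: "\<And>y. 0 \<le> y \<Longrightarrow> 0 \<le> f y"
    and meas[measurable]: "f \<in> borel_measurable borel" "fp \<in> borel_measurable borel" "h \<in> borel_measurable borel"
    and fF: "\<And>\<rho>. \<delta> \<le> \<rho> \<Longrightarrow> \<rho> \<le> R \<Longrightarrow> f \<rho> \<le> F0"
    and fp: "\<And>\<rho>. \<delta> \<le> \<rho> \<Longrightarrow> \<rho> \<le> R \<Longrightarrow> 0 \<le> fp \<rho> \<and> fp \<rho> \<le> 1"
    and h_nonneg: "0 \<le> H0" and h: "\<And>\<rho>. \<delta> \<le> \<rho> \<Longrightarrow> \<rho> \<le> R \<Longrightarrow> \<bar>h \<rho>\<bar> \<le> H0"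
    and step: "\<And>\<theta>. 0 < \<theta> \<Longrightarrow> \<exists>K\<ge>0. \<forall>\<rho> a p N r'. \<delta> \<le> \<rho> \<longrightarrow> \<rho> \<le> R \<longrightarrow> 0 \<le> r' \<longrightarrow> \<bar>p\<bar> \<le> N \<longrightarrow>
       r'\<^sup>2 = ((1 + a) * \<rho>)\<^sup>2 + 2 * ((1 + a) * \<rho>) * p + N\<^sup>2 \<longrightarrow>
       f r' \<le> f \<rho> + fp \<rho> * (\<rho> * a + p) + h \<rho> / 2 * (\<rho> * a)\<^sup>2 + \<theta> * a\<^sup>2 + K * (a ^ 4 + N\<^sup>2)"
    and gen: "\<And>x y. inside m x y \<Longrightarrow> fp (Gnorm G (x - y)) / Gnorm G (x - y) * ((x - y) \<bullet> (G *v (b x - b y)))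
       + 2 * h (Gnorm G (x - y)) * (Gnorm G (x - y))\<^sup>2 / (norm (matrix_inv \<sigma> *v (x - y)))\<^sup>2 \<le> - c * f (Gnorm G (x - y))"
    and \<theta>: "0 < \<theta>"
  shows "\<exists>K\<ge>0. \<forall>s t. 0 \<le> s \<longrightarrow> s \<le> t \<longrightarrow>
    expectation (\<lambda>\<omega>. indicator (stay m t) \<omega> * f (Gnorm G (Z t \<omega>)))
    \<le> (1 - c * (t - s)) * expectation (\<lambda>\<omega>. indicator (stay m s) \<omega> * f (Gnorm G (Z s \<omega>)))
      + \<theta> * (t - s) + K * ((t - s)\<^sup>2 + enn2real (err L m s t))"
proof -
  obtain l where l: "0 < l" "\<And>z. l * Gnorm G z \<le> norm (matrix_inv \<sigma> *v z)"
    by (rule sigma_inv_lower) (rule that)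
  obtain l0 u where u: "0 < l0" "0 < u" "\<And>z. l0 * norm z \<le> Gnorm G z" "\<And>z. Gnorm G z \<le> u * norm z"
    by (rule Gnorm_bounds) (rule that)
  obtain C where C: "0 < C" "\<And>u \<omega>. norm (H u \<omega>) \<le> C" by (rule H_bounded) (rule that)
  define C\<zeta> where "C\<zeta> = 2 / (l * \<delta>)"
  define W where "W = (1 / \<delta>) * (norm G * (2 * m))"
  \<comment> \<open>Errors of weight \<theta>1 arise twice: from freezing the drift, with factor t -
    s, and from the expansion, with a^2 whose mean is at most
    \<open>C\<zeta>\<^sup>2 * (t - s)\<close>. Together they make up \<theta> (t - s).\<close>
  define \<theta>1 where "\<theta>1 = \<theta> / (1 + C\<zeta>\<^sup>2)"
  have C\<zeta>0: "0 < C\<zeta>" using l \<delta> by (simp add: C\<zeta>_def)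
  have W0: "0 \<le> W" using \<delta> m by (simp add: W_def)
  have \<theta>1: "0 < \<theta>1" using \<theta> by (simp add: \<theta>1_def add_pos_nonneg)
  have \<theta>1_eq: "\<theta>1 + \<theta>1 * C\<zeta>\<^sup>2 = \<theta>"
  proof -
    have "1 + C\<zeta>\<^sup>2 \<noteq> 0" by (metis add_pos_nonneg less_irrefl zero_le_power2 zero_less_one)
    moreover have "\<theta>1 + \<theta>1 * C\<zeta>\<^sup>2 = \<theta>1 * (1 + C\<zeta>\<^sup>2)" by (simp add: algebra_simps)
    ultimately show ?thesis by (simp add: \<theta>1_def)
  qed
  from step[OF \<theta>1] obtain K where K: "0 \<le> K" "\<And>\<rho> a p N r'. \<delta> \<le> \<rho> \<Longrightarrow> \<rho> \<le> R \<Longrightarrow> 0 \<le> r' \<Longrightarrow> \<bar>p\<bar> \<le> N \<Longrightarrow>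
       r'\<^sup>2 = ((1 + a) * \<rho>)\<^sup>2 + 2 * ((1 + a) * \<rho>) * p + N\<^sup>2 \<Longrightarrow>
       f r' \<le> f \<rho> + fp \<rho> * (\<rho> * a + p) + h \<rho> / 2 * (\<rho> * a)\<^sup>2 + \<theta>1 * a\<^sup>2 + K * (a ^ 4 + N\<^sup>2)"
    by blast
  \<comment> \<open>\<open>K1\<close> collects the coefficients of \<open>err\<close> and
    \<open>K2\<close> those of (t - s)^2; the factor 3 and the squared dimension come from the
    fourth moment of an increment.\<close>
  define K1 where "K1 = W\<^sup>2 / (4 * \<theta>1) + 4 * K * u\<^sup>2"
  define K2 where "K2 = K * (C\<zeta> ^ 4 * (3 * (real CARD('d))\<^sup>2)) + 2 * K * u\<^sup>2 * L\<^sup>2"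
  have K12: "0 \<le> K1" "0 \<le> K2" using K(1) \<theta>1 C\<zeta>0 by (auto simp: K1_def K2_def intro!: add_nonneg_nonneg mult_nonneg_nonneg)
  have main: "expectation (\<lambda>\<omega>. indicator (stay m t) \<omega> * f (Gnorm G (Z t \<omega>)))
    \<le> (1 - c * (t - s)) * expectation (\<lambda>\<omega>. indicator (stay m s) \<omega> * f (Gnorm G (Z s \<omega>)))
      + \<theta> * (t - s) + (K2 * (t - s)\<^sup>2 + K1 * enn2real (err L m s t))" if st: "0 \<le> s" "s \<le> t" for s t
  proof -
    let ?A = "stay m s"
    let ?i = "\<lambda>\<omega>. indicat_real ?A \<omega>"
    let ?\<rho> = "\<lambda>\<omega>. Gnorm G (Z s \<omega>)"
    let ?y = "\<lambda>\<omega>. matrix_inv \<sigma> *v Z s \<omega>"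
    let ?D = "\<lambda>\<omega>. B t \<omega> - B s \<omega>"
    \<comment> \<open>The reflected noise stretches \<open>Z s\<close> by 1 + \<zeta> \<bullet> (B t
      - B s); \<open>w\<close> is the gradient of the distance function at \<open>Z s\<close>, and
      \<open>q\<close> is its second order coefficient. The indicator makes all three
      bounded.\<close>
    define \<zeta> where "\<zeta> = (\<lambda>\<omega>. ?i \<omega> *\<^sub>R ((2 / (norm (?y \<omega>))\<^sup>2) *\<^sub>R ?y \<omega>))"
    define w where "w = (\<lambda>\<omega>. (?i \<omega> * (fp (?\<rho> \<omega>) / ?\<rho> \<omega>)) *\<^sub>R (G *v Z s \<omega>))"
    define q where "q = (\<lambda>\<omega>. ?i \<omega> * (h (?\<rho> \<omega>) / 2 * (?\<rho> \<omega>)\<^sup>2))"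
    define J where "J = (\<lambda>\<omega>. LBINT u:{s..t}. drift L u \<omega>)"
    define \<epsilon> where "\<epsilon> = (\<lambda>\<omega>. I t \<omega> - I s \<omega> - H s \<omega> *v ?D \<omega>)"
    define Db where "Db = (\<lambda>\<omega>. enn2real (\<integral>\<^sup>+u\<in>{s..t}. ennreal ((norm (drift L u \<omega> - drift L s \<omega>))\<^sup>2) \<partial>lborel))"
    have t: "0 \<le> t" using st by simp
    have A_F[measurable]: "?A \<in> sets (F s)" by (rule stay_sets[OF st(1)])
    have A_M[measurable]: "?A \<in> sets M" "stay m t \<in> sets M" using stay_sets sets_F_M st t by blast+
    have [measurable]: "X s \<in> borel_measurable (F s)" "Y s \<in> borel_measurable (F s)" "H s \<in> borel_measurable (F s)"
      using X_F Y_F H_F st by auto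
    have Zm[measurable]: "(\<lambda>\<omega>. Z s \<omega>) \<in> borel_measurable (F s)" by measurable
    have \<zeta>_F[measurable]: "\<zeta> \<in> borel_measurable (F s)" unfolding \<zeta>_def by measurable
    have w_F[measurable]: "w \<in> borel_measurable (F s)" unfolding w_def by measurable
    have q_F[measurable]: "q \<in> borel_measurable (F s)" unfolding q_def by measurable
    have M_meas[measurable]: "X t \<in> borel_measurable M" "Y t \<in> borel_measurable M" "X s \<in> borel_measurable M" "Y s \<in> borel_measurable M"
      "B t \<in> borel_measurable M" "B s \<in> borel_measurable M" "I t \<in> borel_measurable M" "I s \<in> borel_measurable M"
      "H s \<in> borel_measurable M" "drift L s \<in> borel_measurable M" "\<zeta> \<in> borel_measurable M" "w \<in> borel_measurable M" "q \<in> borel_measurable M"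
    proof -
      show "X t \<in> borel_measurable M" "Y t \<in> borel_measurable M" by (fact measurable_F_M[OF X_F[OF t]] measurable_F_M[OF Y_F[OF t]])+
      show "X s \<in> borel_measurable M" "Y s \<in> borel_measurable M" by (fact measurable_F_M[OF X_F[OF st(1)]] measurable_F_M[OF Y_F[OF st(1)]])+
      show "H s \<in> borel_measurable M" "drift L s \<in> borel_measurable M"
        by (fact measurable_F_M[OF H_F[OF st(1)]] measurable_F_M[OF drift_F[OF L(1) st(1)]])+
      show "\<zeta> \<in> borel_measurable M" "w \<in> borel_measurable M" "q \<in> borel_measurable M"
        by (fact measurable_F_M[OF \<zeta>_F] measurable_F_M[OF w_F] measurable_F_M[OF q_F])+
      show "B t \<in> borel_measurable M" "B s \<in> borel_measurable M" using B_measurable t st(1) by auto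
      show "I t \<in> borel_measurable M" "I s \<in> borel_measurable M" using ito_H t st(1) unfolding is_ito_integral_def by auto
    qed
    have djoint: "(\<lambda>(u, \<omega>). drift L u \<omega>) \<in> borel_measurable (restrict_space borel {s..t} \<Otimes>\<^sub>M M)"
      using drift_joint[OF L(1), of t] st by (intro joint_measurable_subset[of _ "{0..t}" _ _ "{s..t}"]) auto
    have J_meas[measurable]: "J \<in> borel_measurable M"
      unfolding J_def by (rule borel_measurable_set_lebesgue_integral[OF djoint]) simp
    have nndb: "(\<lambda>\<omega>. \<integral>\<^sup>+u\<in>{s..t}. ennreal ((norm (drift L u \<omega> - drift L s \<omega>))\<^sup>2) \<partial>lborel) \<in> borel_measurable M"
      using djoint by (intro borel_measurable_set_nn_integral) (auto simp: split_beta')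
    then have Db_meas[measurable]: "Db \<in> borel_measurable M" unfolding Db_def by measurable
    have \<epsilon>_meas[measurable]: "\<epsilon> \<in> borel_measurable M" unfolding \<epsilon>_def by measurable
    have inA: "inside m (X s \<omega>) (Y s \<omega>)" "\<omega> \<in> space M" if "\<omega> \<in> ?A" for \<omega>
      using that st by (auto simp: stay_def)
    have \<rho>: "\<delta> \<le> ?\<rho> \<omega>" "?\<rho> \<omega> \<le> R" "0 < ?\<rho> \<omega>" "Z s \<omega> \<noteq> 0" if "\<omega> \<in> ?A" for \<omega>
      using \<delta>(2)[OF inA(1)[OF that]] \<delta>(1) inside_nonzero[OF inA(1)[OF that]] by auto
    have y: "l * \<delta> \<le> norm (?y \<omega>)" "0 < norm (?y \<omega>)" if "\<omega> \<in> ?A" for \<omega>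
    proof -
      have "l * \<delta> \<le> l * ?\<rho> \<omega>" using \<rho>[OF that] l by (intro mult_left_mono) auto
      also have "\<dots> \<le> norm (?y \<omega>)" by (rule l)
      finally show "l * \<delta> \<le> norm (?y \<omega>)" .
      moreover have "0 < l * \<delta>" using l \<delta> by simp
      ultimately show "0 < norm (?y \<omega>)" by linarith
    qed
    have \<zeta>_norm: "(norm (\<zeta> \<omega>))\<^sup>2 = 4 / (norm (?y \<omega>))\<^sup>2" if "\<omega> \<in> ?A" for \<omega>
      using that y(2)[OF that] by (simp add: \<zeta>_def power_divide power2_eq_square)
    have \<zeta>_bd: "norm (\<zeta> \<omega>) \<le> C\<zeta>" for \<omega>
    proof (cases "\<omega> \<in> ?A")
      case True
      have "norm (\<zeta> \<omega>) = 2 / norm (?y \<omega>)" using True y(2)[OF True] by (simp add: \<zeta>_def power2_eq_square)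
      also have "\<dots> \<le> C\<zeta>" unfolding C\<zeta>_def using y[OF True] l \<delta> by (intro divide_left_mono) auto
      finally show ?thesis .
    qed (use C\<zeta>0 in \<open>simp add: \<zeta>_def\<close>)
    have w_bd: "norm (w \<omega>) \<le> W * ?i \<omega>" for \<omega>
    proof (cases "\<omega> \<in> ?A")
      case True
      have "norm (Z s \<omega>) \<le> 2 * m"
        using inA(1)[OF True] norm_triangle_ineq4[of "X s \<omega>" "Y s \<omega>"] by (auto simp: inside_def)
      then have "norm (G *v Z s \<omega>) \<le> norm G * (2 * m)"
        by (intro order_trans[OF norm_matrix_vector_mult_le] mult_left_mono) auto
      moreover have "\<bar>fp (?\<rho> \<omega>) / ?\<rho> \<omega>\<bar> \<le> 1 / \<delta>"
        using fp[OF \<rho>(1,2)[OF True]] \<rho>[OF True] \<delta>(1) by (auto intro!: frac_le)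
      ultimately have "\<bar>fp (?\<rho> \<omega>) / ?\<rho> \<omega>\<bar> * norm (G *v Z s \<omega>) \<le> 1 / \<delta> * (norm G * (2 * m))"
        using \<delta> by (intro mult_mono) auto
      then show ?thesis using True by (simp add: w_def W_def)
    qed (simp add: w_def)
    have w_bd': "norm (w \<omega>) \<le> W" for \<omega> using w_bd[of \<omega>] W0 by (auto split: split_indicator_asm)
    have q_bd: "\<bar>q \<omega>\<bar> \<le> H0 / 2 * R\<^sup>2" if "\<omega> \<in> space M" for \<omega>
    proof (cases "\<omega> \<in> ?A")
      case True
      then have "\<bar>q \<omega>\<bar> = \<bar>h (?\<rho> \<omega>)\<bar> / 2 * (?\<rho> \<omega>)\<^sup>2" by (simp add: q_def abs_mult)
      also have "\<dots> \<le> H0 / 2 * R\<^sup>2"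
        using h[OF \<rho>(1,2)[OF True]] \<rho>[OF True] by (intro mult_mono power_mono) auto
      finally show ?thesis .
    qed (use h_nonneg in \<open>simp add: q_def\<close>)
    have J_bd: "norm (J \<omega>) \<le> L * (t - s)" if "\<omega> \<in> space M" for \<omega>
      unfolding J_def
      using continuous_on_subset[OF drift_cont[OF L(1) that], of "{s..t}"] st drift_bound[OF L(1)]
      by (intro set_integral_norm_le_const) auto
    have w\<beta>: "w \<omega> \<bullet> J \<omega> \<le> (t - s) * (w \<omega> \<bullet> drift L s \<omega>) + \<theta>1 * (t - s) + W\<^sup>2 / (4 * \<theta>1) * (?i \<omega> * Db \<omega>)" if "\<omega> \<in> space M" for \<omega>
    proof -
      have "w \<omega> \<bullet> J \<omega> \<le> (t - s) * (w \<omega> \<bullet> drift L s \<omega>) + \<theta>1 * (t - s) + (norm (w \<omega>))\<^sup>2 / (4 * \<theta>1) * Db \<omega>"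
        unfolding J_def Db_def
        using continuous_on_subset[OF drift_cont[OF L(1) that], of "{s..t}"] st
        by (intro inner_set_integral_le \<theta>1) auto
      moreover have "(norm (w \<omega>))\<^sup>2 / (4 * \<theta>1) * Db \<omega> \<le> W\<^sup>2 / (4 * \<theta>1) * (?i \<omega> * Db \<omega>)"
      proof -
        have "(norm (w \<omega>))\<^sup>2 \<le> (W * ?i \<omega>)\<^sup>2" using w_bd[of \<omega>] by (intro power_mono) auto
        also have "\<dots> = W\<^sup>2 * ?i \<omega>" by (auto split: split_indicator)
        finally have "(norm (w \<omega>))\<^sup>2 / (4 * \<theta>1) * Db \<omega> \<le> W\<^sup>2 * ?i \<omega> / (4 * \<theta>1) * Db \<omega>"
          using \<theta>1 by (intro mult_right_mono divide_right_mono) (auto simp: Db_def)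
        then show ?thesis by simp
      qed
      ultimately show ?thesis by linarith
    qed
    \<comment> \<open>The right side of the expansion with the drift frozen and the bound for the
      squared remainder inserted, so that the mean of each summand can be computed or
      estimated.\<close>
    define RHS where "RHS = (\<lambda>\<omega>. ?i \<omega> * f (?\<rho> \<omega>) + (w \<omega> v* \<sigma>) \<bullet> ?D \<omega> - w \<omega> \<bullet> (I t \<omega> - I s \<omega>)
        + ((t - s) * (w \<omega> \<bullet> drift L s \<omega>) + \<theta>1 * (t - s) + W\<^sup>2 / (4 * \<theta>1) * (?i \<omega> * Db \<omega>))
        + q \<omega> * (\<zeta> \<omega> \<bullet> ?D \<omega>)\<^sup>2 + \<theta>1 * (1 * (\<zeta> \<omega> \<bullet> ?D \<omega>)\<^sup>2) + K * (\<zeta> \<omega> \<bullet> ?D \<omega>) ^ 4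
        + K * (2 * u\<^sup>2 * (L\<^sup>2 * (t - s)\<^sup>2 + ?i \<omega> * (norm (\<epsilon> \<omega>))\<^sup>2)))"
    have increment: "AE \<omega> in M. \<omega> \<in> stay m t \<longrightarrow>
        Z t \<omega> = Z s \<omega> + (LBINT u:{s..t}. drift L u \<omega>) + \<sigma> *v (B t \<omega> - B s \<omega>) - (I t \<omega> - I s \<omega>)"
      by (rule increment_identity[OF st L])
    have pointwise: "AE \<omega> in M. indicator (stay m t) \<omega> * f (Gnorm G (Z t \<omega>)) \<le> RHS \<omega>"
      using increment AE_space
    proof eventually_elim
      case (elim \<omega>)
      show ?case
      proof (cases "\<omega> \<in> ?A")
        \<comment> \<open>Outside \<open>stay m s\<close> all random coefficients carry a vanishing
          indicator, and the constants that are left are nonnegative.\<close>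
        case False
        then have "\<omega> \<notin> stay m t" using stay_antimono[OF st(2), of m] by auto
        moreover have "0 \<le> RHS \<omega>"
          unfolding RHS_def using False st \<theta>1 K(1) by (simp add: w_def q_def \<zeta>_def)
        ultimately show ?thesis by simp
      next
        case A: True
        define a where "a = \<zeta> \<omega> \<bullet> ?D \<omega>"
        define e where "e = J \<omega> - \<epsilon> \<omega>"
        define z where "z = Z s \<omega>"
        have z: "z \<noteq> 0" using \<rho>(4)[OF A] by (simp add: z_def)
        have noise: "\<sigma> *v ?D \<omega> - H s \<omega> *v ?D \<omega> = a *\<^sub>R z"
        proof -
          have "ereal s < coupling_time X Y \<omega>" using stay_before_coupling[OF A] st by simp
          then have "H s \<omega> = \<sigma> ** reflection_mat (reflection_dir \<sigma> z)" by (simp add: H_def z_def)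
          then show ?thesis using reflection_noise[OF z, of "?D \<omega>"] A by (simp add: a_def \<zeta>_def z_def)
        qed
        \<comment> \<open>The argument is the vector reached with the cut drift. It is the true
          \<open>Z t\<close> on \<open>stay m t\<close>, but the expansion is valid on all of
          \<open>stay m s\<close>, where f r' \<ge> 0 yields the nonnegativity of \<open>RHS\<close>
          for paths that have left.\<close>
        define r' where "r' = Gnorm G ((1 + a) *\<^sub>R z + e)"
        define p where "p = z \<bullet> (G *v e) / Gnorm G z"
        have "f r' \<le> f (Gnorm G z) + fp (Gnorm G z) * (Gnorm G z * a + p) + h (Gnorm G z) / 2 * (Gnorm G z * a)\<^sup>2 + \<theta>1 * a\<^sup>2 + K * (a ^ 4 + (Gnorm G e)\<^sup>2)"
        proof (rule K(2))
          show "\<delta> \<le> Gnorm G z" "Gnorm G z \<le> R" using \<rho>[OF A] by (auto simp: z_def)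
          show "0 \<le> r'" by (simp add: r'_def Gnorm_nonneg)
          show "\<bar>p\<bar> \<le> Gnorm G e" unfolding p_def by (rule radial_coefficient_bound)
          show "r'\<^sup>2 = ((1 + a) * Gnorm G z)\<^sup>2 + 2 * ((1 + a) * Gnorm G z) * p + (Gnorm G e)\<^sup>2"
            unfolding r'_def p_def by (rule Gnorm_radial_expansion[OF z])
        qed
        also have "fp (Gnorm G z) * (Gnorm G z * a + p) = (w \<omega> v* \<sigma>) \<bullet> ?D \<omega> - w \<omega> \<bullet> (I t \<omega> - I s \<omega>) + w \<omega> \<bullet> J \<omega>"
        proof -
          have g: "0 < Gnorm G z" by (rule Gnorm_pos[OF z])
          \<comment> \<open>Since \<open>w\<close> represents the derivative of the distance and a z
            + e is the whole increment, the Ito increment appears undivided in the linear term and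
            has mean zero.\<close>
          have wv: "w \<omega> \<bullet> v = fp (Gnorm G z) / Gnorm G z * (z \<bullet> (G *v v))" for v
          proof -
            have "(G *v z) \<bullet> v = z \<bullet> (G *v v)" using inner_G_commute[of z v] by (simp add: inner_commute)
            then show ?thesis using A by (simp add: w_def z_def)
          qed
          have "Gnorm G z * a + p = (z \<bullet> (G *v (a *\<^sub>R z + e))) / Gnorm G z"
            using g Gnorm_sq[of z] by (simp add: p_def matrix_vector_right_distrib matrix_vector_mult_scaleR inner_add_right field_simps power2_eq_square)
          then have "fp (Gnorm G z) * (Gnorm G z * a + p) = w \<omega> \<bullet> (a *\<^sub>R z + e)" by (simp add: wv)
          also have "a *\<^sub>R z + e = \<sigma> *v ?D \<omega> - (I t \<omega> - I s \<omega>) + J \<omega>"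
            unfolding noise[symmetric] e_def \<epsilon>_def by simp
          finally show ?thesis unfolding dot_lmul_matrix inner_add_right inner_diff_right[of _ "\<sigma> *v ?D \<omega>"] .
        qed
        also have "h (Gnorm G z) / 2 * (Gnorm G z * a)\<^sup>2 = q \<omega> * (\<zeta> \<omega> \<bullet> ?D \<omega>)\<^sup>2"
          using A by (simp add: q_def a_def z_def power_mult_distrib)
        finally have 1: "f r' \<le> f (Gnorm G z) + ((w \<omega> v* \<sigma>) \<bullet> ?D \<omega> - w \<omega> \<bullet> (I t \<omega> - I s \<omega>) + w \<omega> \<bullet> J \<omega>)
           + q \<omega> * (\<zeta> \<omega> \<bullet> ?D \<omega>)\<^sup>2 + \<theta>1 * a\<^sup>2 + K * (a ^ 4 + (Gnorm G e)\<^sup>2)" .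
        have N: "(Gnorm G e)\<^sup>2 \<le> 2 * u\<^sup>2 * (L\<^sup>2 * (t - s)\<^sup>2 + (norm (\<epsilon> \<omega>))\<^sup>2)"
        proof -
          have "(Gnorm G e)\<^sup>2 \<le> (u * norm e)\<^sup>2" using u(4)[of e] Gnorm_nonneg[of e] by (intro power_mono) auto
          also have "\<dots> = u\<^sup>2 * (norm (J \<omega> - \<epsilon> \<omega>))\<^sup>2" by (simp add: e_def power_mult_distrib)
          also have "\<dots> \<le> u\<^sup>2 * (2 * (norm (0 - \<epsilon> \<omega>))\<^sup>2 + 2 * (norm (J \<omega> - 0))\<^sup>2)"
            by (intro mult_left_mono norm_diff_sq_le) auto
          also have "\<dots> \<le> u\<^sup>2 * (2 * (norm (0 - \<epsilon> \<omega>))\<^sup>2 + 2 * (L * (t - s))\<^sup>2)"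
            using J_bd[OF elim(2)] by (intro mult_left_mono add_left_mono power_mono) auto
          finally show ?thesis by (simp add: power_mult_distrib distrib_left mult_ac add.commute)
        qed
        have "f r' \<le> RHS \<omega>"
          using 1 w\<beta>[OF elim(2)] mult_left_mono[OF N K(1)] A
          unfolding RHS_def a_def[symmetric] z_def[symmetric] by (simp add: algebra_simps)
        moreover have "Z t \<omega> = (1 + a) *\<^sub>R z + e" if "\<omega> \<in> stay m t"
        proof -
          have "Z t \<omega> = z + J \<omega> + \<sigma> *v ?D \<omega> - (I t \<omega> - I s \<omega>)" using elim(1) that by (simp add: J_def z_def)
          also have "\<sigma> *v ?D \<omega> = a *\<^sub>R z + H s \<omega> *v ?D \<omega>" using noise by (simp add: algebra_simps)
          finally show ?thesis by (simp add: e_def \<epsilon>_def algebra_simps)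
        qed
        moreover have "0 \<le> f r'" using f Gnorm_nonneg by (simp add: r'_def)
        ultimately show ?thesis by (auto simp: r'_def split: split_indicator)
      qed
    qed
    have iA: "integrable M (\<lambda>\<omega>. ?i \<omega> * f (?\<rho> \<omega>))"
    proof (rule integrable_const_bound[of _ "\<bar>F0\<bar>"])
      have "norm (?i \<omega> * f (?\<rho> \<omega>)) \<le> \<bar>F0\<bar>" for \<omega>
      proof (cases "\<omega> \<in> ?A")
        case True
        show ?thesis using fF[OF \<rho>(1,2)[OF True]] f[OF Gnorm_nonneg, of "Z s \<omega>"] True by simp
      qed simp
      then show "AE \<omega> in M. norm (?i \<omega> * f (?\<rho> \<omega>)) \<le> \<bar>F0\<bar>" by simp
    qed measurable
    have w\<sigma>: "has_bochner_integral M (\<lambda>\<omega>. (w \<omega> v* \<sigma>) \<bullet> ?D \<omega>) 0"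
    proof (rule increment_inner_mean[OF st])
      show "(\<lambda>\<omega>. w \<omega> v* \<sigma>) \<in> borel_measurable (F s)" by measurable
      show "integrable M (\<lambda>\<omega>. w \<omega> v* \<sigma>)"
      proof (rule integrable_const_bound[of _ "W * norm \<sigma>"])
        show "AE \<omega> in M. norm (w \<omega> v* \<sigma>) \<le> W * norm \<sigma>"
          by (intro AE_I2 order_trans[OF norm_vector_matrix_mult_le] mult_right_mono w_bd') simp
      qed measurable
    qed
    have wI: "has_bochner_integral M (\<lambda>\<omega>. w \<omega> \<bullet> (I t \<omega> - I s \<omega>)) 0"
      by (rule ito_increment_mean[OF ito_H st C(2) w_F w_bd'])
    have iw: "integrable M (\<lambda>\<omega>. w \<omega> \<bullet> drift L s \<omega>)"
    proof (rule integrable_const_bound[of _ "W * L"])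
      show "AE \<omega> in M. norm (w \<omega> \<bullet> drift L s \<omega>) \<le> W * L"
        using W0 by (intro AE_I2) (simp, intro order_trans[OF Cauchy_Schwarz_ineq2] mult_mono w_bd' drift_bound L(1) norm_ge_zero)
    qed measurable
    note err = err_parts[OF st L(1), of m]
    have Db_eq: "ennreal (Db \<omega>) = (\<integral>\<^sup>+u\<in>{s..t}. ennreal ((norm (drift L u \<omega> - drift L s \<omega>))\<^sup>2) \<partial>lborel)" for \<omega>
    proof -
      have "(\<integral>\<^sup>+u\<in>{s..t}. ennreal ((norm (drift L u \<omega> - drift L s \<omega>))\<^sup>2) \<partial>lborel) \<le> (\<integral>\<^sup>+u\<in>{s..t}. ennreal (4 * L\<^sup>2) \<partial>lborel)"
        by (intro nn_integral_mono mult_right_mono ennreal_leI norm_diff_sq_bound drift_bound L) auto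
      also have "\<dots> < \<top>" using st by (simp add: nn_integral_cmult_indicator ennreal_mult_less_top)
      finally show ?thesis unfolding Db_def by simp
    qed
    have Db: "integrable M (\<lambda>\<omega>. ?i \<omega> * Db \<omega>)" "expectation (\<lambda>\<omega>. ?i \<omega> * Db \<omega>) \<le> enn2real (err L m s t)"
    proof -
      have m: "(\<lambda>\<omega>. ?i \<omega> * Db \<omega>) \<in> borel_measurable M" by measurable
      have "(\<integral>\<^sup>+\<omega>. ennreal (?i \<omega> * Db \<omega>) \<partial>M)
        = (\<integral>\<^sup>+\<omega>\<in>?A. (\<integral>\<^sup>+u\<in>{s..t}. ennreal ((norm (drift L u \<omega> - drift L s \<omega>))\<^sup>2) \<partial>lborel) \<partial>M)"
        unfolding Db_eq[symmetric] by (intro nn_integral_cong) (auto split: split_indicator)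
      then have le: "(\<integral>\<^sup>+\<omega>. ennreal (?i \<omega> * Db \<omega>) \<partial>M) \<le> err L m s t" using err(3) by simp
      show "integrable M (\<lambda>\<omega>. ?i \<omega> * Db \<omega>)" "expectation (\<lambda>\<omega>. ?i \<omega> * Db \<omega>) \<le> enn2real (err L m s t)"
        by (rule integral_le_of_nn_integral[OF m _ le err(1)]; simp add: Db_def)+
    qed
    have Eps: "integrable M (\<lambda>\<omega>. ?i \<omega> * (norm (\<epsilon> \<omega>))\<^sup>2)" "expectation (\<lambda>\<omega>. ?i \<omega> * (norm (\<epsilon> \<omega>))\<^sup>2) \<le> 2 * enn2real (err L m s t)"
    proof -
      have m: "(\<lambda>\<omega>. ?i \<omega> * (norm (\<epsilon> \<omega>))\<^sup>2) \<in> borel_measurable M" by measurable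
      have "(\<integral>\<^sup>+\<omega>. ennreal (?i \<omega> * (norm (\<epsilon> \<omega>))\<^sup>2) \<partial>M) = (\<integral>\<^sup>+\<omega>\<in>?A. ennreal ((norm (\<epsilon> \<omega>))\<^sup>2) \<partial>M)"
        by (intro nn_integral_cong) (auto split: split_indicator)
      also have "\<dots> \<le> 2 * (\<integral>\<^sup>+\<omega>\<in>?A. (\<integral>\<^sup>+u\<in>{s..t}. ennreal ((norm (H u \<omega> - H s \<omega>))\<^sup>2) \<partial>lborel) \<partial>M)"
        unfolding \<epsilon>_def by (rule ito_increment_L2[OF ito_H st C(2) _ C(2) A_F]) (rule H_F[OF st(1)])
      also have "\<dots> \<le> 2 * err L m s t" by (intro mult_left_mono err(2)) simp
      finally have le: "(\<integral>\<^sup>+\<omega>. ennreal (?i \<omega> * (norm (\<epsilon> \<omega>))\<^sup>2) \<partial>M) \<le> 2 * err L m s t" .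
      have fin: "2 * err L m s t < \<top>" using err(1) by (simp add: ennreal_mult_less_top)
      have e2: "enn2real (2 * err L m s t) = 2 * enn2real (err L m s t)" by (simp add: enn2real_mult)
      show "integrable M (\<lambda>\<omega>. ?i \<omega> * (norm (\<epsilon> \<omega>))\<^sup>2)" "expectation (\<lambda>\<omega>. ?i \<omega> * (norm (\<epsilon> \<omega>))\<^sup>2) \<le> 2 * enn2real (err L m s t)"
        unfolding e2[symmetric] by (rule integral_le_of_nn_integral[OF m _ le fin]; simp)+
    qed
    have sq1: "has_bochner_integral M (\<lambda>\<omega>. q \<omega> * (\<zeta> \<omega> \<bullet> ?D \<omega>)\<^sup>2) ((t - s) * expectation (\<lambda>\<omega>. q \<omega> * (norm (\<zeta> \<omega>))\<^sup>2))"
      by (rule increment_inner_square[OF st \<zeta>_F \<zeta>_bd q_F q_bd])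
    have sq2: "has_bochner_integral M (\<lambda>\<omega>. 1 * (\<zeta> \<omega> \<bullet> ?D \<omega>)\<^sup>2) ((t - s) * expectation (\<lambda>\<omega>. 1 * (norm (\<zeta> \<omega>))\<^sup>2))"
      by (rule increment_inner_square[OF st \<zeta>_F \<zeta>_bd, of "\<lambda>_. 1" 1]) auto
    note m4 = increment_inner_moment4[OF st \<zeta>_F \<zeta>_bd]
    have const: "has_bochner_integral M (\<lambda>_. x) x" for x :: real
      by (simp add: has_bochner_integral_iff prob_space)
    let ?E = "expectation"
    have hR: "has_bochner_integral M RHS (?E (\<lambda>\<omega>. ?i \<omega> * f (?\<rho> \<omega>)) + 0 - 0
        + ((t - s) * ?E (\<lambda>\<omega>. w \<omega> \<bullet> drift L s \<omega>) + \<theta>1 * (t - s) + W\<^sup>2 / (4 * \<theta>1) * ?E (\<lambda>\<omega>. ?i \<omega> * Db \<omega>))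
        + (t - s) * ?E (\<lambda>\<omega>. q \<omega> * (norm (\<zeta> \<omega>))\<^sup>2) + \<theta>1 * ((t - s) * ?E (\<lambda>\<omega>. 1 * (norm (\<zeta> \<omega>))\<^sup>2))
        + K * ?E (\<lambda>\<omega>. (\<zeta> \<omega> \<bullet> ?D \<omega>) ^ 4)
        + K * (2 * u\<^sup>2 * (L\<^sup>2 * (t - s)\<^sup>2 + ?E (\<lambda>\<omega>. ?i \<omega> * (norm (\<epsilon> \<omega>))\<^sup>2))))"
      unfolding RHS_def
      by (intro has_bochner_integral_add has_bochner_integral_diff has_bochner_integral_mult_right w\<sigma> wI sq1 sq2 const
          has_bochner_integral_integrable iA iw Db(1) Eps(1) m4(1))
    have i\<zeta>: "integrable M (\<lambda>\<omega>. q \<omega> * (norm (\<zeta> \<omega>))\<^sup>2)"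
    proof (rule integrable_const_bound[of _ "H0 / 2 * R\<^sup>2 * C\<zeta>\<^sup>2"])
      have "\<bar>q \<omega>\<bar> * (norm (\<zeta> \<omega>))\<^sup>2 \<le> H0 / 2 * R\<^sup>2 * C\<zeta>\<^sup>2" if "\<omega> \<in> space M" for \<omega>
        using q_bd[OF that] \<zeta>_bd h_nonneg by (intro mult_mono power_mono) auto
      then show "AE \<omega> in M. norm (q \<omega> * (norm (\<zeta> \<omega>))\<^sup>2) \<le> H0 / 2 * R\<^sup>2 * C\<zeta>\<^sup>2"
        by (intro AE_I2) (simp add: abs_mult)
    qed measurable
    \<comment> \<open>The drift and the second order term can only be estimated together. On
      \<open>stay m s\<close> the identity |\<zeta>|^2 = 4/|\<sigma>^{-1} Z s|^2 brings the latter
      into the form that \<open>gen\<close> has.\<close>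
    have "?E (\<lambda>\<omega>. w \<omega> \<bullet> drift L s \<omega>) + ?E (\<lambda>\<omega>. q \<omega> * (norm (\<zeta> \<omega>))\<^sup>2) = ?E (\<lambda>\<omega>. w \<omega> \<bullet> drift L s \<omega> + q \<omega> * (norm (\<zeta> \<omega>))\<^sup>2)"
      by (rule Bochner_Integration.integral_add[symmetric, OF iw i\<zeta>])
    also have "\<dots> \<le> ?E (\<lambda>\<omega>. - c * (?i \<omega> * f (?\<rho> \<omega>)))"
    proof (rule integral_mono)
      show "integrable M (\<lambda>\<omega>. w \<omega> \<bullet> drift L s \<omega> + q \<omega> * (norm (\<zeta> \<omega>))\<^sup>2)" using iw i\<zeta> by simp
      show "integrable M (\<lambda>\<omega>. - c * (?i \<omega> * f (?\<rho> \<omega>)))" using iA by (rule integrable_mult_right)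
      fix \<omega>
      show "w \<omega> \<bullet> drift L s \<omega> + q \<omega> * (norm (\<zeta> \<omega>))\<^sup>2 \<le> - c * (?i \<omega> * f (?\<rho> \<omega>))"
      proof (cases "\<omega> \<in> ?A")
        case A: True
        have d: "drift L s \<omega> = b (X s \<omega>) - b (Y s \<omega>)" by (rule drift_eq[OF L A]) (use st in auto)
        have "(G *v Z s \<omega>) \<bullet> v = Z s \<omega> \<bullet> (G *v v)" for v using inner_G_commute[of "Z s \<omega>" v] by (simp add: inner_commute)
        then have "w \<omega> \<bullet> drift L s \<omega> = fp (?\<rho> \<omega>) / ?\<rho> \<omega> * (Z s \<omega> \<bullet> (G *v (b (X s \<omega>) - b (Y s \<omega>))))"
          using A by (simp add: w_def d)
        moreover have "q \<omega> * (norm (\<zeta> \<omega>))\<^sup>2 = 2 * h (?\<rho> \<omega>) * (?\<rho> \<omega>)\<^sup>2 / (norm (?y \<omega>))\<^sup>2"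
          using A by (simp add: q_def \<zeta>_norm)
        ultimately show ?thesis using gen[OF inA(1)[OF A]] A by simp
      qed (simp add: w_def q_def)
    qed
    also have "\<dots> = - c * ?E (\<lambda>\<omega>. ?i \<omega> * f (?\<rho> \<omega>))" by simp
    finally have "(t - s) * (?E (\<lambda>\<omega>. w \<omega> \<bullet> drift L s \<omega>) + ?E (\<lambda>\<omega>. q \<omega> * (norm (\<zeta> \<omega>))\<^sup>2))
        \<le> (t - s) * (- c * ?E (\<lambda>\<omega>. ?i \<omega> * f (?\<rho> \<omega>)))"
      using st by (intro mult_left_mono) auto
    then have b1: "(t - s) * ?E (\<lambda>\<omega>. w \<omega> \<bullet> drift L s \<omega>) + (t - s) * ?E (\<lambda>\<omega>. q \<omega> * (norm (\<zeta> \<omega>))\<^sup>2)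
        \<le> - (c * (t - s) * ?E (\<lambda>\<omega>. ?i \<omega> * f (?\<rho> \<omega>)))"
      by (simp add: algebra_simps)
    have "?E (\<lambda>\<omega>. 1 * (norm (\<zeta> \<omega>))\<^sup>2) \<le> C\<zeta>\<^sup>2"
    proof -
      have i: "integrable M (\<lambda>\<omega>. 1 * (norm (\<zeta> \<omega>))\<^sup>2)"
        by (rule integrable_const_bound[of _ "C\<zeta>\<^sup>2"]) (use \<zeta>_bd in \<open>auto intro!: AE_I2 power_mono\<close>)
      have "?E (\<lambda>\<omega>. 1 * (norm (\<zeta> \<omega>))\<^sup>2) \<le> ?E (\<lambda>\<omega>. C\<zeta>\<^sup>2)"
        by (rule integral_mono[OF i]) (use \<zeta>_bd in \<open>auto intro!: power_mono\<close>)
      then show ?thesis by (simp add: prob_space)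
    qed
    then have b2: "\<theta>1 * ((t - s) * ?E (\<lambda>\<omega>. 1 * (norm (\<zeta> \<omega>))\<^sup>2)) \<le> \<theta>1 * ((t - s) * C\<zeta>\<^sup>2)"
      using \<theta>1 st by (intro mult_left_mono) auto
    have b3: "W\<^sup>2 / (4 * \<theta>1) * ?E (\<lambda>\<omega>. ?i \<omega> * Db \<omega>) \<le> W\<^sup>2 / (4 * \<theta>1) * enn2real (err L m s t)"
      using \<theta>1 by (intro mult_left_mono Db(2)) auto
    have b4: "K * ?E (\<lambda>\<omega>. (\<zeta> \<omega> \<bullet> ?D \<omega>) ^ 4) \<le> K * (C\<zeta> ^ 4 * (3 * (real CARD('d))\<^sup>2 * (t - s)\<^sup>2))"
      by (intro mult_left_mono m4(2) K(1))
    have b5: "K * (2 * u\<^sup>2 * (L\<^sup>2 * (t - s)\<^sup>2 + ?E (\<lambda>\<omega>. ?i \<omega> * (norm (\<epsilon> \<omega>))\<^sup>2)))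
        \<le> K * (2 * u\<^sup>2 * (L\<^sup>2 * (t - s)\<^sup>2 + 2 * enn2real (err L m s t)))"
      by (intro mult_left_mono add_left_mono Eps(2) K(1)) simp
    have "?E (\<lambda>\<omega>. indicator (stay m t) \<omega> * f (Gnorm G (Z t \<omega>))) \<le> ?E RHS"
    \<comment> \<open>Integrability of the left side has not been established; a nonnegative
      integrable upper bound suffices for this comparison.\<close>
    proof (rule integral_mono_AE')
      show "integrable M RHS" using hR by (rule integrable.intros)
      show "AE \<omega> in M. indicator (stay m t) \<omega> * f (Gnorm G (Z t \<omega>)) \<le> RHS \<omega>" by (rule pointwise)
      have "0 \<le> indicat_real (stay m t) \<omega> * f (Gnorm G (Z t \<omega>))" for \<omega>
        using f[OF Gnorm_nonneg, of "Z t \<omega>"] by simp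
      note nn = this
      show "AE \<omega> in M. 0 \<le> RHS \<omega>" using pointwise by eventually_elim (rule order_trans[OF nn])
    qed
    also have "?E RHS \<le> ?E (\<lambda>\<omega>. ?i \<omega> * f (?\<rho> \<omega>)) - c * (t - s) * ?E (\<lambda>\<omega>. ?i \<omega> * f (?\<rho> \<omega>))
        + (\<theta>1 * (t - s) + \<theta>1 * ((t - s) * C\<zeta>\<^sup>2)) + W\<^sup>2 / (4 * \<theta>1) * enn2real (err L m s t)
        + K * (C\<zeta> ^ 4 * (3 * (real CARD('d))\<^sup>2 * (t - s)\<^sup>2))
        + K * (2 * u\<^sup>2 * (L\<^sup>2 * (t - s)\<^sup>2 + 2 * enn2real (err L m s t)))"
      unfolding has_bochner_integral_integral_eq[OF hR] using b1 b2 b3 b4 b5 by linarith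
    also have "\<theta>1 * (t - s) + \<theta>1 * ((t - s) * C\<zeta>\<^sup>2) = (\<theta>1 + \<theta>1 * C\<zeta>\<^sup>2) * (t - s)" by (simp add: algebra_simps)
    also have "\<dots> = \<theta> * (t - s)" by (simp add: \<theta>1_eq)
    finally show ?thesis by (simp add: K1_def K2_def algebra_simps)
  qed
  show ?thesis
  proof (intro exI conjI allI impI)
    show "0 \<le> max K1 K2" using K12 by simp
    fix s t :: real assume st: "0 \<le> s" "s \<le> t"
    have "K2 * (t - s)\<^sup>2 + K1 * enn2real (err L m s t) \<le> max K1 K2 * (t - s)\<^sup>2 + max K1 K2 * enn2real (err L m s t)"
      by (intro add_mono mult_right_mono) auto
    then show "expectation (\<lambda>\<omega>. indicator (stay m t) \<omega> * f (Gnorm G (Z t \<omega>)))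
      \<le> (1 - c * (t - s)) * expectation (\<lambda>\<omega>. indicator (stay m s) \<omega> * f (Gnorm G (Z s \<omega>)))
      + \<theta> * (t - s) + max K1 K2 * ((t - s)\<^sup>2 + enn2real (err L m s t))"
      using main[OF st] by (simp add: algebra_simps)
  qed
qed

end

section \<open>Passing to the limit along grids\<close>

lemma ennreal_tendsto_0I:
  fixes x :: "nat \<Rightarrow> ennreal"
  assumes "\<And>e. 0 < e \<Longrightarrow> eventually (\<lambda>n. x n \<le> ennreal e) sequentially"
  shows "x \<longlonglongrightarrow> 0"
proof (rule order_tendstoI)
  fix y :: ennreal assume "0 < y"
  obtain e where e: "0 < e" "ennreal e < y"
  proof (cases y)
    case (real r)
    then show ?thesis using \<open>0 < y\<close> by (intro that[of "r/2"]) (auto simp: ennreal_less_iff)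
  qed (auto intro: that[of 1])
  show "eventually (\<lambda>n. x n < y) sequentially"
    using assms[OF e(1)] by eventually_elim (rule le_less_trans[OF _ e(2)])
qed simp

text \<open>Since \<open>r \<le> 1\<close>, errors made in earlier steps are not amplified and
  simply add up.\<close>

lemma discrete_gronwall:
  fixes U :: "nat \<Rightarrow> real"
  assumes step: "\<And>i. i < n \<Longrightarrow> U (Suc i) \<le> r * U i + e i" and r: "0 \<le> r" "r \<le> 1" and e: "\<And>i. i < n \<Longrightarrow> 0 \<le> e i"
  shows "U n \<le> r ^ n * U 0 + (\<Sum>i<n. e i)"
proof -
  have "k \<le> n \<Longrightarrow> U k \<le> r ^ k * U 0 + (\<Sum>i<k. e i)" for k
  proof (induction k)
    case (Suc k)
    have "U (Suc k) \<le> r * U k + e k" using step Suc.prems by simp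
    also have "r * U k \<le> r * (r ^ k * U 0 + (\<Sum>i<k. e i))" using Suc r by (intro mult_left_mono) auto
    also have "\<dots> = r ^ Suc k * U 0 + r * (\<Sum>i<k. e i)" by (simp add: algebra_simps)
    also have "r * (\<Sum>i<k. e i) \<le> 1 * (\<Sum>i<k. e i)" using r e Suc.prems by (intro mult_right_mono sum_nonneg) auto
    finally show ?case by simp
  qed simp
  then show ?thesis by simp
qed

context reflection_pair
begin

definition err_path :: "real \<Rightarrow> real \<Rightarrow> real \<Rightarrow> real \<Rightarrow> 'w \<Rightarrow> ennreal" where
  "err_path L m s t \<omega> = (\<integral>\<^sup>+u\<in>{s..t}. (ennreal ((norm (H u \<omega> - H s \<omega>))\<^sup>2)
     + ennreal ((norm (drift L u \<omega> - drift L s \<omega>))\<^sup>2)) \<partial>lborel) * indicator (stay m s) \<omega>"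

lemma err_path_measurable:
  assumes st: "0 \<le> s" "s \<le> t" and L: "0 < L"
  shows "err_path L m s t \<in> borel_measurable M"
proof -
  have [measurable]: "stay m s \<in> sets M" using stay_sets[OF st(1)] by (rule sets_F_M)
  have [measurable]: "H s \<in> borel_measurable M" "drift L s \<in> borel_measurable M"
    by (fact measurable_F_M[OF H_F[OF st(1)]] measurable_F_M[OF drift_F[OF L st(1)]])+
  have "(\<lambda>(u, \<omega>). drift L u \<omega>) \<in> borel_measurable (restrict_space borel {s..t} \<Otimes>\<^sub>M M)"
    using drift_joint[OF L, of t] st by (intro joint_measurable_subset[of _ "{0..t}" _ _ "{s..t}"]) auto
  then have "(\<lambda>\<omega>. \<integral>\<^sup>+u\<in>{s..t}. (ennreal ((norm (H u \<omega> - H s \<omega>))\<^sup>2)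
     + ennreal ((norm (drift L u \<omega> - drift L s \<omega>))\<^sup>2)) \<partial>lborel) \<in> borel_measurable M"
    using H_joint[OF st] by (intro borel_measurable_set_nn_integral) (auto simp: split_beta')
  then show ?thesis unfolding err_path_def by measurable
qed

lemma err_path_le:
  assumes st: "s \<le> t" and K: "\<And>u. \<omega> \<in> stay m s \<Longrightarrow> u \<in> {s..t} \<Longrightarrow> (norm (H u \<omega> - H s \<omega>))\<^sup>2 + (norm (drift L u \<omega> - drift L s \<omega>))\<^sup>2 \<le> K"
    and K0: "0 \<le> K"
  shows "err_path L m s t \<omega> \<le> ennreal (K * (t - s))"
proof (cases "\<omega> \<in> stay m s")
  case True
  have "err_path L m s t \<omega> \<le> (\<integral>\<^sup>+u\<in>{s..t}. ennreal K \<partial>lborel)"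
  proof -
    have "ennreal ((norm (H u \<omega> - H s \<omega>))\<^sup>2) + ennreal ((norm (drift L u \<omega> - drift L s \<omega>))\<^sup>2) \<le> ennreal K" if "u \<in> {s..t}" for u
      unfolding ennreal_plus[OF zero_le_power2 zero_le_power2, symmetric] by (intro ennreal_leI K True that)
    then have "(\<integral>\<^sup>+u\<in>{s..t}. (ennreal ((norm (H u \<omega> - H s \<omega>))\<^sup>2)
      + ennreal ((norm (drift L u \<omega> - drift L s \<omega>))\<^sup>2)) \<partial>lborel) \<le> (\<integral>\<^sup>+u\<in>{s..t}. ennreal K \<partial>lborel)"
      by (intro nn_integral_mono) (auto split: split_indicator)
    then show ?thesis using True by (simp add: err_path_def)
  qed
  also have "\<dots> = ennreal (K * (t - s))"
    using st K0 by (simp add: nn_integral_cmult_indicator ennreal_mult)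
  finally show ?thesis .
qed (simp add: err_path_def)

text \<open>Up to \<open>v\<close> the difference of the processes has no zero, so the reflection
  direction is continuous along the path; at the coupling time the integrand is cut to 0.\<close>

lemma H_cont_before_coupling:
  assumes w: "\<omega> \<in> space M" and v: "ereal v < coupling_time X Y \<omega>"
  shows "continuous_on {0..v} (\<lambda>u. H u \<omega>)"
proof -
  have nz: "Z u \<omega> \<noteq> 0" if "u \<in> {0..v}" for u using before_coupling_nonzero[OF v] that by auto
  have "continuous_on {0..v} (\<lambda>u. Z u \<omega>)" by (rule continuous_on_subset[OF Z_cont[OF w]]) auto
  then have "continuous_on {0..v} (\<lambda>u. \<sigma> ** reflection_mat (reflection_dir \<sigma> (Z u \<omega>)))"
    using nz by (intro continuous_on_reflection_mat continuous_on_reflection_dir) auto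
  moreover have "H u \<omega> = \<sigma> ** reflection_mat (reflection_dir \<sigma> (Z u \<omega>))" if "u \<in> {0..v}" for u
  proof -
    have "ereal u \<le> ereal v" using that by simp
    then have "ereal u < coupling_time X Y \<omega>" using v by (rule le_less_trans)
    then show ?thesis by (simp add: H_def)
  qed
  ultimately show ?thesis by (simp only: continuous_on_cong[OF refl, of "{0..v}" "\<lambda>u. H u \<omega>"])
qed

text \<open>The supremum is attained because the defining conditions are closed. Grid cells in
  [s, t] that start after \<tau> contribute no error, which confines the starting times of all
  relevant cells to an interval before coupling.\<close>

lemma stay_last_time:
  assumes st: "0 \<le> s" "s \<le> t" and w: "\<omega> \<in> stay m s"
  obtains \<tau> where "s \<le> \<tau>" "\<omega> \<in> stay m \<tau>" "\<And>r. s \<le> r \<Longrightarrow> r \<le> t \<Longrightarrow> \<omega> \<in> stay m r \<Longrightarrow> r \<le> \<tau>"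
proof -
  define S where "S = {r\<in>{s..t}. \<omega> \<in> stay m r}"
  have s: "s \<in> S" using st w by (simp add: S_def)
  have bdd: "bdd_above S" by (auto simp: S_def bdd_above_def intro!: exI[of _ t])
  define \<tau> where "\<tau> = Sup S"
  have s\<tau>: "s \<le> \<tau>" unfolding \<tau>_def by (rule cSup_upper[OF s bdd])
  have wM: "\<omega> \<in> space M" using w by (simp add: stay_def)
  have ins: "inside m (X u \<omega>) (Y u \<omega>)" if "u \<in> {0..<\<tau>}" for u
  proof -
    have "u < Sup S" using that by (simp add: \<tau>_def)
    then obtain r where "r \<in> S" "u < r" using less_cSup_iff[OF _ bdd, of u] s by auto
    then show ?thesis using that by (auto simp: S_def stay_def)
  qed
  have "\<omega> \<in> stay m \<tau>"
  proof (cases "\<tau> = s")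
    case False
    then have pos: "0 < \<tau>" using s\<tau> st by simp
    have "inside m (X u \<omega>) (Y u \<omega>)" if "u \<in> {0..\<tau>}" for u
    proof (rule inside_closure[OF wM _ ins])
      show "u \<in> closure {0..<\<tau>}" using that pos by simp
    qed auto
    then show ?thesis using wM by (simp add: stay_def)
  qed (use w in simp)
  moreover have "r \<le> \<tau>" if "s \<le> r" "r \<le> t" "\<omega> \<in> stay m r" for r
    unfolding \<tau>_def using that by (intro cSup_upper bdd) (simp add: S_def)
  ultimately show thesis using s\<tau> that by blast
qed

text \<open>For a fixed path the sum is at most the squared oscillations over a cell times
  \<open>t - s\<close>, and it is bounded uniformly in the path and the grid. Dominated convergence
  then replaces any rate of convergence.\<close>

lemma grid_err_tendsto_0:
  assumes st: "0 \<le> s" "s \<le> t" and L: "0 < L"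
  shows "(\<lambda>n. \<Sum>i<Suc n. enn2real (err L m (s + real i * ((t - s) / real (Suc n))) (s + real (Suc i) * ((t - s) / real (Suc n))))) \<longlonglongrightarrow> 0"
proof -
  define \<Delta> where "\<Delta> = (\<lambda>n. (t - s) / real (Suc n))"
  define p where "p = (\<lambda>n i. s + real i * \<Delta> n)"
  have \<Delta>: "0 \<le> \<Delta> n" for n using st by (simp add: \<Delta>_def)
  have \<Delta>_sum: "(\<Sum>i<Suc n. \<Delta> n) = t - s" for n by (simp add: \<Delta>_def)
  have p: "0 \<le> p n i" "s \<le> p n i" "p n i \<le> p n (Suc i)" "p n (Suc i) - p n i = \<Delta> n" for n i
  proof -
    have "0 \<le> real i * \<Delta> n" using \<Delta> by simp
    then show "0 \<le> p n i" "s \<le> p n i" using st by (auto simp: p_def)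
    show "p n i \<le> p n (Suc i)" "p n (Suc i) - p n i = \<Delta> n" using \<Delta>[of n] by (auto simp: p_def algebra_simps)
  qed
  have pt: "p n i \<le> t" if "i \<le> Suc n" for n i
  proof -
    have "real i * \<Delta> n \<le> real (Suc n) * \<Delta> n" using \<Delta> that by (intro mult_right_mono) auto
    also have "\<dots> = t - s" by (simp add: \<Delta>_def)
    finally show ?thesis by (simp add: p_def)
  qed
  obtain C where C: "0 < C" "\<And>u \<omega>. norm (H u \<omega>) \<le> C" by (rule H_bounded) (rule that)
  define g where "g = (\<lambda>n \<omega>. \<Sum>i<Suc n. err_path L m (p n i) (p n (Suc i)) \<omega>)"
  have pm[measurable]: "err_path L m (p n i) (p n (Suc i)) \<in> borel_measurable M" for n i
    by (rule err_path_measurable[OF p(1) p(3) L])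
  have sum_le: "g n \<omega> \<le> ennreal (K * (t - s))"
    if K: "\<And>i. i < Suc n \<Longrightarrow> err_path L m (p n i) (p n (Suc i)) \<omega> \<le> ennreal (K * \<Delta> n)" and "0 \<le> K" for n \<omega> K
  proof -
    have "g n \<omega> \<le> (\<Sum>i<Suc n. ennreal (K * \<Delta> n))" unfolding g_def by (intro sum_mono K) simp
    also have "\<dots> = ennreal (\<Sum>i<Suc n. K * \<Delta> n)" using \<Delta>[of n] \<open>0 \<le> K\<close> by (intro sum_ennreal) auto
    also have "(\<Sum>i<Suc n. K * \<Delta> n) = K * (t - s)" unfolding sum_distrib_left[symmetric] \<Delta>_sum ..
    finally show ?thesis .
  qed
  have bound: "g n \<omega> \<le> ennreal ((4 * C\<^sup>2 + 4 * L\<^sup>2) * (t - s))" for n \<omega>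
  proof (rule sum_le)
    fix i
    have "err_path L m (p n i) (p n (Suc i)) \<omega> \<le> ennreal ((4 * C\<^sup>2 + 4 * L\<^sup>2) * (p n (Suc i) - p n i))"
      by (intro err_path_le p add_mono norm_diff_sq_bound C drift_bound L) simp
    then show "err_path L m (p n i) (p n (Suc i)) \<omega> \<le> ennreal ((4 * C\<^sup>2 + 4 * L\<^sup>2) * \<Delta> n)" by (simp only: p(4))
  qed simp
  have lim: "(\<lambda>n. g n \<omega>) \<longlonglongrightarrow> 0" for \<omega>
  proof (cases "\<omega> \<in> stay m s")
    case False
    have "\<omega> \<notin> stay m (p n i)" for n i using False stay_antimono[OF p(2), of m n i] by auto
    then have "err_path L m (p n i) (p n (Suc i)) \<omega> = 0" for n i by (simp add: err_path_def)
    then show ?thesis by (simp add: g_def)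
  next
    case True
    then have wM: "\<omega> \<in> space M" by (simp add: stay_def)
    obtain \<tau> where \<tau>: "s \<le> \<tau>" "\<omega> \<in> stay m \<tau>" "\<And>r. s \<le> r \<Longrightarrow> r \<le> t \<Longrightarrow> \<omega> \<in> stay m r \<Longrightarrow> r \<le> \<tau>"
      using stay_last_time[OF st True] by blast
    have "ereal \<tau> < coupling_time X Y \<omega>" using stay_before_coupling[OF \<tau>(2)] \<tau>(1) st by simp
    then obtain v where v: "\<tau> < v" "ereal v < coupling_time X Y \<omega>"
      using ereal_dense2[of "ereal \<tau>" "coupling_time X Y \<omega>"] by auto
    have "continuous_on {0..v} (\<lambda>u. H u \<omega>)" by (rule H_cont_before_coupling[OF wM v(2)])
    then have ucH: "uniformly_continuous_on {0..v} (\<lambda>u. H u \<omega>)" by (intro compact_uniformly_continuous) auto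
    have "continuous_on {0..v} (\<lambda>u. drift L u \<omega>)" by (rule continuous_on_subset[OF drift_cont[OF L wM]]) auto
    then have ucd: "uniformly_continuous_on {0..v} (\<lambda>u. drift L u \<omega>)" by (intro compact_uniformly_continuous) auto
    show ?thesis
    proof (rule ennreal_tendsto_0I)
      fix e :: real assume e: "0 < e"
      \<comment> \<open>Oscillations below \<eta> of both processes give (\<eta>^2 + \<eta>^2)(t -
        s) \<le> e; the added 1 avoids a division by zero for \<open>s = t\<close>.\<close>
      define \<eta> where "\<eta> = sqrt (e / (2 * (t - s + 1)))"
      have \<eta>: "0 < \<eta>" using e st by (simp add: \<eta>_def)
      have \<eta>2: "(\<eta>\<^sup>2 + \<eta>\<^sup>2) * (t - s) \<le> e"
      proof -
        have "\<eta>\<^sup>2 = e / (2 * (t - s + 1))" using e st by (simp add: \<eta>_def)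
        then have "(\<eta>\<^sup>2 + \<eta>\<^sup>2) * (t - s + 1) = e" using st by (simp add: field_simps)
        moreover have "(\<eta>\<^sup>2 + \<eta>\<^sup>2) * (t - s) \<le> (\<eta>\<^sup>2 + \<eta>\<^sup>2) * (t - s + 1)" by (intro mult_left_mono) auto
        ultimately show ?thesis by linarith
      qed
      obtain d1 where d1: "0 < d1" "\<forall>x\<in>{0..v}. \<forall>x'\<in>{0..v}. dist x' x < d1 \<longrightarrow> dist (H x' \<omega>) (H x \<omega>) < \<eta>"
        using ucH \<eta> unfolding uniformly_continuous_on_def by blast
      obtain d2 where d2: "0 < d2" "\<forall>x\<in>{0..v}. \<forall>x'\<in>{0..v}. dist x' x < d2 \<longrightarrow> dist (drift L x' \<omega>) (drift L x \<omega>) < \<eta>"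
        using ucd \<eta> unfolding uniformly_continuous_on_def by blast
      define d where "d = min (v - \<tau>) (min d1 d2)"
      have d: "0 < d" using v d1 d2 by (simp add: d_def)
      have "(\<lambda>n. (t - s) * inverse (real (Suc n))) \<longlonglongrightarrow> (t - s) * 0"
        by (intro tendsto_mult_left LIMSEQ_inverse_real_of_nat)
      then have "\<Delta> \<longlonglongrightarrow> 0" by (simp add: \<Delta>_def[abs_def] divide_inverse)
      then have "eventually (\<lambda>n. \<Delta> n < d) sequentially" by (rule order_tendstoD) (rule d)
      then show "eventually (\<lambda>n. g n \<omega> \<le> ennreal e) sequentially"
      proof eventually_elim
        case (elim n)
        have "g n \<omega> \<le> ennreal ((\<eta>\<^sup>2 + \<eta>\<^sup>2) * (t - s))"
        proof (rule sum_le)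
          fix i assume i: "i < Suc n"
          have "err_path L m (p n i) (p n (Suc i)) \<omega> \<le> ennreal ((\<eta>\<^sup>2 + \<eta>\<^sup>2) * (p n (Suc i) - p n i))"
          proof (rule err_path_le[OF p(3)])
            fix u assume stay: "\<omega> \<in> stay m (p n i)" and u: "u \<in> {p n i..p n (Suc i)}"
            have pi: "p n i \<le> \<tau>" by (rule \<tau>(3)[OF p(2) pt stay]) (use i in simp)
            have ui: "p n i \<le> u" "u - p n i < d" using u p(4)[of n i] elim by auto
            have mem: "p n i \<in> {0..v}" "u \<in> {0..v}" using pi ui p(1)[of n i] v by (auto simp: d_def)
            have "dist u (p n i) < d1" "dist u (p n i) < d2" using ui by (auto simp: d_def dist_real_def)
            then have "norm (H u \<omega> - H (p n i) \<omega>) < \<eta>" "norm (drift L u \<omega> - drift L (p n i) \<omega>) < \<eta>"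
              using d1(2) d2(2) mem by (auto simp: dist_norm)
            then show "(norm (H u \<omega> - H (p n i) \<omega>))\<^sup>2 + (norm (drift L u \<omega> - drift L (p n i) \<omega>))\<^sup>2 \<le> \<eta>\<^sup>2 + \<eta>\<^sup>2"
              by (intro add_mono power_mono) auto
          qed simp
          then show "err_path L m (p n i) (p n (Suc i)) \<omega> \<le> ennreal ((\<eta>\<^sup>2 + \<eta>\<^sup>2) * \<Delta> n)" by (simp only: p(4))
        qed simp
        also have "\<dots> \<le> ennreal e" by (rule ennreal_leI[OF \<eta>2])
        finally show ?case .
      qed
    qed
  qed
  have "(\<lambda>n. \<integral>\<^sup>+\<omega>. g n \<omega> \<partial>M) \<longlonglongrightarrow> (\<integral>\<^sup>+\<omega>. 0 \<partial>M)"
  proof (rule nn_integral_dominated_convergence)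
    show "g n \<in> borel_measurable M" for n unfolding g_def by measurable
    show "AE \<omega> in M. g n \<omega> \<le> ennreal ((4 * C\<^sup>2 + 4 * L\<^sup>2) * (t - s))" for n using bound by simp
    show "(\<integral>\<^sup>+\<omega>. ennreal ((4 * C\<^sup>2 + 4 * L\<^sup>2) * (t - s)) \<partial>M) < \<infinity>" by (simp add: emeasure_space_1)
    show "AE \<omega> in M. (\<lambda>n. g n \<omega>) \<longlonglongrightarrow> 0" using lim by simp
  qed auto
  then have "(\<lambda>n. enn2real (\<integral>\<^sup>+\<omega>. g n \<omega> \<partial>M)) \<longlonglongrightarrow> enn2real 0"
    by (intro tendsto_enn2real) auto
  moreover have "enn2real (\<integral>\<^sup>+\<omega>. g n \<omega> \<partial>M) = (\<Sum>i<Suc n. enn2real (err L m (p n i) (p n (Suc i))))" for n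
  proof -
    have "(\<integral>\<^sup>+\<omega>. g n \<omega> \<partial>M) = (\<Sum>i<Suc n. err L m (p n i) (p n (Suc i)))"
      unfolding g_def err_def err_path_def[symmetric] by (rule nn_integral_sum) (rule pm)
    moreover have "err L m (p n i) (p n (Suc i)) < \<top>" for i by (rule err_parts(1)[OF p(1) p(3) L])
    ultimately show ?thesis by (simp only: enn2real_sum o_def)
  qed
  ultimately show ?thesis by (simp add: p_def \<Delta>_def)
qed

text \<open>A step of length \<Delta> multiplies by 1 - c \<Delta> and adds \<theta> \<Delta> + K
  (\<Delta>^2 + err). As \<open>K\<close> depends on \<theta>, first \<theta> is fixed and then the
  mesh is refined until the part with \<open>K\<close> is small.\<close>

lemma stay_decay:
  fixes U :: "real \<Rightarrow> real"
  assumes L: "0 < L" and c: "0 < c" and U: "\<And>t. 0 \<le> t \<Longrightarrow> 0 \<le> U t"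
    and step: "\<And>\<theta>. 0 < \<theta> \<Longrightarrow> \<exists>K\<ge>0. \<forall>s t. 0 \<le> s \<longrightarrow> s \<le> t \<longrightarrow>
      U t \<le> (1 - c * (t - s)) * U s + \<theta> * (t - s) + K * ((t - s)\<^sup>2 + enn2real (err L m s t))"
    and st: "0 \<le> s" "s \<le> t"
  shows "U t \<le> exp (- (c * (t - s))) * U s"
proof (rule field_le_epsilon)
  fix e :: real assume e: "0 < e"
  define T where "T = t - s"
  have T: "0 \<le> T" using st by (simp add: T_def)
  define \<theta> where "\<theta> = e / (2 * (T + 1))"
  have \<theta>: "0 < \<theta>" using e T by (simp add: \<theta>_def)
  have \<theta>T: "\<theta> * T \<le> e / 2"
  proof -
    have "\<theta> * T \<le> \<theta> * (T + 1)" using \<theta> by (intro mult_left_mono) auto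
    also have "\<dots> = e / 2" using T by (simp add: \<theta>_def field_simps)
    finally show ?thesis .
  qed
  obtain K where K: "0 \<le> K" "\<And>s t. 0 \<le> s \<Longrightarrow> s \<le> t \<Longrightarrow>
      U t \<le> (1 - c * (t - s)) * U s + \<theta> * (t - s) + K * ((t - s)\<^sup>2 + enn2real (err L m s t))"
    using step[OF \<theta>] by blast
  define \<Delta> where "\<Delta> = (\<lambda>n. T / real (Suc n))"
  define p where "p = (\<lambda>n i. s + real i * \<Delta> n)"
  define E where "E = (\<lambda>n. \<Sum>i<Suc n. enn2real (err L m (p n i) (p n (Suc i))))"
  have E: "E \<longlonglongrightarrow> 0"
    using grid_err_tendsto_0[OF st L, of m] unfolding E_def p_def \<Delta>_def T_def .
  have \<Delta>0: "\<Delta> \<longlonglongrightarrow> 0"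
    using tendsto_mult_left[OF LIMSEQ_inverse_real_of_nat, of T] by (simp add: \<Delta>_def[abs_def] divide_inverse)
  have "(\<lambda>n. K * (T * \<Delta> n + E n)) \<longlonglongrightarrow> K * (T * 0 + 0)"
    by (intro tendsto_mult_left tendsto_add E \<Delta>0)
  then have "eventually (\<lambda>n. K * (T * \<Delta> n + E n) < e / 2) sequentially"
    by (rule order_tendstoD) (use e in simp)
  \<comment> \<open>This makes the factor 1 - c \<Delta> nonnegative, as the recursion
    requires.\<close>
  moreover have "eventually (\<lambda>n. \<Delta> n < 1 / c) sequentially"
    using order_tendstoD(2)[OF \<Delta>0, of "1 / c"] c by simp
  ultimately have "eventually (\<lambda>n. K * (T * \<Delta> n + E n) < e / 2 \<and> \<Delta> n < 1 / c) sequentially"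
    by (rule eventually_conj)
  then obtain n where n: "K * (T * \<Delta> n + E n) < e / 2" "\<Delta> n < 1 / c"
    by (auto simp: eventually_sequentially)
  have \<Delta>n: "0 \<le> \<Delta> n" using T by (simp add: \<Delta>_def)
  have c\<Delta>: "c * \<Delta> n \<le> 1" using n(2) c by (simp add: field_simps)
  have pp: "0 \<le> p n i" "p n i \<le> p n (Suc i)" "p n (Suc i) - p n i = \<Delta> n" for i
  proof -
    have "0 \<le> real i * \<Delta> n" using \<Delta>n by simp
    then show "0 \<le> p n i" using st by (simp add: p_def)
    show "p n i \<le> p n (Suc i)" "p n (Suc i) - p n i = \<Delta> n" using \<Delta>n by (auto simp: p_def algebra_simps)
  qed
  have sumT: "real (Suc n) * \<Delta> n = T" by (simp add: \<Delta>_def)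
  have "U (p n (Suc n)) \<le> (1 - c * \<Delta> n) ^ Suc n * U (p n 0)
     + (\<Sum>i<Suc n. \<theta> * \<Delta> n + K * ((\<Delta> n)\<^sup>2 + enn2real (err L m (p n i) (p n (Suc i)))))"
  proof (rule discrete_gronwall[where U="\<lambda>i. U (p n i)"])
    fix i
    show "U (p n (Suc i)) \<le> (1 - c * \<Delta> n) * U (p n i) + (\<theta> * \<Delta> n + K * ((\<Delta> n)\<^sup>2 + enn2real (err L m (p n i) (p n (Suc i)))))"
      using K(2)[OF pp(1) pp(2)[of i]] unfolding pp(3) by simp
    show "0 \<le> \<theta> * \<Delta> n + K * ((\<Delta> n)\<^sup>2 + enn2real (err L m (p n i) (p n (Suc i))))"
      using \<theta> \<Delta>n K(1) by simp
    show "0 \<le> 1 - c * \<Delta> n" "1 - c * \<Delta> n \<le> 1" using c\<Delta> c \<Delta>n by auto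
  qed
  also have "(\<Sum>i<Suc n. \<theta> * \<Delta> n + K * ((\<Delta> n)\<^sup>2 + enn2real (err L m (p n i) (p n (Suc i)))))
    = \<theta> * (real (Suc n) * \<Delta> n) + K * ((real (Suc n) * \<Delta> n) * \<Delta> n + E n)"
    unfolding E_def sum.distrib sum_distrib_left[symmetric] by (simp add: power2_eq_square algebra_simps)
  also have "\<dots> = \<theta> * T + K * (T * \<Delta> n + E n)" unfolding sumT ..
  also have "p n 0 = s" by (simp add: p_def)
  also have "p n (Suc n) = t" using sumT by (simp add: p_def T_def)
  finally have "U t \<le> (1 - c * \<Delta> n) ^ Suc n * U s + (\<theta> * T + K * (T * \<Delta> n + E n))" .
  moreover have "(1 - c * \<Delta> n) ^ Suc n \<le> exp (- (c * (t - s)))"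
  proof -
    have "(1 - c * \<Delta> n) ^ Suc n \<le> exp (- (c * \<Delta> n)) ^ Suc n"
      using c\<Delta> exp_ge_add_one_self[of "- (c * \<Delta> n)"] by (intro power_mono) auto
    also have "\<dots> = exp (- (c * (real (Suc n) * \<Delta> n)))" by (simp only: exp_of_nat_mult[symmetric]) (simp add: algebra_simps)
    finally show ?thesis unfolding sumT T_def .
  qed
  then have "(1 - c * \<Delta> n) ^ Suc n * U s \<le> exp (- (c * (t - s))) * U s"
    by (rule mult_right_mono) (rule U[OF st(1)])
  ultimately show "U t \<le> exp (- (c * (t - s))) * U s + e"
    using n(1) \<theta>T by linarith
qed

end

section \<open>The concave distance function\<close>

text \<open>The exceptional point is meant for \<open>r1\<close>, where \<open>g\<close> may have a
  kink; monotonicity on both sides is glued by continuity.\<close>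

lemma DERIV_nonpos_antimono_except:
  fixes f :: "real \<Rightarrow> real"
  assumes ab: "a \<le> b" and c: "continuous_on {a..b} f"
    and d: "\<And>x. a < x \<Longrightarrow> x < b \<Longrightarrow> x \<noteq> p \<Longrightarrow> \<exists>y. DERIV f x :> y \<and> y \<le> 0"
  shows "f b \<le> f a"
proof -
  have *: "f v \<le> f u" if "a \<le> u" "u \<le> v" "v \<le> b" "p \<le> u \<or> v \<le> p" for u v
    using that d
    by (intro DERIV_nonpos_imp_decreasing_open[of u v f] continuous_on_subset[OF c]) force+
  show ?thesis
  proof (cases "a \<le> p \<and> p \<le> b")
    case True
    then show ?thesis using *[of a p] *[of p b] by simp
  next
    case False
    then show ?thesis using *[of a b] ab by auto
  qed
qed

text \<open>Subtracting the parabola leaves a function that decreases from \<open>x\<close> to the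
  right and increases towards \<open>x\<close> from the left. With \<open>a = 0\<close> this is the
  tangent inequality of a concave function. The point y = 0 is included, where only continuity is
  available.\<close>

lemma below_tangent_parabola:
  fixes F F' :: "real \<Rightarrow> real"
  assumes Fc: "continuous_on {0..} F" and Fd: "\<And>z. 0 < z \<Longrightarrow> DERIV F z :> F' z"
    and x: "0 < x" and y: "0 \<le> y"
    and D: "\<And>z. x \<le> z \<Longrightarrow> z \<le> y \<Longrightarrow> F' z \<le> F' x + a * (z - x)"
      "\<And>z. 0 < z \<Longrightarrow> y \<le> z \<Longrightarrow> z \<le> x \<Longrightarrow> F' x + a * (z - x) \<le> F' z"
  shows "F y \<le> F x + F' x * (y - x) + a / 2 * (y - x)\<^sup>2"
proof -
  define E where "E = (\<lambda>z. F z - (F' x * (z - x) + a / 2 * (z - x)\<^sup>2))"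
  have Ec: "continuous_on {0..} E" unfolding E_def by (intro continuous_intros Fc)
  have Ed: "DERIV E z :> F' z - (F' x + a * (z - x))" if "0 < z" for z
    unfolding E_def using that by (auto intro!: derivative_eq_intros Fd)
  have "E y \<le> E x"
  proof (cases "x \<le> y")
    case True
    then show ?thesis
    proof (rule DERIV_nonpos_antimono_except[where p=0])
      show "continuous_on {x..y} E" by (rule continuous_on_subset[OF Ec]) (use x in auto)
      show "\<exists>d. DERIV E z :> d \<and> d \<le> 0" if "x < z" "z < y" for z
        using Ed[of z] D(1)[of z] that x by (intro exI[of _ "F' z - (F' x + a * (z - x))"]) auto
    qed
  next
    case False
    have "- E x \<le> - E y"
    proof (rule DERIV_nonpos_antimono_except[where p=0 and f="\<lambda>z. - E z"])
      show "continuous_on {y..x} (\<lambda>z. - E z)" by (intro continuous_intros continuous_on_subset[OF Ec]) (use y in auto)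
      show "\<exists>d. DERIV (\<lambda>z. - E z) z :> d \<and> d \<le> 0" if "y < z" "z < x" for z
        using DERIV_minus[OF Ed[of z]] D(2)[of z] that y
        by (intro exI[of _ "- (F' z - (F' x + a * (z - x)))"]) auto
    qed (use False in simp)
    then show ?thesis by simp
  qed
  then show ?thesis by (simp add: E_def)
qed

lemma set_integral_point: "(LBINT s:{a..a}. f s :: real) = 0" for a :: real
proof -
  have "AE x in lborel. indicat_real {a..a} x *\<^sub>R f x = 0"
    using AE_lborel_singleton[of a] by eventually_elim auto
  then show ?thesis unfolding set_lebesgue_integral_def by (rule integral_eq_zero_AE)
qed

context
  fixes f :: "real \<Rightarrow> real"
  assumes int: "\<And>b. set_integrable lborel {0..b} f" and cont: "continuous_on {0<..} f"
begin

private lemma indefinite_eq: "(LBINT s:{0..r}. f s) = integral {0..r} f"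
  using int by (rule set_borel_integral_eq_integral(2))

lemma indefinite_integral_cont: "continuous_on {0..} (\<lambda>r. LBINT s:{0..r}. f s)"
  unfolding continuous_on_eq_continuous_within
proof
  fix x :: real assume x: "x \<in> {0..}"
  have "continuous_on {0..x+1} (\<lambda>r. integral {0..r} f)"
    by (rule indefinite_integral_continuous_1) (rule set_borel_integral_eq_integral(1)[OF int])
  then have "continuous (at x within {0..x+1}) (\<lambda>r. integral {0..r} f)"
    using x by (simp add: continuous_on_eq_continuous_within)
  moreover have "at x within {0..} = at x within {0..x+1}"
    by (rule at_within_nhd[of x "{..<x+1}"]) auto
  ultimately show "continuous (at x within {0..}) (\<lambda>r. LBINT s:{0..r}. f s)"
    by (simp add: indefinite_eq)
qed

text \<open>The integrand may be unbounded near 0, so the fundamental theorem is applied on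
  [r/2, r + 1], and the integral up to r/2 is a constant.\<close>

lemma indefinite_integral_DERIV:
  assumes r: "0 < r"
  shows "DERIV (\<lambda>r. LBINT s:{0..r}. f s) r :> f r"
proof -
  have c: "continuous_on {r/2..r+1} f" by (rule continuous_on_subset[OF cont]) (use r in auto)
  have "((\<lambda>x. integral {r/2..x} f) has_real_derivative f r) (at r within {r/2..r+1})"
    by (rule integral_has_real_derivative[OF c]) (use r in auto)
  moreover have "at r within {r/2..r+1} = at r" by (rule at_within_interior) (use r in \<open>simp add: interior_atLeastAtMost_real\<close>)
  ultimately have "DERIV (\<lambda>x. integral {0..r/2} f + integral {r/2..x} f) r :> 0 + f r"
    by (intro DERIV_add) auto
  then have "DERIV (\<lambda>x. integral {0..r/2} f + integral {r/2..x} f) r :> f r" by simp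
  then show ?thesis
  proof (rule has_field_derivative_transform_within_open[of _ _ _ "{r/2<..}"])
    fix x assume x: "x \<in> {r/2<..}"
    have "integral {0..r/2} f + integral {r/2..x} f = integral {0..x} f"
      by (rule Henstock_Kurzweil_Integration.integral_combine)
        (use r x in \<open>auto intro: set_borel_integral_eq_integral(1)[OF int]\<close>)
    then show "integral {0..r/2} f + integral {r/2..x} f = (LBINT s:{0..x}. f s)" by (simp add: indefinite_eq)
  qed (use r in auto)
qed

end

lemma continuous_indefinite_integrable:
  fixes f :: "real \<Rightarrow> real"
  assumes "continuous_on {0..} f"
  shows "set_integrable lborel {0..b} f"
  using borel_integrable_compact[OF compact_Icc continuous_on_subset[OF assms], of 0 b] by (simp add: set_integrable_def)

section \<open>The functions determined by kappa\<close>

locale kappa_profile =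
  fixes \<kappa> :: "real \<Rightarrow> real"
  assumes cont: "continuous_on {0<..} \<kappa>"
    and liminf_pos: "Liminf at_top (\<lambda>r. ereal (\<kappa> r)) > 0"
    and int01: "set_integrable lborel {0<..1} (\<lambda>r. r * max (- \<kappa> r) 0)"
begin

abbreviation "\<phi> \<equiv> phi \<kappa>"
abbreviation "\<Phi> \<equiv> Phi \<kappa>"
abbreviation "g \<equiv> g_fun \<kappa>"
abbreviation "f \<equiv> f_fun \<kappa>"
abbreviation "r0 \<equiv> R0 \<kappa>"
abbreviation "r1 \<equiv> R1 \<kappa>"

definition neg :: "real \<Rightarrow> real" where "neg s = s * max (- \<kappa> s) 0"

lemma neg_nonneg: "0 \<le> s \<Longrightarrow> 0 \<le> neg s"
  by (simp add: neg_def)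

lemma neg_cont: "continuous_on {0<..} neg"
  unfolding neg_def using cont by (intro continuous_intros)

lemma neg_int: "set_integrable lborel {0..b} neg"
proof -
  \<comment> \<open>At 0 the factor \<open>s\<close> makes \<open>neg\<close> vanish, whatever value
    kappa takes there.\<close>
  have "set_integrable lborel {0} neg"
  proof -
    have "(\<lambda>x. indicat_real {0} x *\<^sub>R neg x) = (\<lambda>_. 0)"
      by (auto simp: fun_eq_iff neg_def split: split_indicator)
    then show ?thesis unfolding set_integrable_def by simp
  qed
  moreover have "set_integrable lborel {0<..1} neg"
    using int01 by (simp add: neg_def[abs_def])
  moreover have "set_integrable lborel {1..max 1 b} neg"
    using borel_integrable_compact[OF compact_Icc continuous_on_subset[OF neg_cont], of 1 "max 1 b"]
    by (force simp: set_integrable_def)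
  ultimately have "set_integrable lborel ({0} \<union> {0<..1} \<union> {1..max 1 b}) neg"
    by (intro set_integrable_Un) auto
  then show ?thesis by (rule set_integrable_subset) auto
qed

lemma phi_eq: "\<phi> r = exp (- (1/4) * (LBINT s:{0..r}. neg s))"
  by (simp add: phi_def neg_def)

lemma phi_pos: "0 < \<phi> r" by (simp add: phi_def)

lemma phi_0: "\<phi> 0 = 1"
  by (simp add: phi_def set_integral_point del: atLeastAtMost_singleton)

lemma phi_cont: "continuous_on {0..} \<phi>"
  unfolding phi_eq[abs_def] by (intro continuous_intros indefinite_integral_cont neg_int neg_cont)

lemma phi_DERIV: "0 < r \<Longrightarrow> DERIV \<phi> r :> - (1/4) * neg r * \<phi> r"
  unfolding phi_eq[abs_def]
  by (auto intro!: derivative_eq_intros indefinite_integral_DERIV neg_int neg_cont)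

lemma antimono_from_DERIV:
  assumes "continuous_on {0..} F" "\<And>r. 0 < r \<Longrightarrow> r \<noteq> p \<Longrightarrow> \<exists>y. DERIV F r :> y \<and> y \<le> 0" "0 \<le> x" "x \<le> y"
  shows "F y \<le> (F x :: real)"
  using assms by (intro DERIV_nonpos_antimono_except[of x y F p] continuous_on_subset[OF assms(1)]) auto

lemma phi_antimono: "0 \<le> x \<Longrightarrow> x \<le> y \<Longrightarrow> \<phi> y \<le> \<phi> x"
proof (rule antimono_from_DERIV[OF phi_cont, of 0])
  show "\<exists>y. DERIV \<phi> r :> y \<and> y \<le> 0" if "0 < r" for r
    using phi_DERIV[OF that] mult_nonneg_nonneg[OF neg_nonneg less_imp_le[OF phi_pos[of r]], of r] that
    by (intro exI[of _ "- (1/4) * neg r * \<phi> r"]) auto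
qed

lemma phi_le_1: "0 \<le> r \<Longrightarrow> \<phi> r \<le> 1"
  using phi_antimono[of 0 r] phi_0 by simp

lemma Phi_0: "\<Phi> 0 = 0"
  by (simp add: Phi_def set_integral_point del: atLeastAtMost_singleton)

lemma Phi_cont: "continuous_on {0..} \<Phi>"
  unfolding Phi_def[abs_def]
  by (intro indefinite_integral_cont continuous_indefinite_integrable phi_cont continuous_on_subset[OF phi_cont]) auto

lemma Phi_DERIV: "0 < r \<Longrightarrow> DERIV \<Phi> r :> \<phi> r"
  unfolding Phi_def[abs_def]
  by (intro indefinite_integral_DERIV continuous_indefinite_integrable phi_cont continuous_on_subset[OF phi_cont]) auto

lemma strict_mono_from_DERIV:
  fixes F :: "real \<Rightarrow> real"
  assumes "continuous_on {0..} F" "\<And>r. 0 < r \<Longrightarrow> \<exists>y. DERIV F r :> y \<and> 0 < y" "0 \<le> x" "x < y"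
  shows "F x < F y"
  using assms by (intro DERIV_pos_imp_increasing_open[of x y F] continuous_on_subset[OF assms(1)]) auto

lemma Phi_pos: "0 < r \<Longrightarrow> 0 < \<Phi> r"
  using strict_mono_from_DERIV[OF Phi_cont, of 0 r] Phi_DERIV phi_pos Phi_0 by force

definition quot :: "real \<Rightarrow> real" where "quot s = \<Phi> s / \<phi> s"

lemma quot_cont: "continuous_on {0..} quot"
  unfolding quot_def using phi_pos by (intro continuous_intros Phi_cont phi_cont) (simp add: less_imp_neq[symmetric])

lemma quot_pos: "0 < s \<Longrightarrow> 0 < quot s"
  by (simp add: quot_def Phi_pos phi_pos)

definition Quot :: "real \<Rightarrow> real" where "Quot r = (LBINT s:{0..r}. quot s)"

lemma Quot_0: "Quot 0 = 0"
  by (simp add: Quot_def set_integral_point del: atLeastAtMost_singleton)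

lemma Quot_cont: "continuous_on {0..} Quot"
  unfolding Quot_def[abs_def]
  by (intro indefinite_integral_cont continuous_indefinite_integrable quot_cont continuous_on_subset[OF quot_cont]) auto

lemma Quot_DERIV: "0 < r \<Longrightarrow> DERIV Quot r :> quot r"
  unfolding Quot_def[abs_def]
  by (intro indefinite_integral_DERIV continuous_indefinite_integrable quot_cont continuous_on_subset[OF quot_cont]) auto

lemma Quot_strict_mono: "0 \<le> x \<Longrightarrow> x < y \<Longrightarrow> Quot x < Quot y"
  using Quot_DERIV quot_pos by (intro strict_mono_from_DERIV[OF Quot_cont]) auto

lemma Quot_mono: "0 \<le> x \<Longrightarrow> x \<le> y \<Longrightarrow> Quot x \<le> Quot y"
  using Quot_strict_mono[of x y] by (cases "x = y") auto

lemma kappa_eventually: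
  obtains R \<epsilon> where "0 < R" "0 < \<epsilon>" "\<And>r. R \<le> r \<Longrightarrow> \<epsilon> \<le> \<kappa> r"
proof -
  obtain y where y: "0 < y" "y < Liminf at_top (\<lambda>r. ereal (\<kappa> r))"
    using dense[OF liminf_pos] by blast
  then obtain \<epsilon> where \<epsilon>: "y = ereal \<epsilon>" by (cases y) auto
  have "eventually (\<lambda>r. ereal \<epsilon> < ereal (\<kappa> r)) at_top"
    using less_LiminfD[OF y(2)] \<epsilon> by simp
  then obtain N where "\<And>r. N \<le> r \<Longrightarrow> \<epsilon> < \<kappa> r" by (auto simp: eventually_at_top_linorder)
  then show thesis using y(1) \<epsilon> by (intro that[of "max 1 N" \<epsilon>]) (auto intro: less_imp_le)
qed

lemma r0_nonneg: "0 \<le> r0"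
  and kappa_nonneg: "r0 < r \<Longrightarrow> 0 \<le> \<kappa> r"
proof -
  let ?S = "{R. 0 \<le> R \<and> (\<forall>r>0. R \<le> r \<longrightarrow> 0 \<le> \<kappa> r)}"
  obtain R \<epsilon> where R: "0 < R" "0 < \<epsilon>" "\<And>r. R \<le> r \<Longrightarrow> \<epsilon> \<le> \<kappa> r" by (rule kappa_eventually) (rule that)
  have ne: "?S \<noteq> {}" using R by (auto intro!: exI[of _ R] intro: order_trans[OF less_imp_le])
  show r0: "0 \<le> r0" unfolding R0_def by (rule cInf_greatest[OF ne]) simp
  assume r: "r0 < r"
  then obtain x where "x \<in> ?S" "x < r"
    unfolding R0_def using cInf_lessD[OF ne] by blast
  then show "0 \<le> \<kappa> r" using r r0 by auto
qed

text \<open>For \<open>R > r1\<close> the defining inequality holds because \<kappa> \<ge> 0 makes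
  it monotone in \<open>R\<close>; letting \<open>R\<close> decrease to \<open>r1\<close> gives it
  for \<open>r1\<close> itself. As 8 > 0, this excludes r1 = r0 and r1 = 0.\<close>

lemma r1_gt: "r0 < r1" "0 < r1"
  and kappa_r1: "r1 < r \<Longrightarrow> 8 \<le> \<kappa> r * r1 * (r1 - r0)"
proof -
  let ?S = "{R. r0 \<le> R \<and> (\<forall>r>0. R \<le> r \<longrightarrow> 8 \<le> \<kappa> r * R * (R - r0))}"
  obtain R \<epsilon> where R: "0 < R" "0 < \<epsilon>" "\<And>r. R \<le> r \<Longrightarrow> \<epsilon> \<le> \<kappa> r" by (rule kappa_eventually) (rule that)
  \<comment> \<open>From \<open>R\<close> on \<kappa> is at least \<epsilon>, so the factor R' \<ge>
    8/\<epsilon> already yields 8, and the last factor R' - r0 is at least 1.\<close>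
  define R' where "R' = max (max R (8 / \<epsilon>)) (r0 + 1)"
  have "R' \<in> ?S"
  proof (intro CollectI conjI allI impI)
    show "r0 \<le> R'" by (simp add: R'_def)
    fix r :: real assume "0 < r" "R' \<le> r"
    have R'p: "R \<le> R'" "8 / \<epsilon> \<le> R'" "1 \<le> R' - r0" "0 < R'" using R(1) by (auto simp: R'_def)
    have "\<epsilon> * (8 / \<epsilon>) \<le> \<kappa> r * R'" using R(2) R(3)[of r] \<open>R' \<le> r\<close> R'p by (intro mult_mono) auto
    then have "8 \<le> \<kappa> r * R'" using R(2) by simp
    then have "8 * 1 \<le> \<kappa> r * R' * (R' - r0)" using R'p by (intro mult_mono) auto
    then show "8 \<le> \<kappa> r * R' * (R' - r0)" by simp
  qed
  then have ne: "?S \<noteq> {}" by blast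
  have r01: "r0 \<le> r1" unfolding R1_def by (rule cInf_greatest[OF ne]) simp
  have up: "8 \<le> \<kappa> r * R * (R - r0)" if "r1 < R" "R \<le> r" for R r
  proof -
    have "Inf ?S < R" using that(1) by (simp only: R1_def)
    from cInf_lessD[OF ne this] obtain x where x: "x \<in> ?S" "x < R" by (rule bexE)
    have r: "0 < r" "x \<le> r" using r0_nonneg r01 that x by auto
    have 8: "8 \<le> \<kappa> r * x * (x - r0)" using x(1) r by blast
    have x0: "0 \<le> x" "r0 \<le> x" using x(1) r0_nonneg by auto
    have \<kappa>: "0 \<le> \<kappa> r" using kappa_nonneg[of r] that r01 by simp
    have "\<kappa> r * x * (x - r0) \<le> \<kappa> r * R * (R - r0)"
      using x0 x(2) \<kappa> by (intro mult_mono) auto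
    then show ?thesis using 8 by linarith
  qed
  have lim: "8 \<le> \<kappa> r * r1 * (r1 - r0)" if r: "r1 < r" for r
  proof (rule tendsto_lowerbound)
    show "((\<lambda>R. \<kappa> r * R * (R - r0)) \<longlongrightarrow> \<kappa> r * r1 * (r1 - r0)) (at_right r1)"
      by (intro tendsto_intros)
    show "eventually (\<lambda>R. 8 \<le> \<kappa> r * R * (R - r0)) (at_right r1)"
      unfolding eventually_at_right_field using up r by (auto intro!: exI[of _ r])
  qed simp
  show "r1 < r \<Longrightarrow> 8 \<le> \<kappa> r * r1 * (r1 - r0)" by (rule lim)
  have "r1 \<noteq> r0" "r1 \<noteq> 0" using lim[of "r1 + 1"] by auto
  then show "r0 < r1" "0 < r1" using r01 r0_nonneg by auto
qed

lemma neg_zero: "r0 < r \<Longrightarrow> neg r = 0"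
  using kappa_nonneg[of r] by (simp add: neg_def)

abbreviation "N \<equiv> Quot r1"

lemma N_pos: "0 < N"
  using Quot_strict_mono[of 0 r1] r1_gt Quot_0 by simp

lemma g_eq: "g r = 1 - (1/2) * (Quot (min r r1) / N)"
  by (simp add: g_fun_def Quot_def quot_def)

lemma g_cont: "continuous_on {0..} g"
  unfolding g_eq[abs_def] using N_pos r1_gt
  by (intro continuous_intros continuous_on_compose2[OF Quot_cont]) auto

lemma g_DERIV_less:
  assumes "0 < r" "r < r1"
  shows "DERIV g r :> - (1/2) * (quot r / N)"
proof -
  have "DERIV (\<lambda>r. 1 - (1/2) * (Quot r / N)) r :> - (1/2) * (quot r / N)"
    using N_pos by (auto intro!: derivative_eq_intros Quot_DERIV assms)
  then show ?thesis
    by (rule has_field_derivative_transform_within_open[of _ _ _ "{0<..<r1}"]) (use assms in \<open>auto simp: g_eq\<close>)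
qed

lemma g_DERIV_greater:
  assumes "r1 < r"
  shows "DERIV g r :> 0"
proof -
  have "DERIV (\<lambda>r. 1/2 :: real) r :> 0" by (auto intro!: derivative_eq_intros)
  then show ?thesis
    by (rule has_field_derivative_transform_within_open[of _ _ _ "{r1<..}"]) (use assms N_pos in \<open>auto simp: g_eq\<close>)
qed

lemma g_ge_r1: "r1 \<le> r \<Longrightarrow> g r = 1/2"
  using N_pos by (simp add: g_eq min_def)

lemma g_antimono: "0 \<le> x \<Longrightarrow> x \<le> y \<Longrightarrow> g y \<le> g x"
  using Quot_mono[of "min x r1" "min y r1"] N_pos r1_gt by (simp add: g_eq divide_right_mono)

lemma g_bounds: "0 \<le> r \<Longrightarrow> 1/2 \<le> g r \<and> g r \<le> 1"
  using g_antimono[of r "max r r1"] g_ge_r1[of "max r r1"] g_antimono[of 0 r] r1_gt Quot_0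
  by (simp add: g_eq[of 0])

text \<open>The derivative of \<open>f\<close> on the positive half line.\<close>

definition fp :: "real \<Rightarrow> real" where "fp r = \<phi> r * g r"

lemma fp_cont: "continuous_on {0..} fp"
  unfolding fp_def by (intro continuous_intros phi_cont g_cont)

lemma fp_pos: "0 \<le> r \<Longrightarrow> 0 < fp r"
  using g_bounds[of r] phi_pos by (simp add: fp_def)

lemma fp_le_phi: "0 \<le> r \<Longrightarrow> fp r \<le> \<phi> r"
  using g_bounds[of r] phi_pos[of r] mult_left_mono[of "g r" 1 "\<phi> r"] by (simp add: fp_def)

lemma fp_le_1: "0 \<le> r \<Longrightarrow> fp r \<le> 1"
  using fp_le_phi[of r] phi_le_1[of r] by linarith

lemma fp_antimono: "0 \<le> x \<Longrightarrow> x \<le> y \<Longrightarrow> fp y \<le> fp x"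
  unfolding fp_def using phi_antimono[of x y] g_antimono[of x y] phi_pos[of x] g_bounds[of y]
  by (intro mult_mono) auto

lemma f_0: "f 0 = 0"
  by (simp add: f_fun_def set_integral_point del: atLeastAtMost_singleton)

lemma f_eq: "f = (\<lambda>r. LBINT s:{0..r}. fp s)"
  by (simp add: f_fun_def fp_def fun_eq_iff)

lemma f_cont: "continuous_on {0..} f"
  unfolding f_eq
  by (intro indefinite_integral_cont continuous_indefinite_integrable fp_cont continuous_on_subset[OF fp_cont]) auto

lemma f_DERIV: "0 < r \<Longrightarrow> DERIV f r :> fp r"
  unfolding f_eq
  by (intro indefinite_integral_DERIV continuous_indefinite_integrable fp_cont continuous_on_subset[OF fp_cont]) auto

lemma f_strict_mono: "0 \<le> x \<Longrightarrow> x < y \<Longrightarrow> f x < f y"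
  using f_DERIV fp_pos by (intro strict_mono_from_DERIV[OF f_cont]) (auto intro: less_imp_le)

lemma f_mono: "0 \<le> x \<Longrightarrow> x \<le> y \<Longrightarrow> f x \<le> f y"
  using f_strict_mono[of x y] by (cases "x = y") auto

lemma f_nonneg: "0 \<le> x \<Longrightarrow> 0 \<le> f x"
  using f_mono[of 0 x] f_0 by simp

lemma f_pos: "0 < x \<Longrightarrow> 0 < f x"
  using f_strict_mono[of 0 x] f_0 by simp

lemma f_lipschitz: "0 \<le> y \<Longrightarrow> 0 \<le> q \<Longrightarrow> f (y + q) \<le> f y + q"
proof -
  assume yq: "0 \<le> y" "0 \<le> q"
  have "f (y + q) - (y + q) \<le> f y - y"
  proof (rule antimono_from_DERIV[where F="\<lambda>x. f x - x" and p=0])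
    show "continuous_on {0..} (\<lambda>x. f x - x)" by (intro continuous_intros f_cont)
    show "\<exists>y. DERIV (\<lambda>x. f x - x) r :> y \<and> y \<le> 0" if "0 < r" for r
      using fp_le_1[of r] that by (intro exI[of _ "fp r - 1"]) (auto intro!: derivative_eq_intros f_DERIV)
  qed (use yq in auto)
  then show ?thesis by simp
qed

lemma f_le_Phi: "0 \<le> r \<Longrightarrow> f r \<le> \<Phi> r"
proof -
  assume r: "0 \<le> r"
  have "f r - \<Phi> r \<le> f 0 - \<Phi> 0"
  proof (rule antimono_from_DERIV[where F="\<lambda>x. f x - \<Phi> x" and p=0])
    show "continuous_on {0..} (\<lambda>x. f x - \<Phi> x)" by (intro continuous_intros f_cont Phi_cont)
    show "\<exists>y. DERIV (\<lambda>x. f x - \<Phi> x) r :> y \<and> y \<le> 0" if "0 < r" for r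
      using fp_le_phi[of r] that by (intro exI[of _ "fp r - \<phi> r"]) (auto intro!: derivative_eq_intros f_DERIV Phi_DERIV)
  qed (use r in auto)
  then show ?thesis by (simp add: f_0 Phi_0)
qed

lemma f_concave:
  assumes "0 < x" "0 \<le> y"
  shows "f y \<le> f x + fp x * (y - x)"
  using below_tangent_parabola[OF f_cont f_DERIV assms, of 0] fp_antimono assms by auto

lemma phi_const:
  assumes "r0 \<le> r"
  shows "\<phi> r = \<phi> r0"
proof (cases "r0 = r")
  case False
  then have lt: "r0 < r" using assms by simp
  have c: "continuous_on {r0..r} \<phi>" by (rule continuous_on_subset[OF phi_cont]) (use r0_nonneg in auto)
  have d: "DERIV \<phi> x :> 0" if "r0 < x" "x < r" for x
    using phi_DERIV[of x] neg_zero[of x] that r0_nonneg by simp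
  show ?thesis by (rule DERIV_isconst_end[OF lt c d])
qed simp

lemma Phi_concave:
  assumes "0 < x" "0 \<le> y"
  shows "\<Phi> y \<le> \<Phi> x + \<phi> x * (y - x)"
  using below_tangent_parabola[OF Phi_cont Phi_DERIV assms, of 0] phi_antimono assms by auto

text \<open>The quotient \<open>\<Phi> x / x\<close> decreases, as for every concave function
  vanishing at 0.\<close>

lemma Phi_ratio:
  assumes "0 < x" "x \<le> y"
  shows "\<Phi> y \<le> y / x * \<Phi> x"
proof -
  have "x * \<phi> x \<le> \<Phi> x" using Phi_concave[of x 0] assms Phi_0 by (simp add: mult.commute)
  then have "\<phi> x \<le> \<Phi> x / x" using assms by (simp add: field_simps)
  then have "\<phi> x * (y - x) \<le> \<Phi> x / x * (y - x)" using assms by (intro mult_right_mono) auto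
  then have "\<Phi> y \<le> \<Phi> x + \<Phi> x / x * (y - x)" using Phi_concave[of x y] assms by simp
  also have "\<dots> = y / x * \<Phi> x" using assms by (simp add: field_simps)
  finally show ?thesis .
qed

text \<open>Beyond \<open>r0\<close> the function \<phi> is constant, and concavity gives (x - r0)
  \<phi> x \<le> \<Phi> x, so with \<open>r1\<close> replaced by x the left side grows at most as
  fast as the right one. The estimate links the condition defining \<open>R1\<close> to the rate
  1/N.\<close>

lemma N_lower: "(r1 - r0) * \<Phi> r1 \<le> 2 * \<phi> r0 * N"
proof -
  let ?L = "\<lambda>r. (r - r0) * \<Phi> r - 2 * \<phi> r0 * Quot r"
  have "?L r1 \<le> ?L r0"
  proof (rule DERIV_nonpos_antimono_except[where f="?L" and p=0])
    show "continuous_on {r0..r1} ?L"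
      by (intro continuous_intros continuous_on_subset[OF Phi_cont] continuous_on_subset[OF Quot_cont])
        (use r0_nonneg in auto)
    fix x assume x: "r0 < x" "x < r1"
    then have x0: "0 < x" using r0_nonneg by simp
    have p: "\<phi> x = \<phi> r0" by (rule phi_const) (use x in simp)
    have "DERIV ?L x :> (1 * \<Phi> x + \<phi> x * (x - r0)) - 2 * \<phi> r0 * quot x"
      by (auto intro!: derivative_eq_intros Phi_DERIV Quot_DERIV x0)
    moreover have "2 * \<phi> r0 * quot x = 2 * \<Phi> x"
      using phi_pos[of r0] by (simp add: quot_def p)
    moreover have "\<phi> x * (x - r0) \<le> \<Phi> x"
    proof -
      have "x * \<phi> x \<le> \<Phi> x" using Phi_concave[of x 0] x0 Phi_0 by (simp add: mult.commute)
      moreover have "0 \<le> \<phi> x * r0" using phi_pos[of x] r0_nonneg by simp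
      ultimately show ?thesis by (simp add: algebra_simps)
    qed
    ultimately show "\<exists>d. DERIV ?L x :> d \<and> d \<le> 0"
      by (intro exI[of _ "(1 * \<Phi> x + \<phi> x * (x - r0)) - 2 * \<phi> r0 * quot x"] conjI) (assumption, linarith)
  qed (use r1_gt in simp)
  moreover have "0 \<le> 2 * \<phi> r0 * Quot r0" using phi_pos[of r0] Quot_mono[of 0 r0] r0_nonneg Quot_0 by simp
  ultimately show ?thesis by simp
qed

text \<open>Below \<open>r1\<close> the derivative of \<phi> yields the first term and that of
  \<open>g\<close> contributes exactly -\<Phi>/(2N), where \<Phi> \<ge> f. Beyond \<open>r1\<close>
  the slope has the constant value \<phi> r0 / 2, so f'' = 0 and \<kappa> must pay alone: f/(2N) is
  at most r \<phi> r0 / (r1 (r1 - r0)), whereas the first term equals r \<kappa> \<phi> r0 / 8. This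
  is the origin of the 8 in \<open>R1\<close>.\<close>

lemma generator_bound:
  assumes r: "0 < r" "r \<noteq> r1"
  obtains d where "DERIV fp r :> d" "d \<le> r * \<kappa> r * fp r / 4 - f r / (2 * N)"
proof -
  have f\<Phi>: "f r \<le> \<Phi> r" using f_le_Phi r by simp
  show thesis
  proof (cases "r < r1")
    case True
    let ?d = "(- (1/4) * neg r * \<phi> r) * g r + (- (1/2) * (quot r / N)) * \<phi> r"
    have 1: "DERIV fp r :> ?d"
      unfolding fp_def[abs_def] by (rule DERIV_mult'[THEN DERIV_cong, OF phi_DERIV g_DERIV_less]) (use r True in auto)
    have "?d = - (neg r * fp r / 4) - \<Phi> r / (2 * N)"
      using phi_pos[of r] by (simp add: fp_def quot_def field_simps)
    also have "\<dots> \<le> r * \<kappa> r * fp r / 4 - f r / (2 * N)"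
    proof (rule diff_mono)
      have "- neg r \<le> r * \<kappa> r" using r by (simp add: neg_def max_def)
      then have "- neg r * fp r \<le> r * \<kappa> r * fp r" using fp_pos[of r] r by (intro mult_right_mono) auto
      then show "- (neg r * fp r / 4) \<le> r * \<kappa> r * fp r / 4" by simp
      show "f r / (2 * N) \<le> \<Phi> r / (2 * N)" using f\<Phi> N_pos by (intro divide_right_mono) auto
    qed
    finally show thesis using 1 that by blast
  next
    case False
    then have gt: "r1 < r" using r by simp
    have 1: "DERIV fp r :> 0"
      unfolding fp_def[abs_def] using phi_DERIV[of r] neg_zero[of r] r r1_gt gt g_DERIV_greater[OF gt]
      by (auto intro!: DERIV_mult'[THEN DERIV_cong])
    have fpr: "fp r = \<phi> r0 / 2" using g_ge_r1[of r] phi_const[of r] gt r1_gt by (simp add: fp_def)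
    define D where "D = r1 * (r1 - r0)"
    have D: "0 < D" using r1_gt by (simp add: D_def)
    have "f r / (2 * N) \<le> r * \<phi> r0 / D"
    proof -
      have "f r * D \<le> \<Phi> r * D" using f\<Phi> D by (intro mult_right_mono) auto
      also have "\<dots> \<le> (r / r1 * \<Phi> r1) * D" using Phi_ratio[of r1 r] gt r1_gt D by (intro mult_right_mono) auto
      also have "\<dots> = r * ((r1 - r0) * \<Phi> r1)" using r1_gt by (simp add: D_def)
      also have "\<dots> \<le> r * (2 * \<phi> r0 * N)" using N_lower r by (intro mult_left_mono) auto
      finally show ?thesis using D N_pos by (simp add: field_simps)
    qed
    also have "\<dots> \<le> r * \<kappa> r * fp r / 4"
    proof -
      have "8 \<le> \<kappa> r * D" using kappa_r1[OF gt] by (simp add: D_def mult.assoc)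
      then have "8 / D \<le> \<kappa> r" using D by (simp add: field_simps)
      then have "(r * \<phi> r0 / 8) * (8 / D) \<le> (r * \<phi> r0 / 8) * \<kappa> r" using r phi_pos[of r0] by (intro mult_left_mono) auto
      then show ?thesis unfolding fpr by (simp add: mult_ac)
    qed
    finally show thesis using 1 that[of 0] by simp
  qed
qed

text \<open>With \<gamma> = 1/N this is the bound of \<open>generator_bound\<close>; a smaller
  \<gamma> leaves a margin of (1/N - \<gamma>) f / 2 above it.\<close>

definition curv :: "real \<Rightarrow> real \<Rightarrow> real" where
  "curv \<gamma> r = r * \<kappa> r * fp r / 4 - \<gamma> / 2 * f r"

lemma curv_cont: "continuous_on {0<..} (curv \<gamma>)"
  unfolding curv_def by (intro continuous_intros cont continuous_on_subset[OF fp_cont] continuous_on_subset[OF f_cont]) auto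

text \<open>At \<open>r1\<close> the second derivative of \<open>f\<close> jumps. Since \<open>curv\<close> is continuous and dominates it on both
  sides, the second order upper bound needs no Ito-Tanaka argument.\<close>

lemma second_order_upper_bound:
  assumes \<gamma>: "\<gamma> < 1 / N" and \<delta>: "0 < \<delta>" "\<delta> \<le> R"
  obtains v0 where "0 < v0" "v0 \<le> \<delta>"
    "\<And>x v. \<delta> \<le> x \<Longrightarrow> x \<le> R \<Longrightarrow> \<bar>v\<bar> \<le> v0 \<Longrightarrow> f (x + v) \<le> f x + fp x * v + curv \<gamma> x / 2 * v\<^sup>2"
proof -
  \<comment> \<open>The margin of \<open>curv \<gamma>\<close> over the bound for f'' is at least
    \<eta> on [\<delta>/2, \<infinity>). Uniform continuity then lets the single value
    \<open>curv \<gamma> x\<close> dominate f'' throughout a neighbourhood of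
    \<open>x\<close>.\<close>
  define \<eta> where "\<eta> = (1 / N - \<gamma>) / 2 * f (\<delta> / 2)"
  have \<eta>: "0 < \<eta>" using \<gamma> f_pos[of "\<delta> / 2"] \<delta> by (simp add: \<eta>_def)
  have "continuous_on {\<delta>/2..R + \<delta>} (curv \<gamma>)" by (rule continuous_on_subset[OF curv_cont]) (use \<delta> in auto)
  then have "uniformly_continuous_on {\<delta>/2..R + \<delta>} (curv \<gamma>)" by (intro compact_uniformly_continuous) auto
  then obtain d where d: "0 < d" "\<forall>x\<in>{\<delta>/2..R + \<delta>}. \<forall>x'\<in>{\<delta>/2..R + \<delta>}. dist x' x < d \<longrightarrow> dist (curv \<gamma> x') (curv \<gamma> x) < \<eta>"
    using \<eta> unfolding uniformly_continuous_on_def by blast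
  \<comment> \<open>Half of \<delta> keeps the neighbourhood away from 0 and inside the compact
    interval; half of \<open>d\<close> gives the strict inequality in the modulus of
    continuity.\<close>
  define v0 where "v0 = min (\<delta> / 2) (d / 2)"
  have v0: "0 < v0" "v0 \<le> \<delta> / 2" "v0 < d" using \<delta> d by (auto simp: v0_def)
  have slope: "\<exists>y. DERIV fp z :> y \<and> y \<le> curv \<gamma> x"
    if x: "\<delta> \<le> x" "x \<le> R" and z: "\<bar>z - x\<bar> \<le> v0" "z \<noteq> r1" for x z
  proof -
    have mem: "z \<in> {\<delta>/2..R + \<delta>}" "x \<in> {\<delta>/2..R + \<delta>}" using x z v0 \<delta> by (auto simp: abs_le_iff)
    have z0: "0 < z" using mem \<delta> by auto
    obtain y where y: "DERIV fp z :> y" "y \<le> z * \<kappa> z * fp z / 4 - f z / (2 * N)"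
      using generator_bound[OF z0 z(2)] by blast
    have "z * \<kappa> z * fp z / 4 - f z / (2 * N) = curv \<gamma> z - (1 / N - \<gamma>) / 2 * f z"
      by (simp add: curv_def algebra_simps diff_divide_distrib)
    also have "\<dots> \<le> curv \<gamma> z - \<eta>"
      unfolding \<eta>_def using \<gamma> mem \<delta> by (intro diff_left_mono mult_left_mono f_mono) auto
    also have "\<dots> \<le> curv \<gamma> x"
    proof -
      have "dist z x < d" using z v0 by (simp add: dist_real_def)
      then have "dist (curv \<gamma> z) (curv \<gamma> x) < \<eta>" using d(2) mem by blast
      then show ?thesis by (auto simp: dist_real_def)
    qed
    finally show ?thesis using y by (intro exI[of _ y]) auto
  qed
  have D: "fp v \<le> fp u + curv \<gamma> x * (v - u)"
    if x: "\<delta> \<le> x" "x \<le> R" and uv: "x - v0 \<le> u" "u \<le> v" "v \<le> x + v0" for x u v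
  proof -
    have "fp v - curv \<gamma> x * v \<le> fp u - curv \<gamma> x * u"
    proof (rule DERIV_nonpos_antimono_except[OF uv(2), of "\<lambda>z. fp z - curv \<gamma> x * z" r1])
      show "continuous_on {u..v} (\<lambda>z. fp z - curv \<gamma> x * z)"
        by (intro continuous_intros continuous_on_subset[OF fp_cont]) (use x uv v0 \<delta> in auto)
      fix z assume z: "u < z" "z < v" "z \<noteq> r1"
      obtain y where "DERIV fp z :> y" "y \<le> curv \<gamma> x" using slope[of x z] x uv z by (auto simp: abs_le_iff)
      then show "\<exists>y. DERIV (\<lambda>z. fp z - curv \<gamma> x * z) z :> y \<and> y \<le> 0"
        by (intro exI[of _ "y - curv \<gamma> x"]) (auto intro!: derivative_eq_intros)
    qed
    then show ?thesis by (simp add: algebra_simps)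
  qed
  show thesis
  proof (rule that[of v0])
    show "0 < v0" "v0 \<le> \<delta>" using v0 \<delta> by auto
    fix x v assume x: "\<delta> \<le> x" "x \<le> R" and v: "\<bar>v\<bar> \<le> v0"
    have "f (x + v) \<le> f x + fp x * ((x + v) - x) + curv \<gamma> x / 2 * ((x + v) - x)\<^sup>2"
    proof (rule below_tangent_parabola[OF f_cont f_DERIV])
      show "0 < x" "0 \<le> x + v" using x \<delta> v v0 by auto
      show "fp z \<le> fp x + curv \<gamma> x * (z - x)" if "x \<le> z" "z \<le> x + v" for z
        using D[OF x, of x z] that v v0 by auto
      show "fp x + curv \<gamma> x * (z - x) \<le> fp z" if "x + v \<le> z" "z \<le> x" for z
        using D[OF x, of z x] that v v0 by (auto simp: algebra_simps)
    qed
    then show "f (x + v) \<le> f x + fp x * v + curv \<gamma> x / 2 * v\<^sup>2" by simp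
  qed
qed

text \<open>Additivity of the integral turns the quotient \<phi> t / \<phi> s inside \<Phi> s /
  \<phi> s into the exponential of a quarter of the integral over [t, s].\<close>

lemma N_double_integral:
  "N = (LBINT s:{0..r1}. (LBINT t:{0..s}. exp ((1/4) * (LBINT u:{t..s}. u * max (- \<kappa> u) 0))))"
proof -
  have "quot s = (LBINT t:{0..s}. exp ((1/4) * (LBINT u:{t..s}. u * max (- \<kappa> u) 0)))" if s: "0 \<le> s" for s
  proof -
    have "quot s = (1 / \<phi> s) * (LBINT t:{0..s}. \<phi> t)" by (simp add: quot_def Phi_def)
    also have "\<dots> = (LBINT t:{0..s}. (1 / \<phi> s) * \<phi> t)" by (rule set_integral_mult_right[symmetric])
    also have "\<dots> = (LBINT t:{0..s}. exp ((1/4) * (LBINT u:{t..s}. u * max (- \<kappa> u) 0)))"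
    proof (intro set_lebesgue_integral_cong allI impI)
      fix t assume t: "t \<in> {0..s}"
      have "(LBINT u:{0..s}. neg u) = (LBINT u:{0..t} \<union> {t..s}. neg u)"
        using t by (intro arg_cong2[where f="\<lambda>A f. set_lebesgue_integral lborel A f"]) auto
      also have "\<dots> = (LBINT u:{0..t}. neg u) + (LBINT u:{t..s}. neg u)"
      proof (rule set_integral_Un_AE)
        show "AE x in lborel. \<not> (x \<in> {0..t} \<and> x \<in> {t..s})"
          using AE_lborel_singleton[of t] by eventually_elim auto
        show "set_integrable lborel {t..s} neg" by (rule set_integrable_subset[OF neg_int[of s]]) (use t in auto)
      qed (use neg_int in auto)
      finally have "(LBINT u:{t..s}. neg u) = (LBINT u:{0..s}. neg u) - (LBINT u:{0..t}. neg u)" by simp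
      then have "exp ((1/4) * (LBINT u:{t..s}. neg u)) = exp ((1/4) * (LBINT u:{0..s}. neg u)) * exp (- (1/4) * (LBINT u:{0..t}. neg u))"
        unfolding exp_add[symmetric] by (simp add: algebra_simps)
      also have "\<dots> = (1 / \<phi> s) * \<phi> t" by (simp add: phi_eq exp_minus field_simps)
      finally show "(1 / \<phi> s) * \<phi> t = exp ((1/4) * (LBINT u:{t..s}. u * max (- \<kappa> u) 0))" by (simp add: neg_def)
    qed auto
    finally show ?thesis .
  qed
  then show ?thesis unfolding Quot_def by (intro set_lebesgue_integral_cong) auto
qed

end

section \<open>Contraction\<close>

context kappa_profile
begin

text \<open>For negative arguments the integration set is empty and the functions take their value
  at 0; hence they extend continuously, and so are Borel on the whole line.\<close>

lemma set_integral_max_0: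
  fixes F :: "real \<Rightarrow> real"
  shows "(LBINT s:{0..r}. F s) = (LBINT s:{0..max 0 r}. F s)"
proof (cases "0 \<le> r")
  case False
  then have "max 0 r = 0" "{0..r} = {}" by auto
  then show ?thesis using set_integral_point[of 0 F] by (simp only:) (simp add: set_lebesgue_integral_def)
qed (simp add: max_def)

lemma f_max_0: "f r = f (max 0 r)"
  unfolding f_fun_def by (rule set_integral_max_0)

lemma fp_max_0: "fp r = fp (max 0 r)"
proof -
  have "\<phi> r = \<phi> (max 0 r)"
    unfolding phi_def by (subst set_integral_max_0) (rule refl)
  moreover have "min (max 0 r) r1 = max 0 (min r r1)" using r1_gt by auto
  then have "g r = g (max 0 r)"
    unfolding g_eq Quot_def by (subst set_integral_max_0) simp
  ultimately show ?thesis by (simp only: fp_def)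
qed

lemma f_borel: "f \<in> borel_measurable borel"
proof -
  have "continuous_on UNIV (\<lambda>r. f (max 0 r))"
    by (intro continuous_on_compose2[OF f_cont] continuous_intros) auto
  then have "(\<lambda>r. f (max 0 r)) \<in> borel_measurable borel" by (rule borel_measurable_continuous_onI)
  then show ?thesis by (subst f_max_0[abs_def])
qed

lemma fp_borel: "fp \<in> borel_measurable borel"
proof -
  have "continuous_on UNIV (\<lambda>r. fp (max 0 r))"
    by (intro continuous_on_compose2[OF fp_cont] continuous_intros) auto
  then have "(\<lambda>r. fp (max 0 r)) \<in> borel_measurable borel" by (rule borel_measurable_continuous_onI)
  then show ?thesis by (subst fp_max_0[abs_def])
qed

lemma curv_borel: "(\<lambda>r. indicator {0<..} r *\<^sub>R curv \<gamma> r) \<in> borel_measurable borel"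
  by (rule borel_measurable_continuous_on_indicator) (auto intro: curv_cont)

end

locale contractive_reflection_pair = reflection_pair M F B G \<sigma> b X Y I + kappa_profile \<kappa>
  for M :: "'w measure" and F and B :: "real \<Rightarrow> 'w \<Rightarrow> real^'d" and G \<sigma> :: "real^'d^'d"
    and b and X Y I :: "real \<Rightarrow> 'w \<Rightarrow> real^'d" and \<kappa> +
  assumes kappa_le: "\<And>x y. x \<noteq> y \<Longrightarrow> \<kappa> (Gnorm G (x - y)) \<le>
      - 2 * ((norm (matrix_inv \<sigma> *v (x - y)))\<^sup>2 / (Gnorm G (x - y))\<^sup>2)
          * (((x - y) \<bullet> (G *v (b x - b y))) / (Gnorm G (x - y))\<^sup>2)"
    and merged: "AE \<omega> in M. \<forall>t\<ge>0. coupling_time X Y \<omega> \<le> ereal t \<longrightarrow> Y t \<omega> = X t \<omega>"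
begin

text \<open>The definition of \<kappa> bounds the drift by the first part of the second order term
  with the opposite sign, so the two cancel. What remains is -\<gamma> f \<rho>^2/w with w =
  |\<sigma>^{-1}(x - y)|^2, and \<open>alpha_bound\<close> turns \<rho>^2/w into the factor
  1/\<open>alpha\<close>.\<close>

lemma generator_le:
  assumes xy: "x \<noteq> y" and \<gamma>: "0 < \<gamma>"
  shows "fp (Gnorm G (x - y)) / Gnorm G (x - y) * ((x - y) \<bullet> (G *v (b x - b y)))
       + 2 * curv \<gamma> (Gnorm G (x - y)) * (Gnorm G (x - y))\<^sup>2 / (norm (matrix_inv \<sigma> *v (x - y)))\<^sup>2
     \<le> - (\<gamma> / alpha \<sigma> G) * f (Gnorm G (x - y))"
proof -
  define \<rho> where "\<rho> = Gnorm G (x - y)"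
  define w where "w = (norm (matrix_inv \<sigma> *v (x - y)))\<^sup>2"
  define p where "p = (x - y) \<bullet> (G *v (b x - b y))"
  have nz: "x - y \<noteq> 0" using xy by simp
  have \<rho>: "0 < \<rho>" using Gnorm_pos[OF nz] by (simp add: \<rho>_def)
  have w: "0 < w" using sigma_inv_nonzero[OF nz] by (simp add: w_def)
  have \<alpha>: "0 < alpha \<sigma> G" by (rule alpha_pos)
  have w\<alpha>: "w \<le> alpha \<sigma> G * \<rho>\<^sup>2" unfolding w_def \<rho>_def by (rule alpha_bound)
  have "\<kappa> \<rho> \<le> - 2 * (w / \<rho>\<^sup>2) * (p / \<rho>\<^sup>2)" using kappa_le[OF xy] unfolding \<rho>_def w_def p_def .
  also have "\<dots> = - (2 * w / \<rho> ^ 4) * p" by (simp add: power4_eq_xxxx power2_eq_square)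
  finally have \<kappa>p: "\<kappa> \<rho> * \<rho> ^ 4 \<le> - (2 * w) * p" using \<rho> by (simp add: field_simps)
  have "fp \<rho> / \<rho> * p \<le> - (\<kappa> \<rho> * fp \<rho> * \<rho> ^ 3 / (2 * w))"
  proof -
    have "(fp \<rho> / (\<rho> * (2 * w))) * (\<kappa> \<rho> * \<rho> ^ 4) \<le> (fp \<rho> / (\<rho> * (2 * w))) * (- (2 * w) * p)"
      using fp_pos[of \<rho>] \<rho> w by (intro mult_left_mono \<kappa>p) auto
    moreover have "(fp \<rho> / (\<rho> * (2 * w))) * (\<kappa> \<rho> * \<rho> ^ 4) = \<kappa> \<rho> * fp \<rho> * \<rho> ^ 3 / (2 * w)"
      using \<rho> by (simp add: power4_eq_xxxx power3_eq_cube)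
    moreover have "(fp \<rho> / (\<rho> * (2 * w))) * (- (2 * w) * p) = - (fp \<rho> / \<rho> * p)" using w by simp
    ultimately show ?thesis by linarith
  qed
  moreover have "2 * curv \<gamma> \<rho> * \<rho>\<^sup>2 / w = \<kappa> \<rho> * fp \<rho> * \<rho> ^ 3 / (2 * w) - \<gamma> * f \<rho> * (\<rho>\<^sup>2 / w)"
    by (simp add: curv_def power2_eq_square power3_eq_cube add_divide_distrib diff_divide_distrib algebra_simps)
  moreover have "\<gamma> / alpha \<sigma> G * f \<rho> \<le> \<gamma> * f \<rho> * (\<rho>\<^sup>2 / w)"
  proof -
    have "1 / alpha \<sigma> G \<le> \<rho>\<^sup>2 / w" using w\<alpha> w \<alpha> by (simp add: field_simps)
    then have "(\<gamma> * f \<rho>) * (1 / alpha \<sigma> G) \<le> (\<gamma> * f \<rho>) * (\<rho>\<^sup>2 / w)"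
      using \<gamma> f_nonneg[of \<rho>] \<rho> by (intro mult_left_mono) auto
    then show ?thesis by simp
  qed
  ultimately show ?thesis unfolding \<rho>_def[symmetric] w_def[symmetric] p_def[symmetric] by linarith
qed

text \<open>The step constants depend on \<open>m\<close>, but they disappear in the limit along
  grids and the rate does not involve \<open>m\<close>. With the whole space on the right the bound
  is ready for m \<rightarrow> \<infinity>.\<close>

lemma expected_distance_on_stay:
  fixes m :: real
  assumes m: "0 < m" and \<gamma>: "0 < \<gamma>" "\<gamma> < 1 / N" and st: "0 \<le> s" "s \<le> t"
  shows "(\<integral>\<^sup>+\<omega>\<in>stay m t. ennreal (f (Gnorm G (Z t \<omega>))) \<partial>M)
    \<le> ennreal (exp (- (\<gamma> / alpha \<sigma> G * (t - s)))) * (\<integral>\<^sup>+\<omega>. ennreal (f (Gnorm G (Z s \<omega>))) \<partial>M)"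
proof -
  obtain l0 u where u: "0 < l0" "0 < u" "\<And>z. l0 * norm z \<le> Gnorm G z" "\<And>z. Gnorm G z \<le> u * norm z"
    by (rule Gnorm_bounds) (rule that)
  obtain L where L: "0 < L" "\<And>x y. inside m x y \<Longrightarrow> norm (b x - b y) \<le> L"
    by (rule inside_drift_bound) (rule that)
  define \<delta> where "\<delta> = 1 / m"
  \<comment> \<open>The maximum with \<delta> secures \<delta> \<le> R even if no pair of points
    lies inside the region.\<close>
  define R where "R = max \<delta> (u * (2 * m))"
  have \<delta>: "0 < \<delta>" "\<delta> \<le> R" using m by (auto simp: \<delta>_def R_def)
  have in\<delta>: "\<delta> \<le> Gnorm G (x - y) \<and> Gnorm G (x - y) \<le> R" if i: "inside m x y" for x y
  proof
    show "\<delta> \<le> Gnorm G (x - y)" using i m by (simp add: inside_def \<delta>_def field_simps)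
    have "norm (x - y) \<le> 2 * m" using i norm_triangle_ineq4[of x y] by (auto simp: inside_def)
    then have "Gnorm G (x - y) \<le> u * (2 * m)" using u(4)[of "x - y"] u(2) mult_left_mono[of "norm (x - y)" "2 * m" u] by linarith
    then show "Gnorm G (x - y) \<le> R" by (simp add: R_def)
  qed
  \<comment> \<open>Continuity of \<open>curv\<close> is known for positive arguments; the value 0
    elsewhere makes it Borel without changing it on [\<delta>, R].\<close>
  define h where "h = (\<lambda>r. indicator {0<..} r *\<^sub>R curv \<gamma> r)"
  have h_eq: "h r = curv \<gamma> r" if "\<delta> \<le> r" for r using that \<delta> by (simp add: h_def)
  obtain H0 where H0: "0 < H0" "\<And>r. \<delta> \<le> r \<Longrightarrow> r \<le> R \<Longrightarrow> \<bar>h r\<bar> \<le> H0"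
  proof -
    have "compact (curv \<gamma> ` {\<delta>..R})"
      by (intro compact_continuous_image continuous_on_subset[OF curv_cont]) (use \<delta> in auto)
    then obtain H0 where "0 < H0" "\<forall>v\<in>curv \<gamma> ` {\<delta>..R}. norm v \<le> H0"
      using compact_imp_bounded bounded_pos by blast
    then show ?thesis using h_eq by (intro that[of H0]) auto
  qed
  obtain v0 where v0: "0 < v0" "v0 \<le> \<delta>"
    "\<And>x v. \<delta> \<le> x \<Longrightarrow> x \<le> R \<Longrightarrow> \<bar>v\<bar> \<le> v0 \<Longrightarrow> f (x + v) \<le> f x + fp x * v + curv \<gamma> x / 2 * v\<^sup>2"
    by (rule second_order_upper_bound[OF \<gamma>(2) \<delta>]) (rule that)
  have radial: "\<exists>K\<ge>0. \<forall>\<rho> a p N r'. \<delta> \<le> \<rho> \<longrightarrow> \<rho> \<le> R \<longrightarrow> 0 \<le> r' \<longrightarrow> \<bar>p\<bar> \<le> N \<longrightarrow>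
       r'\<^sup>2 = ((1 + a) * \<rho>)\<^sup>2 + 2 * ((1 + a) * \<rho>) * p + N\<^sup>2 \<longrightarrow>
       f r' \<le> f \<rho> + fp \<rho> * (\<rho> * a + p) + h \<rho> / 2 * (\<rho> * a)\<^sup>2 + \<theta> * a\<^sup>2 + K * (a ^ 4 + N\<^sup>2)" if \<theta>: "0 < \<theta>" for \<theta>
  proof (rule radial_step[OF \<delta> v0(1,2) less_imp_le[OF H0(1)] \<theta>, of f fp h])
    show "f x \<le> f y" if "0 \<le> x" "x \<le> y" for x y using that by (rule f_mono)
    show "f (y + q) \<le> f y + q" if "0 \<le> y" "0 \<le> q" for y q using that by (rule f_lipschitz)
    show "f y \<le> f x + fp x * (y - x)" if "\<delta> \<le> x" "x \<le> R" "0 \<le> y" for x y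
      using that \<delta> by (intro f_concave) auto
    show "0 \<le> fp x \<and> fp x \<le> 1" if "\<delta> \<le> x" "x \<le> R" for x
      using fp_pos[of x] fp_le_1[of x] that \<delta> by simp
    show "\<bar>h x\<bar> \<le> H0" if "\<delta> \<le> x" "x \<le> R" for x using that by (rule H0(2))
    show "f (x + v) \<le> f x + fp x * v + h x / 2 * v\<^sup>2" if "\<delta> \<le> x" "x \<le> R" "\<bar>v\<bar> \<le> v0" for x v
      using v0(3)[OF that] h_eq[OF that(1)] by simp
  qed blast
  define U where "U = (\<lambda>t. expectation (\<lambda>\<omega>. indicator (stay m t) \<omega> * f (Gnorm G (Z t \<omega>))))"
  define c where "c = \<gamma> / alpha \<sigma> G"
  have c: "0 < c" using \<gamma> alpha_pos by (simp add: c_def)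
  have step: "\<exists>K\<ge>0. \<forall>s t. 0 \<le> s \<longrightarrow> s \<le> t \<longrightarrow>
      U t \<le> (1 - c * (t - s)) * U s + \<theta> * (t - s) + K * ((t - s)\<^sup>2 + enn2real (err L m s t))" if \<theta>: "0 < \<theta>" for \<theta>
    unfolding U_def
  proof (rule one_step[where h=h and R=R, OF m L \<delta>(1) in\<delta> _ f_borel fp_borel _ _ _ _ _ radial _ \<theta>])
    show "0 \<le> f y" if "0 \<le> y" for y using that by (rule f_nonneg)
    show "h \<in> borel_measurable borel" unfolding h_def by (rule curv_borel)
    show "f \<rho> \<le> f R" if "\<delta> \<le> \<rho>" "\<rho> \<le> R" for \<rho> using that \<delta> by (intro f_mono) auto
    show "0 \<le> fp x \<and> fp x \<le> 1" if "\<delta> \<le> x" "x \<le> R" for x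
      using fp_pos[of x] fp_le_1[of x] that \<delta> by simp
    show "0 \<le> H0" using H0 by simp
    show "\<bar>h x\<bar> \<le> H0" if "\<delta> \<le> x" "x \<le> R" for x using that by (rule H0(2))
    show "fp (Gnorm G (x - y)) / Gnorm G (x - y) * ((x - y) \<bullet> (G *v (b x - b y)))
       + 2 * h (Gnorm G (x - y)) * (Gnorm G (x - y))\<^sup>2 / (norm (matrix_inv \<sigma> *v (x - y)))\<^sup>2 \<le> - c * f (Gnorm G (x - y))"
      if "inside m x y" for x y
      using generator_le[of x y \<gamma>] inside_nonzero[OF that] in\<delta>[OF that] h_eq \<gamma> unfolding c_def by simp
  qed
  have Unn: "0 \<le> U t" for t
    unfolding U_def using f_nonneg[OF Gnorm_nonneg] by (intro integral_nonneg_AE AE_I2) simp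
  have main: "U t \<le> exp (- (c * (t - s))) * U s"
    by (rule stay_decay[OF L(1) c Unn step st])
  have nn: "(\<integral>\<^sup>+\<omega>\<in>stay m t. ennreal (f (Gnorm G (Z t \<omega>))) \<partial>M) = ennreal (U t)" if t: "0 \<le> t" for t
  proof -
    have [measurable]: "X t \<in> borel_measurable M" "Y t \<in> borel_measurable M" "stay m t \<in> sets M" "f \<in> borel_measurable borel"
      by (fact measurable_F_M[OF X_F[OF t]] measurable_F_M[OF Y_F[OF t]] sets_F_M[OF stay_sets[OF t]] f_borel)+
    have "integrable M (\<lambda>\<omega>. indicator (stay m t) \<omega> * f (Gnorm G (Z t \<omega>)))"
    proof (rule integrable_const_bound[of _ "f R"])
      have "norm (indicat_real (stay m t) \<omega> * f (Gnorm G (Z t \<omega>))) \<le> f R" for \<omega>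
      proof (cases "\<omega> \<in> stay m t")
        case True
        then have "inside m (X t \<omega>) (Y t \<omega>)" using t by (auto simp: stay_def)
        then have "f (Gnorm G (Z t \<omega>)) \<le> f R" using in\<delta> by (intro f_mono Gnorm_nonneg) auto
        then show ?thesis using True f_nonneg[OF Gnorm_nonneg, of "Z t \<omega>"] by simp
      qed (use f_nonneg[of R] \<delta> in simp)
      then show "AE \<omega> in M. norm (indicat_real (stay m t) \<omega> * f (Gnorm G (Z t \<omega>))) \<le> f R" by simp
    qed measurable
    then have "ennreal (U t) = (\<integral>\<^sup>+\<omega>. ennreal (indicator (stay m t) \<omega> * f (Gnorm G (Z t \<omega>))) \<partial>M)"
      unfolding U_def using f_nonneg[OF Gnorm_nonneg] by (intro nn_integral_eq_integral[symmetric]) auto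
    also have "\<dots> = (\<integral>\<^sup>+\<omega>\<in>stay m t. ennreal (f (Gnorm G (Z t \<omega>))) \<partial>M)"
      by (intro nn_integral_cong) (auto split: split_indicator)
    finally show ?thesis ..
  qed
  have t: "0 \<le> t" using st by simp
  have "(\<integral>\<^sup>+\<omega>\<in>stay m t. ennreal (f (Gnorm G (Z t \<omega>))) \<partial>M) \<le> ennreal (exp (- (c * (t - s))) * U s)"
    unfolding nn[OF t] by (rule ennreal_leI[OF main])
  also have "\<dots> = ennreal (exp (- (c * (t - s)))) * (\<integral>\<^sup>+\<omega>\<in>stay m s. ennreal (f (Gnorm G (Z s \<omega>))) \<partial>M)"
    unfolding nn[OF st(1)] by (simp add: ennreal_mult Unn)
  also have "\<dots> \<le> ennreal (exp (- (c * (t - s)))) * (\<integral>\<^sup>+\<omega>. ennreal (f (Gnorm G (Z s \<omega>))) \<partial>M)"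
    by (intro mult_left_mono nn_integral_mono) (auto split: split_indicator)
  finally show ?thesis by (simp add: c_def)
qed

lemma expected_distance_decay:
  assumes \<gamma>: "0 < \<gamma>" "\<gamma> < 1 / N" and st: "0 \<le> s" "s \<le> t"
  shows "(\<integral>\<^sup>+\<omega>. ennreal (f (Gnorm G (Z t \<omega>))) \<partial>M)
    \<le> ennreal (exp (- (\<gamma> / alpha \<sigma> G * (t - s)))) * (\<integral>\<^sup>+\<omega>. ennreal (f (Gnorm G (Z s \<omega>))) \<partial>M)"
proof -
  have t: "0 \<le> t" using st by simp
  let ?h = "\<lambda>n \<omega>. ennreal (f (Gnorm G (Z t \<omega>))) * indicator (stay (real (Suc n)) t) \<omega>"
  have [measurable]: "X t \<in> borel_measurable M" "Y t \<in> borel_measurable M" "f \<in> borel_measurable borel"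
    by (fact measurable_F_M[OF X_F[OF t]] measurable_F_M[OF Y_F[OF t]] f_borel)+
  have [measurable]: "stay (real (Suc n)) t \<in> sets M" for n by (rule sets_F_M[OF stay_sets[OF t]])
  have inc: "incseq ?h"
  proof (rule incseq_SucI, rule le_funI)
    fix n \<omega>
    have "stay (real (Suc n)) t \<subseteq> stay (real (Suc (Suc n))) t" by (rule stay_mono) simp
    then show "?h n \<omega> \<le> ?h (Suc n) \<omega>" by (auto split: split_indicator)
  qed
  have "AE \<omega> in M. ennreal (f (Gnorm G (Z t \<omega>))) = (SUP n. ?h n \<omega>)"
    using merged AE_space
  proof eventually_elim
    case (elim \<omega>)
    show ?case
    proof (cases "ereal t < coupling_time X Y \<omega>")
      case True
      obtain n where n: "\<omega> \<in> stay (real (Suc n)) t" by (rule stay_exhausts[OF elim(2) t True])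
      show ?thesis
      proof (rule antisym)
        have "ennreal (f (Gnorm G (Z t \<omega>))) = ?h n \<omega>" using n by simp
        also have "\<dots> \<le> (SUP n. ?h n \<omega>)" by (rule SUP_upper) simp
        finally show "ennreal (f (Gnorm G (Z t \<omega>))) \<le> (SUP n. ?h n \<omega>)" .
        show "(SUP n. ?h n \<omega>) \<le> ennreal (f (Gnorm G (Z t \<omega>)))"
          by (rule SUP_least) (auto split: split_indicator)
      qed
    next
      case False
      then have "Y t \<omega> = X t \<omega>" using elim(1) t by auto
      then show ?thesis by (simp add: f_0)
    qed
  qed
  then have "(\<integral>\<^sup>+\<omega>. ennreal (f (Gnorm G (Z t \<omega>))) \<partial>M) = (\<integral>\<^sup>+\<omega>. (SUP n. ?h n \<omega>) \<partial>M)"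
    by (rule nn_integral_cong_AE)
  also have "\<dots> = (SUP n. \<integral>\<^sup>+\<omega>. ?h n \<omega> \<partial>M)"
    by (rule nn_integral_monotone_convergence_SUP[OF inc]) measurable
  also have "\<dots> \<le> ennreal (exp (- (\<gamma> / alpha \<sigma> G * (t - s)))) * (\<integral>\<^sup>+\<omega>. ennreal (f (Gnorm G (Z s \<omega>))) \<partial>M)"
    by (rule SUP_least) (rule expected_distance_on_stay[OF _ \<gamma> st], simp)
  finally show ?thesis .
qed

text \<open>Nonnegative integrals admit an infinite expected distance at time \<open>s\<close>; the
  right side is then infinite. Otherwise \<gamma> increases to 1/N in the decay bound, and the
  exponentials at \<open>s\<close> and \<open>t\<close> are separated.\<close>

lemma contraction:
  assumes st: "0 \<le> s" "s \<le> t"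
  shows "ennreal (exp (1 / (alpha \<sigma> G * N) * t)) * (\<integral>\<^sup>+\<omega>. ennreal (f (Gnorm G (Z t \<omega>))) \<partial>M)
    \<le> ennreal (exp (1 / (alpha \<sigma> G * N) * s)) * (\<integral>\<^sup>+\<omega>. ennreal (f (Gnorm G (Z s \<omega>))) \<partial>M)"
proof -
  let ?V = "\<lambda>t. \<integral>\<^sup>+\<omega>. ennreal (f (Gnorm G (Z t \<omega>))) \<partial>M"
  define c where "c = 1 / (alpha \<sigma> G * N)"
  show ?thesis
  proof (cases "?V s")
    case top
    then show ?thesis by (simp add: ennreal_mult_top)
  next
    case (real v)
    have dec: "?V t \<le> ennreal (exp (- (\<gamma> / alpha \<sigma> G * (t - s))) * v)" if "0 < \<gamma>" "\<gamma> < 1 / N" for \<gamma>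
      using expected_distance_decay[OF that st] real by (simp add: ennreal_mult)
    have N2: "0 < 1 / (2 * N)" "1 / (2 * N) < 1 / N" using N_pos by (auto simp: field_simps)
    \<comment> \<open>One admissible \<gamma> is enough to see that the expectation at time
      \<open>t\<close> is finite, which allows the limit to be taken in the reals.\<close>
    obtain w where w: "0 \<le> w" "?V t = ennreal w"
      using dec[OF N2] by (cases "?V t") (auto simp: top_unique)
    have "w \<le> exp (- (1 / N / alpha \<sigma> G * (t - s))) * v"
    proof (rule tendsto_lowerbound)
      show "((\<lambda>\<gamma>. exp (- (\<gamma> / alpha \<sigma> G * (t - s))) * v) \<longlongrightarrow> exp (- (1 / N / alpha \<sigma> G * (t - s))) * v) (at_left (1 / N))"
        using alpha_pos by (intro tendsto_intros) auto
      show "eventually (\<lambda>\<gamma>. w \<le> exp (- (\<gamma> / alpha \<sigma> G * (t - s))) * v) (at_left (1 / N))"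
        unfolding eventually_at_left_field
      proof (intro exI conjI allI impI)
        show "1 / (2 * N) < 1 / N" by (rule N2)
        fix \<gamma> assume "1 / (2 * N) < \<gamma>" "\<gamma> < 1 / N"
        then have "ennreal w \<le> ennreal (exp (- (\<gamma> / alpha \<sigma> G * (t - s))) * v)"
          using dec[of \<gamma>] N2 w by simp
        then show "w \<le> exp (- (\<gamma> / alpha \<sigma> G * (t - s))) * v" using real(1) by (simp add: ennreal_le_iff)
      qed
    qed simp
    also have "1 / N / alpha \<sigma> G * (t - s) = c * t - c * s" by (simp add: c_def diff_divide_distrib mult.commute)
    finally have "exp (c * t) * w \<le> exp (c * t) * (exp (- (c * t - c * s)) * v)" by (intro mult_left_mono) auto
    also have "\<dots> = exp (c * s) * v" by (simp add: mult.assoc[symmetric] exp_add[symmetric])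
    finally have "ennreal (exp (c * t) * w) \<le> ennreal (exp (c * s) * v)" by (rule ennreal_leI)
    then show ?thesis unfolding c_def[symmetric] real(2) w(2) using w(1) real(1) by (simp add: ennreal_mult)
  qed
qed

end

theorem theorem1:
  fixes \<sigma> G :: "real^'d^'d" and b :: "real^'d \<Rightarrow> real^'d"
    and M :: "'w measure" and F :: "real \<Rightarrow> 'w measure"
    and B X Y :: "real \<Rightarrow> 'w \<Rightarrow> real^'d"
    and \<kappa> :: "real \<Rightarrow> real" and c :: real
  assumes "det \<sigma> > 0"
    and "transpose G = G" and "\<And>z. z \<noteq> 0 \<Longrightarrow> z \<bullet> (G *v z) > 0"
    and "local_lipschitz (UNIV :: real set) UNIV (\<lambda>_. b)"
    and "brownian_motion M F B"
    and "non_explosive M F b \<sigma> B"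
    and "\<kappa> = kappa \<sigma> G b"
    and "\<And>r. r > 0 \<Longrightarrow> bdd_below (kappa_values \<sigma> G b r)"
    and "continuous_on {0<..} \<kappa>"
    and "Liminf at_top (\<lambda>r. ereal (\<kappa> r)) > 0"
    and "set_integrable lborel {0<..1} (\<lambda>r. r * max (- \<kappa> r) 0)"
    and "c = contraction_rate \<sigma> G \<kappa>"
    and "reflection_coupling M F b \<sigma> B X Y"
  shows "c > 0 \<and>
    1 / c = alpha \<sigma> G * (LBINT s:{0..R1 \<kappa>}. Phi \<kappa> s / phi \<kappa> s) \<and>
    1 / c = alpha \<sigma> G * (LBINT s:{0..R1 \<kappa>}. (LBINT t:{0..s}.
                   exp ((1/4) * (LBINT u:{t..s}. u * max (- \<kappa> u) 0)))) \<and>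
    antimono_on {0..} (\<lambda>t. ennreal (exp (c * t)) * (\<integral>\<^sup>+ \<omega>. ennreal (d_f G \<kappa> (X t \<omega>) (Y t \<omega>)) \<partial>M))"
proof -
  obtain I where coup: "sde_solution M F b \<sigma> B X" "adapted F Y"
    "\<forall>\<omega>\<in>space M. continuous_on {0..} (\<lambda>t. X t \<omega>) \<and> continuous_on {0..} (\<lambda>t. Y t \<omega>)"
    "is_ito_integral M F B
            (\<lambda>s \<omega>. if ereal s < coupling_time X Y \<omega>
                    then \<sigma> ** reflection_mat (reflection_dir \<sigma> (X s \<omega> - Y s \<omega>)) else 0) I"
    "AE \<omega> in M. \<forall>t\<ge>0. ereal t < coupling_time X Y \<omega> \<longrightarrow>
             Y t \<omega> = Y 0 \<omega> + (LBINT s:{0..t}. b (Y s \<omega>)) + I t \<omega>"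
    "AE \<omega> in M. \<forall>t\<ge>0. coupling_time X Y \<omega> \<le> ereal t \<longrightarrow> Y t \<omega> = X t \<omega>"
    using assms(13) unfolding reflection_coupling_def by blast
  have b_cont: "continuous_on UNIV b"
    using local_lipschitz_continuous_on[OF assms(4), of 0] by simp
  interpret diffusion_matrices G \<sigma>
    by unfold_locales (use assms(1-3) in auto)
  interpret contractive_reflection_pair M F B G \<sigma> b X Y I \<kappa>
  proof
    show "brownian_motion M F B" by (rule assms(5))
    show "continuous_on UNIV b" by (rule b_cont)
    show "X t \<in> borel_measurable (F t)" if "0 \<le> t" for t
      using coup(1) that by (auto simp: sde_solution_def adapted_def)
    show "Y t \<in> borel_measurable (F t)" if "0 \<le> t" for t
      using coup(2) that by (auto simp: adapted_def)
    show "continuous_on {0..} (\<lambda>t. X t \<omega>)" "continuous_on {0..} (\<lambda>t. Y t \<omega>)" if "\<omega> \<in> space M" for \<omega>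
      using coup(3) that by auto
    show "AE \<omega> in M. \<forall>t\<ge>0. X t \<omega> = X 0 \<omega> + (LBINT s:{0..t}. b (X s \<omega>)) + \<sigma> *v B t \<omega>"
      using coup(1) unfolding sde_solution_def by (auto elim: eventually_mono)
    show "\<kappa> (Gnorm G (x - y)) \<le>
      - 2 * ((norm (matrix_inv \<sigma> *v (x - y)))\<^sup>2 / (Gnorm G (x - y))\<^sup>2)
          * (((x - y) \<bullet> (G *v (b x - b y))) / (Gnorm G (x - y))\<^sup>2)" if "x \<noteq> y" for x y
      unfolding assms(7) kappa_def
    \<comment> \<open>The infimum of a set of reals is a lower bound only when the set is bounded
      below; this is the part of the hypotheses that makes \<kappa> real-valued.\<close>
    proof (rule cInf_lower)
      show "bdd_below (kappa_values \<sigma> G b (Gnorm G (x - y)))" using that by (intro assms(8) Gnorm_pos) simp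
    qed (auto simp: kappa_values_def)
  qed (fact coup assms)+
  have N: "(LBINT s:{0..R1 \<kappa>}. Phi \<kappa> s / phi \<kappa> s) = N" by (simp add: Quot_def quot_def)
  have c: "c = 1 / (alpha \<sigma> G * N)" unfolding assms(12) contraction_rate_def N ..
  show ?thesis
  proof (intro conjI)
    show "0 < c" unfolding c using alpha_pos N_pos by simp
    show "1 / c = alpha \<sigma> G * (LBINT s:{0..R1 \<kappa>}. Phi \<kappa> s / phi \<kappa> s)" unfolding N c by simp
    show "1 / c = alpha \<sigma> G * (LBINT s:{0..R1 \<kappa>}. (LBINT t:{0..s}.
                   exp ((1/4) * (LBINT u:{t..s}. u * max (- \<kappa> u) 0))))"
      unfolding N_double_integral[symmetric] c by simp
    show "antimono_on {0..} (\<lambda>t. ennreal (exp (c * t)) * (\<integral>\<^sup>+ \<omega>. ennreal (d_f G \<kappa> (X t \<omega>) (Y t \<omega>)) \<partial>M))"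
      unfolding c d_f_def by (intro monotone_onI contraction) auto
  qed
qed

end
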